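(* Let $\nu\in ID$ and let $\alpha,\beta>0$ with $\alpha\neq\beta$. Define $$r_{(\alpha,\beta)}(u):=\frac{\beta}{\beta-\alpha}\,u^{\alpha}-\frac{\alpha}{\beta-\alpha}\,u^{\beta},\qquad u\in[0,1].$$ Then $r_{(\alpha,\beta)}:[0,1]\to[0,1]$ is a continuous strictly increasing time change, it is symmetric in $\alpha$ and $\beta$, that is, $r_{(\alpha,\beta)}(u)=r_{(\beta,\alpha)}(u)$, and $$\mathcal{J}^{\alpha}\bigl(\mathcal{J}^{\beta}(\nu)\bigr)=\mathcal{L}\Bigl(\int_0^1 u\,dY_{\nu}\bigl(r_{(\alpha,\beta)}(u)\bigr)\Bigr)=\mathcal{L}\Bigl(\int_0^1 r_{(\alpha,\beta)}^{-1}(u)\,dY_{\nu}(u)\Bigr),$$ where $r_{(\alpha,\beta)}^{-1}$ denotes the inverse function of $r_{(\alpha,\beta)}$.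
   Context: $ID$ is the set of all infinitely divisible Borel probability measures on $\mathbb{R}^d$. $\mathcal{L}(X)$ denotes the probability distribution of a random vector $X$. For $\nu\in ID$, $(Y_\nu(t))_{t\ge 0}$ denotes an $\mathbb{R}^d$-valued Lévy process with $\mathcal{L}(Y_\nu(1))=\nu$, i.e. a process starting from zero, with stationary and independent increments, and with paths that are right continuous with finite left limits. Random integrals are defined pathwise by formal integration by parts: for a continuous function $h$ of bounded variation on $[0,1]$ and a continuous nondecreasing time change $r:[0,1]\to[0,\infty)$, $$\int_0^1 h(t)\,dY(r(t)):=h(1)Y(r(1))-h(0)Y(r(0))-\int_{(0,1]}Y(r(t)-)\,dh(t).$$ For $\beta>0$ the mapping $\mathcal{J}^\beta: ID\to ID$ is defined by $$\mathcal{J}^\beta(\nu):=\mathcal{L}\Bigl(\int_0^1 t^{1/\beta}\,dY_\nu(t)\Bigr)=\mathcal{L}\Bigl(\int_0^1 t\,dY_\nu(t^\beta)\Bigr).$$ *)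

theory Defs
  imports "HOL-Probability.Probability"
begin

section \<open>Infinitely divisible laws\<close>

primrec convolution_power :: "nat \<Rightarrow> 'a::ordered_euclidean_space measure \<Rightarrow> 'a measure" where
  "convolution_power 0 \<mu> = return borel 0"
| "convolution_power (Suc n) \<mu> = convolution \<mu> (convolution_power n \<mu>)"

definition borel_prob :: "'a::topological_space measure \<Rightarrow> bool" where
  "borel_prob \<mu> \<longleftrightarrow> prob_space \<mu> \<and> sets \<mu> = sets borel"

definition ID :: "'a::ordered_euclidean_space measure set" where
  "ID = {\<nu>. borel_prob \<nu> \<and> (\<forall>n\<ge>1. \<exists>\<mu>. borel_prob \<mu> \<and> \<nu> = convolution_power n \<mu>)}"

section \<open>Levy processes\<close>

definition cadlag :: "(real \<Rightarrow> 'a::topological_space) \<Rightarrow> bool" where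
  "cadlag f \<longleftrightarrow> (\<forall>t\<ge>0. (f \<longlongrightarrow> f t) (at_right t)) \<and> (\<forall>t>0. \<exists>l. (f \<longlongrightarrow> l) (at_left t))"

text \<open>The time set is \<open>[0, \<infinity>)\<close>; values of \<open>Y\<close> at negative times are irrelevant.\<close>

locale levy_process = prob_space M
  for M :: "'w measure" and Y :: "real \<Rightarrow> 'w \<Rightarrow> 'a::euclidean_space" +
  assumes random_vector: "\<And>t. 0 \<le> t \<Longrightarrow> Y t \<in> borel_measurable M"
    and start_zero: "\<And>\<omega>. \<omega> \<in> space M \<Longrightarrow> Y 0 \<omega> = 0"
    and independent_increments:
      "\<And>(n::nat) t. \<lbrakk>0 \<le> t 0; \<And>i. i < n \<Longrightarrow> t i < t (Suc i)\<rbrakk> \<Longrightarrow>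
        indep_vars (\<lambda>_. borel) (\<lambda>i \<omega>. Y (t (Suc i)) \<omega> - Y (t i) \<omega>) {..<n}"
    and stationary_increments:
      "\<And>s t. \<lbrakk>0 \<le> s; 0 \<le> t\<rbrakk> \<Longrightarrow>
        distr M borel (\<lambda>\<omega>. Y (s + t) \<omega> - Y s \<omega>) = distr M borel (\<lambda>\<omega>. Y t \<omega> - Y 0 \<omega>)"
    and cadlag_paths: "\<And>\<omega>. \<omega> \<in> space M \<Longrightarrow> cadlag (\<lambda>t. Y t \<omega>)"

section \<open>Pathwise random integrals\<close>

text \<open>The convention at \<open>0\<close>, where a path has no past, is \<open>f(0-) = f(0)\<close>.\<close>

definition left_limit :: "(real \<Rightarrow> 'a::t2_space) \<Rightarrow> real \<Rightarrow> 'a" where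
  "left_limit f s = (if s \<le> 0 then f 0 else Lim (at_left s) f)"

definition total_variation :: "(real \<Rightarrow> real) \<Rightarrow> real \<Rightarrow> real \<Rightarrow> real" where
  "total_variation h a b =
     Sup {(\<Sum>i<n. \<bar>h (t (Suc i)) - h (t i)\<bar>) | (n::nat) t. mono_on {..n} t \<and> t ` {..n} \<subseteq> {a..b}}"

text \<open>
  The Lebesgue-Stieltjes integral of \<open>f\<close> over \<open>(0,1]\<close> against \<open>dh\<close>, for \<open>h\<close> continuous and of bounded
  variation on \<open>[0,1]\<close>, is taken through the Jordan decomposition \<open>h - h(0) = V - (V - (h - h(0)))\<close>,
  where \<open>V t\<close> is the variation of \<open>h\<close> on \<open>[0,t]\<close>. As interval measures live on the whole line, both
  nondecreasing parts are continued constantly outside \<open>[0,1]\<close>.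
\<close>

definition stieltjes_integral :: "(real \<Rightarrow> real) \<Rightarrow> (real \<Rightarrow> 'a::euclidean_space) \<Rightarrow> 'a" where
  "stieltjes_integral h f =
     (let c = (\<lambda>t. max 0 (min 1 t));
          V = (\<lambda>t. total_variation h 0 (c t));
          W = (\<lambda>t. V t - (h (c t) - h 0))
      in (LINT t:{0<..1}|interval_measure V. f t) - (LINT t:{0<..1}|interval_measure W. f t))"

definition path_integral :: "(real \<Rightarrow> real) \<Rightarrow> (real \<Rightarrow> real) \<Rightarrow> (real \<Rightarrow> 'a::euclidean_space) \<Rightarrow> 'a" where
  "path_integral h r y =
     h 1 *\<^sub>R y (r 1) - h 0 *\<^sub>R y (r 0) - stieltjes_integral h (\<lambda>t. left_limit y (r t))"

definition integral_law ::
  "'w measure \<Rightarrow> (real \<Rightarrow> 'w \<Rightarrow> 'a::euclidean_space) \<Rightarrow> (real \<Rightarrow> real) \<Rightarrow> (real \<Rightarrow> real) \<Rightarrow> 'a measure"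
where
  "integral_law M Y h r = distr M borel (\<lambda>\<omega>. path_integral h r (\<lambda>t. Y t \<omega>))"

text \<open>
  The law of the integral does not depend on the Levy process chosen to represent \<open>\<nu>\<close>, so the
  description below denotes it. Fixing the type of the sample points to be that of paths loses
  nothing, since every Levy process has the same law as its canonical version on path space.
\<close>

definition J_map :: "real \<Rightarrow> 'a::euclidean_space measure \<Rightarrow> 'a measure" where
  "J_map \<beta> \<nu> =
     (THE \<mu>. \<exists>(M :: (real \<Rightarrow> 'a) measure) Y.
        levy_process M Y \<and> distr M borel (Y 1) = \<nu> \<and>
        \<mu> = integral_law M Y (\<lambda>t. t powr (1 / \<beta>)) (\<lambda>t. t))"

section \<open>The time change\<close>

definition time_change :: "real \<Rightarrow> real \<Rightarrow> real \<Rightarrow> real" where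
  "time_change \<alpha> \<beta> u = \<beta> / (\<beta> - \<alpha>) * u powr \<alpha> - \<alpha> / (\<beta> - \<alpha>) * u powr \<beta>"

end

theory Submission
  imports Defs
begin

text \<open>
  The law of an integral of a Levy process is determined by its characteristic function: if
  \<open>exp (t * \<psi> y)\<close> is that of \<open>Y t\<close>, then \<open>\<integral> h dY\<close> has the exponent
  \<open>y \<mapsto> \<integral> \<psi> (h u *\<^sub>R y) du\<close>, as one sees on Riemann sums, which converge pathwise.  Iterating the
  mapping gives the exponent \<open>\<integral>\<integral> \<psi> (s powr (1/\<alpha>) * t powr (1/\<beta>) *\<^sub>R y) dt ds\<close>, and the time change
  is the distribution function of \<open>s powr (1/\<alpha>) * t powr (1/\<beta>)\<close> for independent uniform \<open>s\<close> and
  \<open>t\<close>, whose quantile function is the inverse time change.  To iterate the mapping at all one needs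
  a Levy process whose law at time \<open>1\<close> is that of \<open>\<integral> h dY\<close>; it is obtained by Kolmogorov extension
  along the dyadic times, the law at time \<open>t\<close> being that of \<open>\<integral> h(u) dY(t u)\<close>, followed by
  regularization of the paths.
\<close>

section \<open>Characteristic functions on Euclidean space\<close>

text \<open>Three obstacles shape the proof. \<open>J_map\<close> is a definite description over
  measures on \<open>real \<Rightarrow> 'a\<close>, so a law fed to it must be represented by a
  process on exactly that sample type; hence the extension is built on functions of a real time.
  Exponents have to be compared, although complex logarithms are multivalued: the zero-free
  continuous function \<open>ch 1\<close> gets a continuous logarithm, normalized at 0, from the
  contractibility of the space. Finally \<open>levy_process\<close> demands a cadlag path at every
  sample point. The regularization counts oscillations. In a short window the walk on any grid is
  displaced by more than \<epsilon> with probability at most 1/3; an Ottaviani-type argument then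
  bounds the probability of ever leaving the ball of radius 2 \<epsilon> by 1/2, and an oscillation
  beyond 4 \<epsilon> forces such an exit. So \<open>p\<close> successive oscillations have
  probability at most \<open>(1 / 2) ^ p\<close>, uniformly in the grid, and almost surely only
  finitely many occur, which yields one-sided limits along the dyadics.\<close>

definition chf :: "'a::euclidean_space measure \<Rightarrow> 'a \<Rightarrow> complex" where
  "chf \<mu> y = (CLINT x|\<mu>. iexp (x \<bullet> y))"

text \<open>The real trigonometric polynomials with arbitrary frequencies. The phase
  \<open>a\<close> makes sines and constants instances of one generator, and the product formula for
  cosines makes the set an algebra, as polynomial approximation requires.\<close>

inductive_set trig :: "('a::euclidean_space \<Rightarrow> real) set" where
  cos: "(\<lambda>x. cos (x \<bullet> t + a)) \<in> trig"
| scale: "f \<in> trig \<Longrightarrow> (\<lambda>x. c * f x) \<in> trig"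
| add: "f \<in> trig \<Longrightarrow> g \<in> trig \<Longrightarrow> (\<lambda>x. f x + g x) \<in> trig"

lemma trig_measurable: "f \<in> trig \<Longrightarrow> f \<in> borel_measurable borel"
  by (induction rule: trig.induct) auto

lemma trig_bounded: "f \<in> trig \<Longrightarrow> \<exists>B. \<forall>x. \<bar>f x\<bar> \<le> B"
proof (induction rule: trig.induct)
  case (scale f c)
  then obtain B where "\<forall>x. \<bar>f x\<bar> \<le> B" by blast
  then have "\<forall>x. \<bar>c * f x\<bar> \<le> \<bar>c\<bar> * B" by (simp add: abs_mult mult_left_mono)
  then show ?case ..
next
  case (add f g)
  then obtain B C where B: "\<And>x. \<bar>f x\<bar> \<le> B" and C: "\<And>x. \<bar>g x\<bar> \<le> C" by blast
  have "\<bar>f x + g x\<bar> \<le> B + C" for x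
    using B[of x] C[of x] by linarith
  then show ?case by blast
next
  case (cos t a)
  show ?case by (rule exI[of _ 1]) simp
qed

lemma trig_const: "(\<lambda>x. c) \<in> trig"
  using trig.scale[OF trig.cos[of 0 0], of c] by simp

lemma trig_sin: "(\<lambda>x. sin (x \<bullet> t)) \<in> trig"
  using trig.cos[of t "- (pi / 2)"] by (simp add: cos_diff)

lemma trig_mult_cos: "g \<in> trig \<Longrightarrow> (\<lambda>x. cos (x \<bullet> t + a) * g x) \<in> trig"
proof (induction rule: trig.induct)
  case (cos s b)
  have "(\<lambda>x. (1/2) * cos (x \<bullet> (t - s) + (a - b)) + (1/2) * cos (x \<bullet> (t + s) + (a + b))) \<in> trig"
    by (intro trig.intros)
  moreover have "cos (x \<bullet> t + a) * cos (x \<bullet> s + b) =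
      (1/2) * cos (x \<bullet> (t - s) + (a - b)) + (1/2) * cos (x \<bullet> (t + s) + (a + b))" for x
  proof -
    have "x \<bullet> (t - s) + (a - b) = (x \<bullet> t + a) - (x \<bullet> s + b)"
      and "x \<bullet> (t + s) + (a + b) = (x \<bullet> t + a) + (x \<bullet> s + b)"
      by (simp_all add: inner_diff_right inner_add_right)
    then show ?thesis by (simp only: cos_diff[of "x \<bullet> t + a"] cos_add[of "x \<bullet> t + a"]) (simp add: field_simps)
  qed
  ultimately show ?case by simp
next
  case (scale f c)
  then show ?case using trig.scale[OF scale.IH, of c] by (simp add: mult.left_commute)
next
  case (add f g)
  then show ?case using trig.add[OF add.IH] by (simp add: distrib_left)
qed

lemma trig_mult: "f \<in> trig \<Longrightarrow> g \<in> trig \<Longrightarrow> (\<lambda>x. f x * g x) \<in> trig"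
proof (induction rule: trig.induct)
  case (cos t a) then show ?case by (simp add: trig_mult_cos)
next
  case (scale f c)
  then show ?case using trig.scale[of "\<lambda>x. f x * g x" c] by (simp add: mult.assoc)
next
  case (add f h)
  then show ?case using trig.add[of "\<lambda>x. f x * g x" "\<lambda>x. h x * g x"] by (simp add: distrib_right)
qed

lemma trig_polynomial:
  fixes p :: "real \<Rightarrow> real"
  assumes "real_polynomial_function p" and f: "f \<in> trig"
  shows "(\<lambda>x. p (f x)) \<in> trig"
  using assms(1)
proof (induction rule: real_polynomial_function.induct)
  case (linear p)
  then obtain c where "p = (\<lambda>x. x * c)" by (auto simp: real_bounded_linear)
  then show ?case using trig.scale[OF f, of c] by (simp add: mult.commute)
qed (auto intro: trig_const trig.add trig_mult)

lemma integral_cos_chf: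
  assumes "borel_prob \<mu>"
  shows "(\<integral>x. cos (x \<bullet> t + a) \<partial>\<mu>) = Re (iexp a * chf \<mu> t)"
proof -
  interpret prob_space \<mu> using assms by (simp add: borel_prob_def)
  have [measurable_cong]: "sets \<mu> = sets borel" using assms by (simp add: borel_prob_def)
  have i: "integrable \<mu> (\<lambda>x. iexp (x \<bullet> t))"
    by (rule integrable_iexp) auto
  have "iexp a * chf \<mu> t = (CLINT x|\<mu>. iexp (x \<bullet> t + a))"
    unfolding chf_def using i by (subst integral_mult_right_zero[symmetric])
      (simp add: distrib_left exp_add mult.commute)
  moreover have "Re (CLINT x|\<mu>. iexp (x \<bullet> t + a)) = (\<integral>x. Re (iexp (x \<bullet> t + a)) \<partial>\<mu>)"
    by (rule integral_Re[symmetric], rule integrable_iexp) auto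
  ultimately show ?thesis by (simp add: Re_exp)
qed

lemma integrable_trig:
  assumes "borel_prob \<mu>" and "f \<in> trig"
  shows "integrable \<mu> f"
proof -
  interpret prob_space \<mu> using assms by (simp add: borel_prob_def)
  obtain B where "\<forall>x. \<bar>f x\<bar> \<le> B" using trig_bounded[OF assms(2)] ..
  then show ?thesis
    using assms trig_measurable[OF assms(2)]
    by (intro integrable_const_bound[where B=B]) (auto simp: borel_prob_def cong: measurable_cong_sets)
qed

lemma integral_trig_eq:
  assumes "borel_prob \<mu>" "borel_prob \<nu>" "chf \<mu> = chf \<nu>" "f \<in> trig"
  shows "(\<integral>x. f x \<partial>\<mu>) = (\<integral>x. f x \<partial>\<nu>)"
  using assms(4)
proof (induction rule: trig.induct)
  case (cos t a)
  then show ?case using assms by (simp add: integral_cos_chf)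
next
  case (add f g)
  then show ?case using assms(1,2) by (simp add: integrable_trig)
qed simp

text \<open>Members of \<open>trig\<close> are Borel; conversely
  \<open>sin (u * (x \<bullet> b)) / u\<close> tends to \<open>x \<bullet> b\<close> as
  \<open>u\<close> tends to 0, so they determine all coordinates. Finite sets \<open>F\<close> are
  built into the generator to make it stable under intersection.\<close>

lemma sets_borel_trig:
  "sets (borel :: 'a::euclidean_space measure) =
     sigma_sets UNIV {{x. \<forall>h\<in>F. h x > 0} | F. finite F \<and> F \<subseteq> trig}" (is "_ = sigma_sets UNIV ?E")
proof
  show "sigma_sets UNIV ?E \<subseteq> sets (borel :: 'a measure)"
  proof (rule sets.sigma_sets_subset[of _ borel, simplified], safe)
    fix F :: "('a \<Rightarrow> real) set" assume F: "finite F" "F \<subseteq> trig"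
    have "{x \<in> space borel. \<forall>h\<in>F. h x > 0} \<in> sets borel"
    proof (rule sets.sets_Collect_finite_All)
      show "{x \<in> space borel. 0 < h x} \<in> sets borel" if "h \<in> F" for h
      proof -
        have [measurable]: "h \<in> borel_measurable borel" using F that trig_measurable by blast
        show ?thesis by measurable
      qed
    qed fact
    then show "{x. \<forall>h\<in>F. h x > 0} \<in> sets borel" by simp
  qed
next
  let ?S = "sigma (UNIV::'a set) ?E"
  have h: "h \<in> borel_measurable ?S" if "h \<in> trig" for h
    unfolding borel_measurable_iff_greater
  proof
    fix c
    have "{x. \<forall>g\<in>{\<lambda>x. h x + - c}. g x > 0} \<in> ?E"
      using that trig.add[OF that trig_const[of "-c"]] by blast
    then have "{x. \<forall>g\<in>{\<lambda>x. h x + - c}. g x > 0} \<in> sets ?S"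
      by (auto intro: sigma_sets.Basic)
    then show "{w \<in> space ?S. c < h w} \<in> sets ?S" by simp
  qed
  have "(\<lambda>x. x \<bullet> b) \<in> borel_measurable ?S" for b :: 'a
  proof (rule borel_measurable_LIMSEQ_real)
    fix x :: 'a
    have "((\<lambda>u. sin (u * (x \<bullet> b)) / u) \<longlongrightarrow> x \<bullet> b) (at 0)"
    proof -
      have "((\<lambda>u. sin (u * (x \<bullet> b))) has_real_derivative cos (0 * (x \<bullet> b)) * (x \<bullet> b)) (at 0)"
        by (auto intro!: derivative_eq_intros)
      then show ?thesis by (simp add: DERIV_def)
    qed
    moreover have "filterlim (\<lambda>n. 1 / real (Suc n)) (at 0) sequentially"
      unfolding filterlim_at using LIMSEQ_inverse_real_of_nat by (auto simp: divide_simps)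
    ultimately have "(\<lambda>n. sin (1 / real (Suc n) * (x \<bullet> b)) / (1 / real (Suc n))) \<longlonglongrightarrow> x \<bullet> b"
      by (rule filterlim_compose)
    then show "(\<lambda>n. real (Suc n) * sin (x \<bullet> (b /\<^sub>R real (Suc n)))) \<longlonglongrightarrow> x \<bullet> b"
      by (simp add: divide_inverse mult.commute[of "sin _"])
  next
    show "(\<lambda>x. real (Suc n) * sin (x \<bullet> (b /\<^sub>R real (Suc n)))) \<in> borel_measurable ?S" for n
      by (intro h trig.scale trig_sin)
  qed
  then have "(\<lambda>x. x) \<in> measurable ?S (borel :: 'a measure)"
    by (subst borel_measurable_euclidean_space) auto
  then show "sets (borel :: 'a measure) \<subseteq> sigma_sets UNIV ?E"
    using measurable_sets[of "\<lambda>x. x" ?S borel] by auto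
qed

text \<open>Equal characteristic functions give equal integrals over \<open>trig\<close>. The
  predicate \<open>good\<close> asks for equality against \<open>f * g\<close> for every
  \<open>g\<close> in \<open>trig\<close>; this quantifier lets further factors be multiplied in:
  members of \<open>trig\<close>, continuous functions of them by Weierstrass approximation, and
  finally indicators of \<open>{x. h x > 0}\<close>. Finite products of these indicators reach the
  generator in \<open>sets_borel_trig\<close>.\<close>

lemma chf_unique:
  fixes \<mu> \<nu> :: "'a::euclidean_space measure"
  assumes p: "borel_prob \<mu>" "borel_prob \<nu>" and eq: "chf \<mu> = chf \<nu>"
  shows "\<mu> = \<nu>"
proof -
  interpret m: prob_space \<mu> using p by (simp add: borel_prob_def)
  interpret n: prob_space \<nu> using p by (simp add: borel_prob_def)
  have s: "sets \<mu> = sets borel" "sets \<nu> = sets borel" using p by (simp_all add: borel_prob_def)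
  define good where "good f \<longleftrightarrow> f \<in> borel_measurable borel \<and> (\<exists>B. \<forall>x. \<bar>f x\<bar> \<le> B) \<and>
     (\<forall>g\<in>trig. (\<integral>x. f x * g x \<partial>\<mu>) = (\<integral>x. f x * g x \<partial>\<nu>))" for f :: "'a \<Rightarrow> real"
  have good_bounded: "\<exists>B. \<forall>x. \<bar>f x\<bar> \<le> B" if "good f" for f
    using that unfolding good_def by (elim conjE)
  have good_measurable: "f \<in> borel_measurable borel" if "good f" for f
    using that unfolding good_def by (elim conjE)
  have good_eq: "(\<integral>x. f x * g x \<partial>\<mu>) = (\<integral>x. f x * g x \<partial>\<nu>)" if "good f" "g \<in> trig" for f g
    using that unfolding good_def by (elim conjE) (erule (1) bspec)
  have goodI: "good f" if "f \<in> borel_measurable borel" "\<And>x. \<bar>f x\<bar> \<le> B"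
    "\<And>g. g \<in> trig \<Longrightarrow> (\<integral>x. f x * g x \<partial>\<mu>) = (\<integral>x. f x * g x \<partial>\<nu>)" for f B
    unfolding good_def by (intro conjI exI[of _ B] ballI allI that)
  have good_lim: "good f"
    if f: "\<And>n. good (F n)" and B: "\<And>n x. \<bar>F n x\<bar> \<le> B" and l: "\<And>x. (\<lambda>n. F n x) \<longlonglongrightarrow> f x" for F f B
  proof -
    have [measurable]: "F n \<in> borel_measurable borel" for n using good_measurable[OF f] .
    have fm [measurable]: "f \<in> borel_measurable borel" by (rule borel_measurable_LIMSEQ_real[OF l]) simp
    have fB: "\<bar>f x\<bar> \<le> B" for x
      by (rule LIMSEQ_le_const2[OF tendsto_rabs[OF l]]) (use B in auto)
    have "(\<integral>x. f x * g x \<partial>\<mu>) = (\<integral>x. f x * g x \<partial>\<nu>)" if g: "g \<in> trig" for g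
    proof -
      have [measurable]: "g \<in> borel_measurable borel" by (rule trig_measurable) fact
      obtain C where C: "\<bar>g x\<bar> \<le> C" for x using trig_bounded[OF g] by blast
      have lim: "(\<lambda>n. \<integral>x. F n x * g x \<partial>\<rho>) \<longlonglongrightarrow> (\<integral>x. f x * g x \<partial>\<rho>)" if "borel_prob \<rho>" for \<rho>
      proof (rule integral_dominated_convergence[where w="\<lambda>_. B * C"])
        interpret prob_space \<rho> using that by (simp add: borel_prob_def)
        have [measurable_cong]: "sets \<rho> = sets borel" using that by (simp add: borel_prob_def)
        show "(\<lambda>x. f x * g x) \<in> borel_measurable \<rho>" "(\<lambda>x. F n x * g x) \<in> borel_measurable \<rho>" for n
          by measurable
        show "integrable \<rho> (\<lambda>_. B * C)" by simp
        show "AE x in \<rho>. (\<lambda>i. F i x * g x) \<longlonglongrightarrow> f x * g x"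
          by (intro always_eventually allI tendsto_mult l tendsto_const)
        show "AE x in \<rho>. norm (F n x * g x) \<le> B * C" for n
        proof (rule AE_I2)
          show "norm (F n x * g x) \<le> B * C" for x
            using mult_mono'[OF B[of n x] C[of x]] by (simp add: abs_mult)
        qed
      qed
      have "(\<lambda>n. \<integral>x. F n x * g x \<partial>\<mu>) = (\<lambda>n. \<integral>x. F n x * g x \<partial>\<nu>)" using good_eq[OF f g] by simp
      from LIMSEQ_unique[OF lim[OF p(1), unfolded this] lim[OF p(2)]] show ?thesis .
    qed
    with fm fB show ?thesis by (rule goodI)
  qed
  have good_trig: "good (\<lambda>x. f x * h x)" if f: "good f" and h: "h \<in> trig" for f h
  proof -
    obtain B C where BC: "\<bar>f x\<bar> \<le> B" "\<bar>h x\<bar> \<le> C" for x using good_bounded[OF f] trig_bounded[OF h] by blast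
    have "\<bar>f x * h x\<bar> \<le> B * C" for x
      using BC[of x] by (simp add: abs_mult mult_mono')
    moreover have "(\<integral>x. f x * h x * g x \<partial>\<mu>) = (\<integral>x. f x * h x * g x \<partial>\<nu>)" if "g \<in> trig" for g
      using good_eq[OF f trig_mult[OF h that]] by (simp only: mult.assoc)
    ultimately show ?thesis
      by (rule goodI[OF borel_measurable_times[OF good_measurable[OF f] trig_measurable[OF h]]])
  qed
  have good_cont: "good (\<lambda>x. f x * \<phi> (h x))"
    if f: "good f" and h: "h \<in> trig" and \<phi>: "continuous_on UNIV \<phi>" for f h \<phi>
  proof -
    obtain B C where B: "\<bar>f x\<bar> \<le> B" and C: "\<bar>h x\<bar> \<le> C" for x
      using good_bounded[OF f] trig_bounded[OF h] by blast
    \<comment> \<open>The polynomials have to be close to \<open>\<phi>\<close> only on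
      \<open>{-C..C}\<close>, which contains all values of \<open>h\<close>.\<close>
    have "\<forall>n. \<exists>p. real_polynomial_function p \<and> (\<forall>s\<in>{-C..C}. \<bar>\<phi> s - p s\<bar> < 1 / real (Suc n))"
    proof
      fix n :: nat
      have "continuous_on {-C..C} \<phi>" by (rule continuous_on_subset[OF \<phi>]) simp
      then obtain p where "real_polynomial_function p" "\<And>s. s \<in> {-C..C} \<Longrightarrow> \<bar>\<phi> s - p s\<bar> < 1 / real (Suc n)"
        by (rule Stone_Weierstrass_real_polynomial_function[OF compact_Icc, of _ _ _ "1 / real (Suc n)"]) auto
      then show "\<exists>p. real_polynomial_function p \<and> (\<forall>s\<in>{-C..C}. \<bar>\<phi> s - p s\<bar> < 1 / real (Suc n))"
        by blast
    qed
    from choice[OF this] obtain p where p: "\<And>n. real_polynomial_function (p n)"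
      "\<And>n s. s \<in> {-C..C} \<Longrightarrow> \<bar>\<phi> s - p n s\<bar> < 1 / real (Suc n)" by blast
    have e: "\<bar>\<phi> (h x) - p n (h x)\<bar> < 1 / real (Suc n)" for x n
      by (rule p(2)) (use C[of x] in \<open>auto simp: abs_le_iff\<close>)
    have "compact (\<phi> ` {-C..C})"
      by (intro compact_continuous_image continuous_on_subset[OF \<phi>]) auto
    then obtain K where K: "\<And>s. s \<in> {-C..C} \<Longrightarrow> \<bar>\<phi> s\<bar> \<le> K"
      using compact_imp_bounded[of "\<phi> ` {-C..C}"] unfolding bounded_real by blast
    have Kh: "\<bar>\<phi> (h x)\<bar> \<le> K" for x using C[of x] by (intro K) (auto simp: abs_le_iff)
    show ?thesis
    proof (rule good_lim)
      show "good (\<lambda>x. f x * p n (h x))" for n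
        by (rule good_trig[OF f trig_polynomial[OF p(1) h]])
      show "\<bar>f x * p n (h x)\<bar> \<le> B * (K + 1)" for n x
      proof -
        have "1 / real (Suc n) \<le> 1" by simp
        then have "\<bar>p n (h x)\<bar> \<le> K + 1" using e[of x n] Kh[of x] by linarith
        then show ?thesis using B[of x] by (simp add: abs_mult mult_mono')
      qed
      show "(\<lambda>n. f x * p n (h x)) \<longlonglongrightarrow> f x * \<phi> (h x)" for x
      proof (intro tendsto_mult tendsto_const)
        have "(\<lambda>n. \<phi> (h x) - p n (h x)) \<longlonglongrightarrow> 0"
          by (rule Lim_null_comparison[OF _ LIMSEQ_inverse_real_of_nat])
             (use e in \<open>auto simp: inverse_eq_divide intro!: always_eventually less_imp_le\<close>)
        from tendsto_diff[OF tendsto_const[of "\<phi> (h x)"] this]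
        show "(\<lambda>n. p n (h x)) \<longlonglongrightarrow> \<phi> (h x)" by simp
      qed
    qed
  qed
  have good_ind: "good (\<lambda>x. f x * indicator {x. h x > 0} x)" if f: "good f" and h: "h \<in> trig" for f h
  proof -
    obtain B where B: "\<bar>f x\<bar> \<le> B" for x using good_bounded[OF f] by blast
    show ?thesis
    proof (rule good_lim)
      \<comment> \<open>These continuous functions of \<open>h\<close> equal \<open>1\<close> once
        \<open>n * h x \<ge> 1\<close> and vanish where \<open>h x \<le> 0\<close>, so they converge
        to the indicator.\<close>
      show "good (\<lambda>x. f x * min 1 (real n * max 0 (h x)))" for n
        by (rule good_cont[OF f h]) (intro continuous_intros)
      show "\<bar>f x * min 1 (real n * max 0 (h x))\<bar> \<le> B * 1" for n x
        using mult_mono'[OF B[of x], of "\<bar>min 1 (real n * max 0 (h x))\<bar>" 1] by (simp add: abs_mult)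
      show "(\<lambda>n. f x * min 1 (real n * max 0 (h x))) \<longlonglongrightarrow> f x * indicator {x. h x > 0} x" for x
      proof (intro tendsto_mult tendsto_const, cases "h x > 0")
        case True
        have "eventually (\<lambda>n. real n \<ge> 1 / h x) sequentially"
          by (metis eventually_sequentiallyI nat_ceiling_le_eq)
        then have "eventually (\<lambda>n. min 1 (real n * max 0 (h x)) = 1) sequentially"
          by eventually_elim (use True in \<open>auto simp: field_simps min_def\<close>)
        then show "(\<lambda>n. min 1 (real n * max 0 (h x))) \<longlonglongrightarrow> indicator {x. h x > 0} x"
          using True by (simp add: tendsto_eventually)
      qed auto
    qed
  qed
  have meas: "measure \<mu> {x. \<forall>h\<in>F. h x > 0} = measure \<nu> {x. \<forall>h\<in>F. h x > 0}"
    if F: "finite F" "F \<subseteq> trig" for F :: "('a \<Rightarrow> real) set"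
  proof -
    have "good (indicator {x. \<forall>h\<in>F. h x > 0})"
      using F
    proof (induction F)
      case empty
      show ?case by (rule goodI[of _ 1]) (use integral_trig_eq[OF p eq] in auto)
    next
      case (insert h F)
      have "indicator {x. \<forall>h\<in>insert h F. h x > 0} =
          (\<lambda>x. indicator {x. \<forall>h\<in>F. h x > 0} x * indicator {x. h x > 0} x :: real)"
        by (auto simp: indicator_def)
      then show ?case using good_ind[of _ h] insert by auto
    qed
    then have i: "(\<integral>x. indicator {x. \<forall>h\<in>F. h x > 0} x * 1 \<partial>\<mu>) = (\<integral>x. indicator {x. \<forall>h\<in>F. h x > 0} x * (1::real) \<partial>\<nu>)"
      by (rule good_eq[OF _ trig_const])
    have "{x. \<forall>h\<in>F. h x > 0} \<in> sets borel"
      unfolding sets_borel_trig using F by (blast intro: sigma_sets.Basic)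
    with i show ?thesis using s sets_eq_imp_space_eq[OF s(1)] sets_eq_imp_space_eq[OF s(2)] by simp
  qed
  show ?thesis
  proof (rule measure_eqI_generator_eq[where A="\<lambda>_. UNIV" and \<Omega>=UNIV and E="{{x. \<forall>h\<in>F. h x > 0} | F. finite F \<and> F \<subseteq> trig}"])
    show "Int_stable {{x::'a. \<forall>h\<in>F. h x > 0} | F. finite F \<and> F \<subseteq> trig}"
      unfolding Int_stable_def
    proof safe
      fix F G :: "('a \<Rightarrow> real) set" assume "finite F" "F \<subseteq> trig" "finite G" "G \<subseteq> trig"
      then show "\<exists>H. {x. \<forall>h\<in>F. 0 < h x} \<inter> {x. \<forall>h\<in>G. 0 < h x} = {x. \<forall>h\<in>H. 0 < h x} \<and> finite H \<and> H \<subseteq> trig"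
        by (intro exI[of _ "F \<union> G"]) auto
    qed
    show "sets \<mu> = sigma_sets UNIV {{x. \<forall>h\<in>F. h x > 0} | F. finite F \<and> F \<subseteq> trig}"
      "sets \<nu> = sigma_sets UNIV {{x. \<forall>h\<in>F. h x > 0} | F. finite F \<and> F \<subseteq> trig}"
      using s sets_borel_trig by simp_all
    show "emeasure \<mu> X = emeasure \<nu> X" if "X \<in> {{x. \<forall>h\<in>F. h x > 0} | F. finite F \<and> F \<subseteq> trig}" for X
      using that meas by (auto simp: m.emeasure_eq_measure n.emeasure_eq_measure)
    show "range (\<lambda>_. UNIV) \<subseteq> {{x::'a. \<forall>h\<in>F. h x > 0} | F. finite F \<and> F \<subseteq> trig}"
      by (auto intro!: exI[of _ "{}"])
  qed auto
qed

section \<open>Path integrals as limits of Riemann sums\<close>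

text \<open>One-sided limits bound \<open>y\<close> near each point, and the bisection principle
  \<open>Bolzano\<close> turns local bounds into one on the whole interval.\<close>

lemma cadlag_bounded:
  fixes y :: "real \<Rightarrow> 'a::real_normed_vector"
  assumes y: "cadlag y"
  shows "\<exists>K. \<forall>t\<in>{0..R}. norm (y t) \<le> K"
proof (cases "0 \<le> R")
  case True
  \<comment> \<open>The guard \<open>0 \<le> t\<close> matters at \<open>x = 0\<close>: the
    intervals of the bisection principle may reach to negative times, where nothing is known about
    \<open>y\<close>.\<close>
  define P where "P a b \<longleftrightarrow> (\<exists>K. \<forall>t\<in>{a..b}. 0 \<le> t \<longrightarrow> norm (y t) \<le> K)" for a b
  have "P 0 R"
    using True
  proof (induction rule: Bolzano)
    case (trans a b c)
    then obtain K L where "\<forall>t\<in>{a..b}. 0 \<le> t \<longrightarrow> norm (y t) \<le> K" "\<forall>t\<in>{b..c}. 0 \<le> t \<longrightarrow> norm (y t) \<le> L"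
      unfolding P_def by blast
    then have "\<forall>t\<in>{a..c}. 0 \<le> t \<longrightarrow> norm (y t) \<le> max K L"
      by (auto simp: le_max_iff_disj)
    then show ?case unfolding P_def ..
  next
    case (local x)
    have "(y \<longlongrightarrow> y x) (at_right x)" using y local by (simp add: cadlag_def)
    then have "eventually (\<lambda>t. norm (y t) < norm (y x) + 1) (at_right x)"
      by (intro order_tendstoD(2)[OF tendsto_norm]) auto
    then obtain u where u: "x < u" "\<And>t. x < t \<Longrightarrow> t < u \<Longrightarrow> norm (y t) < norm (y x) + 1"
      unfolding eventually_at_right_field by blast
    obtain v K where v: "v < x" "\<And>t. v < t \<Longrightarrow> t < x \<Longrightarrow> 0 \<le> t \<Longrightarrow> norm (y t) < K"
    proof (cases "x = 0")
      case True
      then show ?thesis by (intro that[of "-1" 0]) auto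
    next
      case False
      then have "0 < x" using local by simp
      then obtain l where "(y \<longlongrightarrow> l) (at_left x)" using y unfolding cadlag_def by blast
      then have "eventually (\<lambda>t. norm (y t) < norm l + 1) (at_left x)"
        by (intro order_tendstoD(2)[OF tendsto_norm]) auto
      then show ?thesis unfolding eventually_at_left_field using that by blast
    qed
    show ?case
    proof (intro exI[of _ "min (u - x) (x - v)"] conjI allI impI)
      fix a b assume ab: "a \<le> x \<and> x \<le> b \<and> b - a < min (u - x) (x - v)"
      have "norm (y t) \<le> max (norm (y x) + 1) K" if "t \<in> {a..b}" "0 \<le> t" for t
        using that ab u(2)[of t] v(2)[of t] by (cases t x rule: linorder_cases) auto
      then show "P a b" unfolding P_def by blast
    qed (use u v in auto)
  qed
  then show ?thesis by (auto simp: P_def)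
qed auto

lemma total_variation_mono:
  assumes "mono_on {a..b} h" and "a \<le> b"
  shows "total_variation h a b = h b - h a"
proof -
  let ?S = "{(\<Sum>i<n. \<bar>h (t (Suc i)) - h (t i)\<bar>) | (n::nat) t. mono_on {..n} t \<and> t ` {..n} \<subseteq> {a..b}}"
  have "h b - h a \<in> ?S"
  proof -
    let ?t = "\<lambda>i::nat. if i = 0 then a else b"
    have "h a \<le> h b" by (rule mono_onD[OF assms(1)]) (use assms(2) in auto)
    then have "h b - h a = (\<Sum>i<1. \<bar>h (?t (Suc i)) - h (?t i)\<bar>)" by simp
    moreover have "mono_on {..1} ?t \<and> ?t ` {..1} \<subseteq> {a..b}"
      using assms(2) by (auto simp: mono_on_def)
    ultimately show ?thesis by (intro CollectI exI[of _ 1] exI[of _ ?t]) (rule conjI)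
  qed
  moreover have "s \<le> h b - h a" if "s \<in> ?S" for s
  proof -
    obtain n t where s: "s = (\<Sum>i<n. \<bar>h (t (Suc i)) - h (t i)\<bar>)"
      and t: "mono_on {..n} t" "t ` {..n} \<subseteq> {a..b}" using \<open>s \<in> ?S\<close> by blast
    have tr: "t i \<in> {a..b}" if "i \<le> n" for i using t(2) that by blast
    have *: "h (t i) \<le> h (t j)" if "i \<le> j" "j \<le> n" for i j
      by (intro mono_onD[OF assms(1)] mono_onD[OF t(1)]) (use tr[of i] tr[of j] that in auto)
    have "s = (\<Sum>i<n. h (t (Suc i)) - h (t i))"
      unfolding s using * by (intro sum.cong) auto
    also have "\<dots> = h (t n) - h (t 0)" by (rule sum_lessThan_telescope)
    also have "\<dots> \<le> h b - h a"
    proof (rule diff_mono)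
      show "h (t n) \<le> h b" "h a \<le> h (t 0)"
        using tr[of 0] tr[of n] assms(2) by (auto intro!: mono_onD[OF assms(1)])
    qed
    finally show ?thesis .
  qed
  ultimately show ?thesis unfolding total_variation_def by (rule cSup_eq_maximum)
qed

text \<open>For nondecreasing \<open>h\<close> the part \<open>W\<close> in
  \<open>stieltjes_integral\<close> is identically \<open>0\<close>, and its integral drops out by
  this.\<close>

lemma LINT_null_interval:
  fixes f :: "real \<Rightarrow> 'a::{banach, second_countable_topology}"
  shows "(LINT t:{0<..1}|interval_measure (\<lambda>_. 0). f t) = 0"
proof -
  have "emeasure (interval_measure (\<lambda>_. 0)) {0<..1::real} = 0"
    by (subst emeasure_interval_measure_Ioc) auto
  then have "AE t in interval_measure (\<lambda>_. 0). t \<notin> {0<..1::real}"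
    by (intro AE_not_in) (auto simp: null_sets_def)
  then show ?thesis
    unfolding set_lebesgue_integral_def by (intro integral_eq_zero_AE) auto
qed

text \<open>The variation \<open>V\<close> of a nondecreasing \<open>h\<close>, as
  \<open>stieltjes_integral\<close> extends it to the line.\<close>

definition clamped :: "(real \<Rightarrow> real) \<Rightarrow> real \<Rightarrow> real" where
  "clamped h t = h (max 0 (min 1 t)) - h 0"

lemma stieltjes_integral_mono:
  assumes h: "mono_on {0..1} h"
  shows "stieltjes_integral h f = (LINT t:{0<..1}|interval_measure (clamped h). f t)"
proof -
  have "total_variation h 0 (max 0 (min 1 t)) = clamped h t" for t
    unfolding clamped_def by (rule total_variation_mono[OF mono_on_subset[OF h]]) auto
  then show ?thesis
    unfolding stieltjes_integral_def Let_def
    by (simp add: LINT_null_interval) (simp add: clamped_def[symmetric] fun_eq_iff LINT_null_interval)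
qed

lemma emeasure_clamped:
  assumes h: "mono_on {0..1} h" "continuous_on {0..1} h" and "0 \<le> a" "a \<le> b" "b \<le> 1"
  shows "emeasure (interval_measure (clamped h)) {a<..b} = ennreal (h b - h a)"
proof -
  have "continuous_on UNIV (clamped h)"
    unfolding clamped_def
    by (intro continuous_intros continuous_on_compose2[OF h(2)]) auto
  then have "continuous (at_right x) (clamped h)" for x
    by (simp add: continuous_on_eq_continuous_at continuous_at_imp_continuous_at_within)
  moreover have "clamped h x \<le> clamped h y" if "x \<le> y" for x y
    unfolding clamped_def using that by (auto intro!: mono_onD[OF h(1)])
  ultimately have "emeasure (interval_measure (clamped h)) {a<..b} = ennreal (clamped h b - clamped h a)"
    using assms by (intro emeasure_interval_measure_Ioc) auto
  then show ?thesis using assms by (simp add: clamped_def)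
qed

text \<open>The cell \<open>{j/n<..(j+1)/n}\<close> containing \<open>s \<in> {0<..1}\<close> has \<open>j = cell n s\<close>.\<close>

definition cell :: "nat \<Rightarrow> real \<Rightarrow> nat" where
  "cell n s = nat (\<lceil>real n * s\<rceil> - 1)"

lemma cell_iff:
  assumes "0 < s" "0 < n"
  shows "cell n s = j \<longleftrightarrow> real j / real n < s \<and> s \<le> real (Suc j) / real n"
proof -
  have "\<lceil>real n * s\<rceil> \<ge> 1" using assms by simp
  then have "cell n s = j \<longleftrightarrow> \<lceil>real n * s\<rceil> = int j + 1" unfolding cell_def by linarith
  also have "\<dots> \<longleftrightarrow> real j < real n * s \<and> real n * s \<le> real j + 1"
    by (auto simp: ceiling_eq_iff)
  also have "\<dots> \<longleftrightarrow> real j / real n < s \<and> s \<le> real (Suc j) / real n"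
    using assms by (simp add: field_simps)
  finally show ?thesis .
qed

lemma cell_lower: "0 < s \<Longrightarrow> 0 < n \<Longrightarrow> real (cell n s) / real n < s"
  using cell_iff[of s n "cell n s"] by simp

lemma cell_upper: "0 < s \<Longrightarrow> 0 < n \<Longrightarrow> s \<le> real (Suc (cell n s)) / real n"
  using cell_iff[of s n "cell n s"] by simp

lemma cell_less:
  assumes "0 < s" "s \<le> 1" "0 < n"
  shows "cell n s < n"
proof -
  have "real (cell n s) / real n < 1" using cell_lower[of s n] assms by linarith
  then show ?thesis using assms by (simp add: divide_simps)
qed

text \<open>Cells are open on the left, so their left ends stay strictly below \<open>s\<close>.
  Sampling a cadlag path there therefore yields its left limit, the value that the Stieltjes
  integrand asks for.\<close>

lemma cell_tendsto_left:
  assumes "0 < s"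
  shows "filterlim (\<lambda>n. real (cell n s) / real n) (at_left s) sequentially"
  unfolding filterlim_at
proof
  have lower: "eventually (\<lambda>n. real (cell n s) / real n < s) sequentially"
    using eventually_gt_at_top[of 0] by eventually_elim (rule cell_lower[OF assms])
  then show "eventually (\<lambda>n. real (cell n s) / real n \<in> {..<s} \<and> real (cell n s) / real n \<noteq> s) sequentially"
    by eventually_elim simp
  show "(\<lambda>n. real (cell n s) / real n) \<longlonglongrightarrow> s"
  proof (rule tendsto_sandwich)
    show "eventually (\<lambda>n. s - 1 / real n \<le> real (cell n s) / real n) sequentially"
      using eventually_gt_at_top[of 0]
    proof eventually_elim
      case (elim n)
      then show ?case using cell_upper[OF assms elim] by (simp add: add_divide_distrib)
    qed
    show "eventually (\<lambda>n. real (cell n s) / real n \<le> s) sequentially"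
      using lower by eventually_elim (rule less_imp_le)
    show "(\<lambda>n. s - 1 / real n) \<longlonglongrightarrow> s"
      using tendsto_diff[OF tendsto_const lim_1_over_n] by simp
  qed simp
qed

lemma sum_cell:
  fixes v :: "nat \<Rightarrow> 'a::real_vector"
  assumes "0 < s" "s \<le> 1" "0 < n"
  shows "(\<Sum>j<n. indicator {real j / real n<..real (Suc j) / real n} s *\<^sub>R v j) = v (cell n s)"
proof -
  have "indicator {real j / real n<..real (Suc j) / real n} s *\<^sub>R v j = (if cell n s = j then v j else 0)" for j
    using cell_iff[OF assms(1,3), of j] by (auto simp: indicator_def)
  then show ?thesis using cell_less[OF assms] by (simp add: sum.delta)
qed

section \<open>Riemann sums along a grid and their limit\<close>

lemma sum_by_parts:
  fixes y :: "nat \<Rightarrow> 'a::real_vector"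
  shows "(\<Sum>j<n. h (Suc j) *\<^sub>R (y (Suc j) - y j)) = h n *\<^sub>R y n - h 0 *\<^sub>R y 0 - (\<Sum>j<n. (h (Suc j) - h j) *\<^sub>R y j)"
  by (induction n) (auto simp: algebra_simps)

lemma left_limit_tendsto:
  fixes y :: "real \<Rightarrow> 'a::t2_space"
  assumes "cadlag y" "0 < s"
  shows "(y \<longlongrightarrow> left_limit y s) (at_left s)"
proof -
  obtain l where l: "(y \<longlongrightarrow> l) (at_left s)" using assms unfolding cadlag_def by blast
  then have "Lim (at_left s) y = l" by (intro tendsto_Lim) simp_all
  then show ?thesis using l assms by (simp add: left_limit_def)
qed

text \<open>The integrand is taken at the right end of each cell: after summation by parts the path
  then appears at the left ends, whose limits are the \<open>left_limit\<close> values in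
  \<open>path_integral\<close>.\<close>

definition riemann_sum :: "(real \<Rightarrow> real) \<Rightarrow> (real \<Rightarrow> real) \<Rightarrow> (real \<Rightarrow> 'a::euclidean_space) \<Rightarrow> nat \<Rightarrow> 'a" where
  "riemann_sum h r y n =
     (\<Sum>j<n. h (real (Suc j) / real n) *\<^sub>R (y (r (real (Suc j) / real n)) - y (r (real j / real n))))"

text \<open>Strictness makes \<open>r\<close> carry points strictly left of \<open>s\<close> to
  points strictly left of \<open>r s\<close>, so left limits survive the time change.\<close>

locale time_scale =
  fixes r :: "real \<Rightarrow> real"
  assumes r_cont: "continuous_on {0..1} r" and r_mono: "strict_mono_on {0..1} r" and r_nonneg: "0 \<le> r 0"
begin

lemma r_le: "0 \<le> s \<Longrightarrow> s \<le> t \<Longrightarrow> t \<le> 1 \<Longrightarrow> r s \<le> r t"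
  using strict_mono_on_leD[OF r_mono] by simp

lemma r_less: "0 \<le> s \<Longrightarrow> s < t \<Longrightarrow> t \<le> 1 \<Longrightarrow> r s < r t"
  using strict_mono_onD[OF r_mono] by simp

lemma r_range: "0 \<le> t \<Longrightarrow> t \<le> 1 \<Longrightarrow> r t \<in> {0..r 1}"
  using r_le[of 0 t] r_le[of t 1] r_nonneg by simp

lemma left_limit_cell:
  assumes y: "cadlag y" and s: "0 < s" "s \<le> 1"
  shows "(\<lambda>n. y (r (real (cell n s) / real n))) \<longlonglongrightarrow> left_limit y (r s)"
proof (rule filterlim_compose[OF left_limit_tendsto[OF y]])
  show "0 < r s" using r_less[of 0 s] s r_nonneg by simp
  let ?s = "\<lambda>n. real (cell n s) / real n"
  have ev: "eventually (\<lambda>n. 0 \<le> ?s n \<and> ?s n < s) sequentially"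
    using eventually_gt_at_top[of 0] by eventually_elim (simp add: cell_lower s)
  show "filterlim (\<lambda>n. r (?s n)) (at_left (r s)) sequentially"
    unfolding filterlim_at
  proof
    show "eventually (\<lambda>n. r (?s n) \<in> {..<r s} \<and> r (?s n) \<noteq> r s) sequentially"
      using ev
    proof eventually_elim
      case (elim n)
      then have "r (?s n) < r s" using r_less[of "?s n" s] s by simp
      then show ?case by simp
    qed
    have "?s \<longlonglongrightarrow> s" using cell_tendsto_left[OF s(1)] by (simp add: filterlim_at)
    then show "(\<lambda>n. r (?s n)) \<longlonglongrightarrow> r s"
      by (rule continuous_on_tendsto_compose[OF r_cont])
        (use s ev in \<open>auto elim!: eventually_mono\<close>)
  qed
qed

end

text \<open>After summation by parts the sum on the grid \<open>g (j / n)\<close> contains the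
  integral against \<open>dh\<close> of a step function \<open>F n\<close>, which takes the values
  of the path at the left ends of the cells. These converge pointwise to the left limits and are
  bounded because a cadlag path is, so dominated convergence applies. The free choice of
  \<open>g\<close> lets one sequence of sums serve both sides of a change of time.\<close>

lemma path_integral_riemann_scaled:
  fixes y :: "real \<Rightarrow> 'a::euclidean_space"
  assumes h: "mono_on {0..1} h" "continuous_on {0..1} h" and "time_scale r" and y: "cadlag y"
    and g: "continuous_on {0..1} g" "strict_mono_on {0..1} g" "g 0 = 0" "g 1 = 1"
  shows "riemann_sum (\<lambda>s. h (g s)) (\<lambda>s. r (g s)) y \<longlonglongrightarrow> path_integral h r y"
proof -
  interpret r: time_scale r by fact
  have g_le: "g s \<le> g t" if "0 \<le> s" "s \<le> t" "t \<le> 1" for s t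
    using strict_mono_on_leD[OF g(2)] that by simp
  have g_less: "g s < g t" if "0 \<le> s" "s < t" "t \<le> 1" for s t
    using strict_mono_onD[OF g(2)] that by simp
  have g_range: "g t \<in> {0..1}" if "0 \<le> t" "t \<le> 1" for t
    using g_le[of 0 t] g_le[of t 1] that g by simp
  interpret rg: time_scale "\<lambda>s. r (g s)"
  proof
    show "continuous_on {0..1} (\<lambda>s. r (g s))"
      by (rule continuous_on_compose2[OF r.r_cont g(1)]) (use g_range in auto)
    show "strict_mono_on {0..1} (\<lambda>s. r (g s))"
      using g_range by (intro strict_mono_onI r.r_less) (auto intro: g_less)
    show "0 \<le> r (g 0)" using g r.r_nonneg by simp
  qed
  define m where "m = interval_measure (clamped h)"
  have [measurable_cong]: "sets m = sets borel" by (simp add: m_def)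
  define F where "F n t = (\<Sum>j<n. indicator {g (real j / real n)<..g (real (Suc j) / real n)} t *\<^sub>R y (r (g (real j / real n))))"
    for n t
  obtain K where K: "\<And>t. t \<in> {0..r 1} \<Longrightarrow> norm (y t) \<le> K" using cadlag_bounded[OF y] by blast
  have em: "emeasure m {a<..b} = ennreal (h b - h a)" if "0 \<le> a" "a \<le> b" "b \<le> 1" for a b
    unfolding m_def using h that by (rule emeasure_clamped)
  \<comment> \<open>Every point of \<open>{0<..1}\<close> is \<open>g s\<close> for some
    \<open>s\<close> there, so the cells of the image grid are reduced to the equidistant cells
    containing \<open>s\<close>.\<close>
  have inv: "\<exists>s. 0 < s \<and> s \<le> 1 \<and> g s = t" if t: "0 < t" "t \<le> 1" for t
  proof -
    obtain s where "0 \<le> s" "s \<le> 1" "g s = t" using IVT'[of g 0 t 1] g(1,3,4) t by auto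
    then show ?thesis using g t by (intro exI[of _ s]) (cases "s = 0", auto)
  qed
  have F_eq: "F n (g s) = y (r (g (real (cell n s) / real n)))" if s: "0 < s" "s \<le> 1" "0 < n" for n s
  proof -
    have "indicator {g (real j / real n)<..g (real (Suc j) / real n)} (g s) =
        (indicator {real j / real n<..real (Suc j) / real n} s :: real)" if "j < n" for j
    proof -
      have "0 \<le> real j / real n" "real (Suc j) / real n \<le> 1" "0 \<le> real (Suc j) / real n" "real j / real n \<le> 1"
        using that by (auto simp: divide_simps)
      then have "g (real j / real n) < g s \<longleftrightarrow> real j / real n < s"
        "g s \<le> g (real (Suc j) / real n) \<longleftrightarrow> s \<le> real (Suc j) / real n"
        using strict_mono_on_less[OF g(2)] strict_mono_on_less_eq[OF g(2)] s by auto
      then show ?thesis by (simp add: indicator_def)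
    qed
    then show ?thesis unfolding F_def
      using sum_cell[OF s(1,2,3), of "\<lambda>j. y (r (g (real j / real n)))"] by simp
  qed
  have "(\<lambda>n. LINT t|m. indicator {0<..1} t *\<^sub>R F n t) \<longlonglongrightarrow>
      (LINT t|m. indicator {0<..1} t *\<^sub>R left_limit y (r t))"
  proof (rule integral_dominated_convergence[where w="\<lambda>t. indicator {0<..1} t * K"])
    have lim: "(\<lambda>n. indicator {0<..1} t *\<^sub>R F n t) \<longlonglongrightarrow> indicator {0<..1} t *\<^sub>R left_limit y (r t)" for t
    proof (cases "t \<in> {0<..1}")
      case True
      then obtain s where s: "0 < s" "s \<le> 1" "g s = t" using inv by auto
      have "(\<lambda>n. F n t) \<longlonglongrightarrow> left_limit y (r t)"
      proof (rule Lim_transform_eventually)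
        show "(\<lambda>n. y (r (g (real (cell n s) / real n)))) \<longlonglongrightarrow> left_limit y (r t)"
          using rg.left_limit_cell[OF y s(1,2)] s(3) by simp
        show "eventually (\<lambda>n. y (r (g (real (cell n s) / real n))) = F n t) sequentially"
          using eventually_gt_at_top[of 0] by eventually_elim (use F_eq s in auto)
      qed
      then show ?thesis by (intro tendsto_intros)
    qed simp
    then show "AE t in m. (\<lambda>n. indicator {0<..1} t *\<^sub>R F n t) \<longlonglongrightarrow> indicator {0<..1} t *\<^sub>R left_limit y (r t)"
      by simp
    show [measurable]: "(\<lambda>t. indicator {0<..1} t *\<^sub>R F n t) \<in> borel_measurable m" for n
      unfolding F_def by measurable
    show "(\<lambda>t. indicator {0<..1} t *\<^sub>R left_limit y (r t)) \<in> borel_measurable m"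
      by (rule borel_measurable_LIMSEQ_metric[OF _ lim]) measurable
    show "integrable m (\<lambda>t. indicator {0<..1} t * K)"
      using em[of 0 1] by (intro integrable_mult_left integrable_real_indicator) auto
    show "AE t in m. norm (indicator {0<..1} t *\<^sub>R F n t) \<le> indicator {0<..1} t * K" for n
    proof (rule AE_I2)
      fix t
      have K0: "0 \<le> K" using K[of 0] r.r_range[of 1] by (simp add: order_trans[OF norm_ge_zero])
      have "norm (F n t) \<le> K" if t: "t \<in> {0<..1}"
      proof (cases "n = 0")
        case False
        obtain s where s: "0 < s" "s \<le> 1" "g s = t" using inv t by auto
        have "real (cell n s) / real n \<in> {0..1}"
          using cell_less[OF s(1,2), of n] False by simp
        then show ?thesis
          using F_eq[OF s(1,2), of n] s(3) False rg.r_range[of "real (cell n s) / real n"] g K by auto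
      qed (use K0 in \<open>simp add: F_def\<close>)
      then show "norm (indicator {0<..1} t *\<^sub>R F n t) \<le> indicator {0<..1} t * K"
        by (simp add: indicator_def)
    qed
  qed
  moreover have "(LINT t|m. indicator {0<..1} t *\<^sub>R left_limit y (r t)) = stieltjes_integral h (\<lambda>t. left_limit y (r t))"
    by (simp add: stieltjes_integral_mono[OF h(1)] m_def set_lebesgue_integral_def)
  moreover have "(LINT t|m. indicator {0<..1} t *\<^sub>R F n t) =
      (\<Sum>j<n. (h (g (real (Suc j) / real n)) - h (g (real j / real n))) *\<^sub>R y (r (g (real j / real n))))" for n
  proof -
    have u: "0 \<le> g (real j / real n)" "g (real j / real n) \<le> g (real (Suc j) / real n)" "g (real (Suc j) / real n) \<le> 1"
      if "j < n" for j
    proof -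
      have "0 \<le> real j / real n" "real j / real n \<le> real (Suc j) / real n" "real (Suc j) / real n \<le> 1"
        using that by (auto simp: divide_simps)
      then show "0 \<le> g (real j / real n)" "g (real j / real n) \<le> g (real (Suc j) / real n)" "g (real (Suc j) / real n) \<le> 1"
        using g_range[of "real j / real n"] g_range[of "real (Suc j) / real n"] g_le by auto
    qed
    have int: "integrable m (indicator {g (real j / real n)<..g (real (Suc j) / real n)} :: real \<Rightarrow> real)"
      if "j < n" for j
      using em[OF u[OF that]] by (intro integrable_real_indicator) auto
    have "indicator {0<..1} t *\<^sub>R F n t = F n t" for t
    proof (cases "t \<in> {0<..1}")
      case False
      have "indicator {g (real j / real n)<..g (real (Suc j) / real n)} t = (0::real)" if "j < n" for j
        using u[OF that] False by (auto simp: indicator_def)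
      then show ?thesis using False by (simp add: F_def)
    qed simp
    then have "(LINT t|m. indicator {0<..1} t *\<^sub>R F n t) = (LINT t|m. F n t)" by simp
    also have "\<dots> = (\<Sum>j<n. LINT t|m. indicator {g (real j / real n)<..g (real (Suc j) / real n)} t *\<^sub>R y (r (g (real j / real n))))"
      unfolding F_def using int by (intro Bochner_Integration.integral_sum integrable_scaleR_left) auto
    also have "\<dots> = (\<Sum>j<n. measure m {g (real j / real n)<..g (real (Suc j) / real n)} *\<^sub>R y (r (g (real j / real n))))"
    proof (intro sum.cong refl)
      fix j assume "j \<in> {..<n}"
      then have "integrable m (indicator {g (real j / real n)<..g (real (Suc j) / real n)} :: real \<Rightarrow> real)"
        using int by simp
      then show "(LINT t|m. indicator {g (real j / real n)<..g (real (Suc j) / real n)} t *\<^sub>R y (r (g (real j / real n)))) =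
          measure m {g (real j / real n)<..g (real (Suc j) / real n)} *\<^sub>R y (r (g (real j / real n)))"
        by (subst integral_scaleR_left) (simp_all add: m_def)
    qed
    also have "\<dots> = (\<Sum>j<n. (h (g (real (Suc j) / real n)) - h (g (real j / real n))) *\<^sub>R y (r (g (real j / real n))))"
    proof (intro sum.cong arg_cong2[of _ _ _ _ scaleR] refl)
      fix j assume "j \<in> {..<n}"
      then have j: "j < n" by simp
      have "h (g (real j / real n)) \<le> h (g (real (Suc j) / real n))"
        by (rule mono_onD[OF h(1)]) (use u[OF j] in auto)
      then show "measure m {g (real j / real n)<..g (real (Suc j) / real n)} =
          h (g (real (Suc j) / real n)) - h (g (real j / real n))"
        using em[OF u[OF j]] by (simp add: measure_def)
    qed
    finally show ?thesis .
  qed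
  ultimately have lim: "(\<lambda>n. \<Sum>j<n. (h (g (real (Suc j) / real n)) - h (g (real j / real n))) *\<^sub>R y (r (g (real j / real n))))
      \<longlonglongrightarrow> stieltjes_integral h (\<lambda>t. left_limit y (r t))" by simp
  have "riemann_sum (\<lambda>s. h (g s)) (\<lambda>s. r (g s)) y n = h 1 *\<^sub>R y (r 1) - h 0 *\<^sub>R y (r 0) -
      (\<Sum>j<n. (h (g (real (Suc j) / real n)) - h (g (real j / real n))) *\<^sub>R y (r (g (real j / real n))))"
    if n: "0 < n" for n
    using n g sum_by_parts[of "\<lambda>j. h (g (real j / real n))" "\<lambda>j. y (r (g (real j / real n)))" n]
    by (simp add: riemann_sum_def del: of_nat_Suc)
  then have "eventually (\<lambda>n. h 1 *\<^sub>R y (r 1) - h 0 *\<^sub>R y (r 0) -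
      (\<Sum>j<n. (h (g (real (Suc j) / real n)) - h (g (real j / real n))) *\<^sub>R y (r (g (real j / real n)))) =
      riemann_sum (\<lambda>s. h (g s)) (\<lambda>s. r (g s)) y n) sequentially"
    by (intro eventually_mono[OF eventually_gt_at_top[of 0]]) (rule sym)
  then show ?thesis unfolding path_integral_def
    by (rule Lim_transform_eventually[rotated]) (intro tendsto_intros lim)
qed

lemma path_integral_riemann:
  assumes "mono_on {0..1} h" "continuous_on {0..1} h" "time_scale r" "cadlag y"
  shows "riemann_sum h r y \<longlonglongrightarrow> path_integral h r y"
  using path_integral_riemann_scaled[OF assms, of "\<lambda>s. s"]
  by (simp add: strict_mono_on_def continuous_on_id)

text \<open>Both integrals are limits of the same sums, cut at equidistant times for the right-hand one.\<close>

lemma path_integral_inverse_time: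
  assumes r: "continuous_on {0..1} r" "strict_mono_on {0..1} r" "r 0 = 0" "r 1 = 1" and y: "cadlag y"
    and g: "continuous_on {0..1} g" "strict_mono_on {0..1} g" "g 0 = 0" "g 1 = 1"
    and rg: "\<And>u. u \<in> {0..1} \<Longrightarrow> r (g u) = u"
  shows "path_integral (\<lambda>u. u) r y = path_integral g (\<lambda>u. u) y"
proof -
  have "riemann_sum (\<lambda>s. g s) (\<lambda>s. r (g s)) y \<longlonglongrightarrow> path_integral (\<lambda>u. u) r y"
    by (rule path_integral_riemann_scaled[OF _ _ _ y g])
      (use r in \<open>auto simp: mono_on_def time_scale_def intro!: continuous_intros\<close>)
  moreover have "riemann_sum g (\<lambda>u. u) y \<longlonglongrightarrow> path_integral g (\<lambda>u. u) y"
    by (rule path_integral_riemann[OF _ g(1) _ y])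
      (use strict_mono_on_imp_mono_on[OF g(2)] in \<open>auto simp: time_scale_def strict_mono_on_def intro!: continuous_intros\<close>)
  moreover have "riemann_sum (\<lambda>s. g s) (\<lambda>s. r (g s)) y = riemann_sum g (\<lambda>u. u) y"
  proof
    fix n
    have "r (g (real j / real n)) = real j / real n" "r (g (real (Suc j) / real n)) = real (Suc j) / real n"
      if "j < n" for j
      by (rule rg, use that in \<open>simp add: divide_simps\<close>)+
    then show "riemann_sum (\<lambda>s. g s) (\<lambda>s. r (g s)) y n = riemann_sum g (\<lambda>u. u) y n"
      by (simp add: riemann_sum_def)
  qed
  ultimately show ?thesis by (simp add: LIMSEQ_unique)
qed

text \<open>The two boundary terms contribute at most \<open>C * K\<close> each, the sum against the
  increments of \<open>h\<close> at most \<open>(h 1 - h 0) * K \<le> 2 * C * K\<close>. Since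
  \<open>K\<close> bounds the path only on the range of \<open>r\<close>, integrals over a short
  time span are small.\<close>

lemma norm_path_integral_le:
  fixes y :: "real \<Rightarrow> 'a::euclidean_space"
  assumes h: "mono_on {0..1} h" "continuous_on {0..1} h" and r: "time_scale r" and y: "cadlag y"
    and C: "\<bar>h 0\<bar> \<le> C" "\<bar>h 1\<bar> \<le> C" and K: "\<And>s. s \<in> {r 0..r 1} \<Longrightarrow> norm (y s) \<le> K"
  shows "norm (path_integral h r y) \<le> 4 * C * K"
proof (rule LIMSEQ_le_const2[OF tendsto_norm[OF path_integral_riemann[OF h r y]]])
  interpret time_scale r by fact
  have K': "norm (y (r s)) \<le> K" if "0 \<le> s" "s \<le> 1" for s
    using r_le[of 0 s] r_le[of s 1] that by (intro K) auto
  have K0: "0 \<le> K" using order_trans[OF norm_ge_zero K'[of 0]] by simp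
  have "norm (riemann_sum h r y n) \<le> 4 * C * K" if n: "0 < n" for n
  proof -
    let ?d = "\<lambda>j. h (real (Suc j) / real n) - h (real j / real n)"
    have d: "0 \<le> ?d j" "norm (y (r (real j / real n))) \<le> K" if "j < n" for j
      using that by (auto intro!: K' mono_onD[OF h(1)] simp: divide_simps)
    have "norm (\<Sum>j<n. ?d j *\<^sub>R y (r (real j / real n))) \<le> (\<Sum>j<n. ?d j * K)"
      by (rule sum_norm_le) (use d in \<open>auto intro!: mult_left_mono\<close>)
    also have "\<dots> = (h 1 - h 0) * K"
      unfolding sum_distrib_right[symmetric] using n
        sum_lessThan_telescope[of "\<lambda>j. h (real j / real n)" n] by simp
    finally have 1: "norm (\<Sum>j<n. ?d j *\<^sub>R y (r (real j / real n))) \<le> (h 1 - h 0) * K" .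
    have eq: "riemann_sum h r y n = h 1 *\<^sub>R y (r 1) - h 0 *\<^sub>R y (r 0) - (\<Sum>j<n. ?d j *\<^sub>R y (r (real j / real n)))"
      using n sum_by_parts[of "\<lambda>j. h (real j / real n)" "\<lambda>j. y (r (real j / real n))" n]
      by (simp add: riemann_sum_def del: of_nat_Suc)
    have "norm (riemann_sum h r y n) \<le> norm (h 1 *\<^sub>R y (r 1)) + norm (h 0 *\<^sub>R y (r 0)) + (h 1 - h 0) * K"
      unfolding eq using 1 norm_triangle_ineq4 by (smt (verit))
    also have "norm (h 1 *\<^sub>R y (r 1)) \<le> C * K" using C K'[of 1] by (auto intro!: mult_mono')
    also have "norm (h 0 *\<^sub>R y (r 0)) \<le> C * K" using C K'[of 0] by (auto intro!: mult_mono')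
    also have "(h 1 - h 0) * K \<le> (C + C) * K" using C K0 by (intro mult_right_mono) auto
    finally show ?thesis by (simp add: algebra_simps)
  qed
  then show "\<exists>N. \<forall>n\<ge>N. norm (riemann_sum h r y n) \<le> 4 * C * K" by (intro exI[of _ 1]) auto
qed

section \<open>The exponent of a Levy process\<close>

lemma borel_prob_distr:
  "prob_space M \<Longrightarrow> X \<in> borel_measurable M \<Longrightarrow> borel_prob (distr M borel X)"
  by (simp add: borel_prob_def prob_space.prob_space_distr)

lemma chf_distr:
  "X \<in> borel_measurable M \<Longrightarrow> chf (distr M borel X) y = (CLINT \<omega>|M. iexp (X \<omega> \<bullet> y))"
  unfolding chf_def by (subst integral_distr) auto

lemma (in prob_space) tendsto_expectation_iexp:
  fixes f :: "nat \<Rightarrow> 'a \<Rightarrow> real"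
  assumes [measurable]: "\<And>n. f n \<in> borel_measurable M" "g \<in> borel_measurable M"
    and lim: "AE \<omega> in M. (\<lambda>n. f n \<omega>) \<longlonglongrightarrow> g \<omega>"
  shows "(\<lambda>n. CLINT \<omega>|M. iexp (f n \<omega>)) \<longlonglongrightarrow> (CLINT \<omega>|M. iexp (g \<omega>))"
proof (rule integral_dominated_convergence[where w="\<lambda>_. 1"])
  show "AE \<omega> in M. (\<lambda>n. iexp (f n \<omega>)) \<longlonglongrightarrow> iexp (g \<omega>)"
    using lim by eventually_elim (intro tendsto_intros)
qed auto

lemma (in prob_space) continuous_chf_distr:
  fixes X :: "'a \<Rightarrow> 'b::euclidean_space"
  assumes [measurable]: "X \<in> borel_measurable M"
  shows "continuous_on UNIV (\<lambda>y. CLINT \<omega>|M. iexp (X \<omega> \<bullet> y))"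
proof -
  have "isCont (\<lambda>y. CLINT \<omega>|M. iexp (X \<omega> \<bullet> y)) y" for y
    unfolding continuous_at_sequentially comp_def
    by (intro allI impI tendsto_expectation_iexp always_eventually) (auto intro!: tendsto_intros)
  then show ?thesis by (simp add: continuous_at_imp_continuous_on)
qed

text \<open>The added \<open>1\<close> puts these rationals strictly to the right of
  \<open>t\<close>, even if \<open>t\<close> is one of them, so that right continuity of the paths
  applies.\<close>

lemma right_approx:
  assumes "0 \<le> t"
  shows "filterlim (\<lambda>n. (real (nat \<lfloor>t * real (Suc n)\<rfloor>) + 1) / real (Suc n)) (at_right t) sequentially"
    (is "filterlim ?q _ _")
  unfolding filterlim_at
proof
  have b: "t < ?q n \<and> ?q n \<le> t + 1 / real (Suc n)" for n
  proof -
    define k where "k = \<lfloor>t * real (Suc n)\<rfloor>"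
    have "real (nat k) = of_int k" using assms by (simp add: k_def)
    moreover have "of_int k \<le> t * real (Suc n)" "t * real (Suc n) < of_int k + 1"
      unfolding k_def by linarith+
    moreover have "0 < real (Suc n)" by simp
    ultimately show ?thesis unfolding k_def[symmetric]
      by (simp only: pos_less_divide_eq pos_divide_le_eq distrib_right times_divide_eq_left) simp
  qed
  show "eventually (\<lambda>n. ?q n \<in> {t<..} \<and> ?q n \<noteq> t) sequentially"
  proof (intro always_eventually allI conjI)
    show "?q n \<in> {t<..}" "?q n \<noteq> t" for n using b[of n] by (simp_all del: of_nat_Suc)
  qed
  show "?q \<longlonglongrightarrow> t"
  proof (rule tendsto_sandwich[OF always_eventually always_eventually])
    show "\<forall>n. t \<le> ?q n" "\<forall>n. ?q n \<le> t + 1 / real (Suc n)" using b less_imp_le by blast+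
    show "(\<lambda>n. t + 1 / real (Suc n)) \<longlonglongrightarrow> t"
      using tendsto_add[OF tendsto_const LIMSEQ_inverse_real_of_nat, of t]
      by (simp add: inverse_eq_divide)
  qed simp
qed

lemma increasing_nonneg:
  fixes t :: "nat \<Rightarrow> real"
  assumes "0 \<le> t 0" "\<And>i. i < n \<Longrightarrow> t i < t (Suc i)" "i \<le> n"
  shows "0 \<le> t i"
  using assms(3)
proof (induction i)
  case (Suc i)
  then show ?case using assms(2)[of i] by simp
qed (rule assms(1))

context levy_process
begin

lemma measurable_Y [measurable]: "0 \<le> t \<Longrightarrow> Y t \<in> borel_measurable M"
  by (rule random_vector)

definition ch :: "real \<Rightarrow> 'a \<Rightarrow> complex" where
  "ch t y = (CLINT \<omega>|M. iexp (Y t \<omega> \<bullet> y))"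

lemma chf_eq_ch: "0 \<le> t \<Longrightarrow> chf (distr M borel (Y t)) y = ch t y"
  by (simp add: ch_def chf_distr)

lemma ch_increment:
  assumes "0 \<le> s" "0 \<le> t"
  shows "(CLINT \<omega>|M. iexp ((Y (s + t) \<omega> - Y s \<omega>) \<bullet> y)) = ch t y"
proof -
  have "(CLINT \<omega>|M. iexp ((Y (s + t) \<omega> - Y s \<omega>) \<bullet> y)) = chf (distr M borel (\<lambda>\<omega>. Y (s + t) \<omega> - Y s \<omega>)) y"
    using assms by (subst chf_distr) auto
  also have "\<dots> = chf (distr M borel (\<lambda>\<omega>. Y t \<omega> - Y 0 \<omega>)) y"
    using stationary_increments[OF assms] by simp
  also have "\<dots> = (CLINT \<omega>|M. iexp ((Y t \<omega> - Y 0 \<omega>) \<bullet> y))"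
    using assms by (subst chf_distr) auto
  also have "\<dots> = ch t y" unfolding ch_def
    by (rule Bochner_Integration.integral_cong) (auto simp: start_zero)
  finally show ?thesis .
qed

text \<open>Each increment has its own frequency \<open>z i\<close> because the inner product of a
  Riemann sum with \<open>y\<close> has this form, with \<open>z i\<close> a multiple of
  \<open>y\<close> by a value of the integrand.\<close>

lemma ch_increments:
  fixes n :: nat and t :: "nat \<Rightarrow> real"
  assumes "0 \<le> t 0" "\<And>i. i < n \<Longrightarrow> t i < t (Suc i)"
  shows "(CLINT \<omega>|M. iexp (\<Sum>i<n. (Y (t (Suc i)) \<omega> - Y (t i) \<omega>) \<bullet> z i)) = (\<Prod>i<n. ch (t (Suc i) - t i) (z i))"
proof -
  have nonneg: "0 \<le> t i" if "i \<le> n" for i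
    by (rule increasing_nonneg[OF assms that])
  have m: "Y (t (Suc i)) \<in> borel_measurable M" "Y (t i) \<in> borel_measurable M" if "i < n" for i
    using nonneg[of i] nonneg[of "Suc i"] that by auto
  have ind: "indep_vars (\<lambda>_. borel) (\<lambda>i \<omega>. iexp ((Y (t (Suc i)) \<omega> - Y (t i) \<omega>) \<bullet> z i)) {..<n}"
    by (rule indep_vars_compose2[OF independent_increments[OF assms], where N="\<lambda>_. borel" and Y="\<lambda>i x. iexp (x \<bullet> z i)"])
      auto
  have "(CLINT \<omega>|M. iexp (\<Sum>i<n. (Y (t (Suc i)) \<omega> - Y (t i) \<omega>) \<bullet> z i)) =
      (CLINT \<omega>|M. (\<Prod>i<n. iexp ((Y (t (Suc i)) \<omega> - Y (t i) \<omega>) \<bullet> z i)))"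
    by (simp add: exp_sum sum_distrib_left)
  also have "\<dots> = (\<Prod>i<n. CLINT \<omega>|M. iexp ((Y (t (Suc i)) \<omega> - Y (t i) \<omega>) \<bullet> z i))"
  proof (rule indep_vars_lebesgue_integral[OF _ ind])
    show "integrable M (\<lambda>\<omega>. iexp ((Y (t (Suc i)) \<omega> - Y (t i) \<omega>) \<bullet> z i))" if "i \<in> {..<n}" for i
      using m[of i] that by (intro integrable_iexp) auto
  qed simp
  also have "\<dots> = (\<Prod>i<n. ch (t (Suc i) - t i) (z i))"
  proof (intro prod.cong refl)
    fix i assume "i \<in> {..<n}"
    then show "(CLINT \<omega>|M. iexp ((Y (t (Suc i)) \<omega> - Y (t i) \<omega>) \<bullet> z i)) = ch (t (Suc i) - t i) (z i)"
      using ch_increment[of "t i" "t (Suc i) - t i" "z i"] nonneg[of i] assms(2)[of i] by simp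
  qed
  finally show ?thesis .
qed

lemma ch_of_nat_mult:
  assumes "0 < t"
  shows "ch (real k * t) y = ch t y ^ k"
proof -
  have "(CLINT \<omega>|M. iexp (\<Sum>i<k. (Y (real (Suc i) * t) \<omega> - Y (real i * t) \<omega>) \<bullet> y)) = ch (real k * t) y"
    unfolding ch_def inner_sum_left[symmetric]
      sum_lessThan_telescope[of "\<lambda>i. Y (real i * t) \<omega>" for \<omega>]
    by (rule Bochner_Integration.integral_cong) (auto simp: start_zero)
  moreover have "(CLINT \<omega>|M. iexp (\<Sum>i<k. (Y (real (Suc i) * t) \<omega> - Y (real i * t) \<omega>) \<bullet> y)) = ch t y ^ k"
    using assms by (subst ch_increments[where t="\<lambda>i. real i * t"]) (simp_all add: algebra_simps)
  ultimately show ?thesis by simp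
qed

lemma ch_tendsto_right:
  assumes "0 \<le> t" and q: "filterlim q (at_right t) sequentially"
  shows "(\<lambda>n. ch (q n) y) \<longlonglongrightarrow> ch t y"
proof -
  have "eventually (\<lambda>n. t < q n) sequentially"
    using q by (auto simp: filterlim_at elim: eventually_mono)
  \<comment> \<open>Measurability of \<open>Y\<close> is known at nonnegative times only, and
    \<open>q\<close> exceeds \<open>t\<close> only eventually; hence the shift by
    \<open>N\<close>.\<close>
  then obtain N where N: "\<And>n. n \<ge> N \<Longrightarrow> t < q n" by (auto simp: eventually_sequentially)
  have "(\<lambda>n. ch (q (n + N)) y) \<longlonglongrightarrow> ch t y"
    unfolding ch_def
  proof (rule tendsto_expectation_iexp)
    show "(\<lambda>\<omega>. Y (q (n + N)) \<omega> \<bullet> y) \<in> borel_measurable M" for n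
      using N[of "n + N"] assms(1) by (intro borel_measurable_inner measurable_Y) auto
    show "(\<lambda>\<omega>. Y t \<omega> \<bullet> y) \<in> borel_measurable M"
      using assms(1) by (intro borel_measurable_inner measurable_Y) auto
    show "AE \<omega> in M. (\<lambda>n. Y (q (n + N)) \<omega> \<bullet> y) \<longlonglongrightarrow> Y t \<omega> \<bullet> y"
    proof (rule AE_I2)
      fix \<omega> assume "\<omega> \<in> space M"
      then have "((\<lambda>s. Y s \<omega>) \<longlongrightarrow> Y t \<omega>) (at_right t)"
        using cadlag_paths assms(1) by (auto simp: cadlag_def)
      from LIMSEQ_ignore_initial_segment[OF filterlim_compose[OF this q], of N]
      show "(\<lambda>n. Y (q (n + N)) \<omega> \<bullet> y) \<longlonglongrightarrow> Y t \<omega> \<bullet> y" by (intro tendsto_intros)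
    qed
  qed
  then show ?thesis by (rule LIMSEQ_offset)
qed

lemma ch_zero_time: "ch 0 y = 1"
proof -
  have "ch 0 y = (CLINT \<omega>|M. 1)" unfolding ch_def
    by (rule Bochner_Integration.integral_cong) (auto simp: start_zero)
  then show ?thesis by (simp add: prob_space)
qed

lemma ch_zero [simp]: "ch t 0 = 1"
  by (simp add: ch_def prob_space)

lemma continuous_ch: "0 \<le> t \<Longrightarrow> continuous_on UNIV (ch t)"
  unfolding ch_def by (rule continuous_chf_distr) simp

lemma ch_one_root:
  assumes "0 < n"
  shows "ch 1 y = ch (1 / real n) y ^ n"
  using ch_of_nat_mult[of "1 / real n" n y] assms by simp

text \<open>A zero at time 1 would be a zero at every time \<open>1 / n\<close>, whereas these
  values tend to \<open>ch 0 y = 1\<close> by right continuity of the paths at 0.\<close>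

lemma ch_one_nonzero: "ch 1 y \<noteq> 0"
proof
  assume "ch 1 y = 0"
  then have 0: "ch (1 / real (Suc n)) y = 0" for n using ch_one_root[of "Suc n" y] by auto
  have "filterlim (\<lambda>n. 1 / real (Suc n)) (at_right 0) sequentially"
    unfolding filterlim_at using LIMSEQ_inverse_real_of_nat by (simp add: inverse_eq_divide)
  from ch_tendsto_right[OF _ this, of y] show False
    unfolding 0 ch_zero_time by (simp add: LIMSEQ_const_iff)
qed

text \<open>At a time \<open>1/n\<close> the two sides differ by a continuous function of \<open>y\<close> with values in the
  finite set of \<open>n\<close>-th roots of unity.\<close>

lemma ch_exponent:
  assumes \<psi>: "continuous_on UNIV \<psi>" "\<psi> 0 = 0" "\<And>y. ch 1 y = exp (\<psi> y)" and t: "0 \<le> t"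
  shows "ch t y = exp (of_real t * \<psi> y)"
proof -
  have root: "ch (1 / real n) y = exp (of_real (1 / real n) * \<psi> y)" if n: "0 < n" for n y
  proof -
    define q where "q y = ch (1 / real n) y * exp (- (\<psi> y / of_nat n))" for y
    have "q y ^ n = 1" for y
    proof -
      have "q y ^ n = ch 1 y * exp (- \<psi> y)"
        using n ch_one_root[OF n, of y] by (simp add: q_def power_mult_distrib exp_of_nat_mult[symmetric])
      then show ?thesis by (simp add: \<psi>(3) exp_minus)
    qed
    then have "finite (range q)"
      by (intro finite_subset[OF _ finite_roots_unity[of n]]) (use n in auto)
    moreover have "continuous_on UNIV q"
      unfolding q_def by (intro continuous_intros \<psi>(1) continuous_ch) (use n in auto)
    ultimately have "q constant_on UNIV"
      by (intro continuous_finite_range_constant) auto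
    then have "q y = q 0" by (auto simp: constant_on_def)
    also have "q 0 = 1" by (simp add: q_def \<psi>(2))
    finally show ?thesis by (simp add: q_def exp_minus field_simps)
  qed
  \<comment> \<open>From the times \<open>1 / n\<close> the formula passes to their multiples by
    taking powers, and from these to \<open>t\<close> by right continuity.\<close>
  let ?q = "\<lambda>n. (real (nat \<lfloor>t * real (Suc n)\<rfloor>) + 1) / real (Suc n)"
  have "(\<lambda>n. ch (?q n) y) \<longlonglongrightarrow> ch t y"
    by (rule ch_tendsto_right[OF t right_approx[OF t]])
  moreover have "ch (?q n) y = exp (of_real (?q n) * \<psi> y)" for n
  proof -
    define k where "k = Suc (nat \<lfloor>t * real (Suc n)\<rfloor>)"
    have q: "?q n = real k * (1 / real (Suc n))" by (simp add: k_def)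
    have "ch (?q n) y = exp (of_real (1 / real (Suc n)) * \<psi> y) ^ k"
      unfolding q by (subst ch_of_nat_mult) (simp_all only: root, simp)
    also have "\<dots> = exp (of_real (?q n) * \<psi> y)"
      unfolding q exp_of_nat_mult[symmetric] by (simp add: mult.assoc)
    finally show ?thesis .
  qed
  moreover have "(\<lambda>n. exp (of_real (?q n) * \<psi> y)) \<longlonglongrightarrow> exp (of_real t * \<psi> y)"
    using right_approx[OF t] by (intro tendsto_intros) (simp add: filterlim_at)
  ultimately show ?thesis by (simp add: LIMSEQ_unique)
qed

text \<open>A continuous function without zeros on a contractible space has a continuous logarithm.
  Subtracting its value at 0, whose exponential is 1, normalizes it, and the normalization is what
  makes it usable in \<open>ch_exponent\<close>.\<close>

lemma exponent_exists:
  obtains \<psi> where "continuous_on UNIV \<psi>" "\<psi> 0 = 0" "\<And>y. ch 1 y = exp (\<psi> y)"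
proof -
  obtain g where g: "continuous_on UNIV g" "\<And>y. ch 1 y = exp (g y)"
    using continuous_logarithm_on_contractible[of UNIV "ch 1"] continuous_ch[of 1] ch_one_nonzero
    by auto
  have "exp (g 0) = 1" using g(2)[of 0] by simp
  then have "ch 1 y = exp (g y - g 0)" for y using g(2)[of y] by (simp add: exp_diff)
  moreover have "continuous_on UNIV (\<lambda>y. g y - g 0)" by (intro continuous_intros g(1))
  ultimately show ?thesis using that[of "\<lambda>y. g y - g 0"] by simp
qed

end

section \<open>The exponent of a random integral\<close>

lemma riemann_right_tendsto:
  fixes F :: "real \<Rightarrow> 'b::euclidean_space"
  assumes F: "continuous_on {0..1} F"
  shows "(\<lambda>n. \<Sum>j<n. (1 / real n) *\<^sub>R F (real (Suc j) / real n)) \<longlonglongrightarrow> (LINT u:{0..1}|lborel. F u)"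
proof (rule LIMSEQ_I)
  fix e :: real assume e: "0 < e"
  have "uniformly_continuous_on {0..1} F" by (rule compact_uniformly_continuous[OF F]) simp
  then obtain d where d: "d > 0"
    "\<And>u v. u \<in> {0..1} \<Longrightarrow> v \<in> {0..1} \<Longrightarrow> dist u v < d \<Longrightarrow> dist (F u) (F v) < e / 2"
    unfolding uniformly_continuous_on_def using e half_gt_zero[OF e] by metis
  have I: "(LINT u:{0..1}|lborel. F u) = integral {0..1} F"
    by (intro set_borel_integral_eq_integral borel_integrable_atLeastAtMost' F)
  have "norm ((\<Sum>j<n. (1 / real n) *\<^sub>R F (real (Suc j) / real n)) - integral {0..1} F) < e"
    if n: "0 < n" "1 / real n < d" for n
  proof -
    let ?u = "\<lambda>j. real j / real n"
    have u: "0 \<le> ?u j" "?u j \<le> ?u (Suc j)" "?u (Suc j) - ?u j = 1 / real n" for j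
      using n by (simp_all add: divide_right_mono diff_divide_distrib[symmetric])
    have u1: "?u j \<le> 1" if "j \<le> n" for j using that n by simp
    have cont: "continuous_on {a..b} F" if "0 \<le> a" "b \<le> 1" for a b
      using that by (intro continuous_on_subset[OF F]) auto
    have piece: "norm ((1 / real n) *\<^sub>R F (?u (Suc j)) - integral {?u j..?u (Suc j)} F) \<le> e / 2 * (1 / real n)"
      if j: "j < n" for j
    proof -
      have c: "continuous_on {?u j..?u (Suc j)} F" using u(1) u1[of "Suc j"] j by (intro cont) auto
      have "integral {?u j..?u (Suc j)} (\<lambda>x. F (?u (Suc j)) - F x) =
          (1 / real n) *\<^sub>R F (?u (Suc j)) - integral {?u j..?u (Suc j)} F"
        using u[of j] by (subst Henstock_Kurzweil_Integration.integral_diff)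
          (auto intro: integrable_continuous_interval c simp del: of_nat_Suc)
      moreover have "norm (integral {?u j..?u (Suc j)} (\<lambda>x. F (?u (Suc j)) - F x)) \<le> e / 2 * (?u (Suc j) - ?u j)"
      proof (rule integral_bound[OF u(2)])
        show "continuous_on {?u j..?u (Suc j)} (\<lambda>x. F (?u (Suc j)) - F x)" by (intro continuous_intros c)
        fix x assume x: "x \<in> {?u j..?u (Suc j)}"
        have "dist (F (?u (Suc j))) (F x) < e / 2"
        proof (rule d(2))
          have "?u (Suc j) \<le> 1" using u1[of "Suc j"] j by simp
          then show "?u (Suc j) \<in> {0..1}" "x \<in> {0..1}"
            using u(1)[of j] u(1)[of "Suc j"] x unfolding atLeastAtMost_iff by linarith+
          have "\<bar>?u (Suc j) - x\<bar> \<le> 1 / real n"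
            using u(3)[of j] x unfolding atLeastAtMost_iff by linarith
          then show "dist (?u (Suc j)) x < d" using n(2) by (simp add: dist_real_def)
        qed
        then show "norm (F (?u (Suc j)) - F x) \<le> e / 2" by (simp add: dist_norm)
      qed
      ultimately show ?thesis by (simp only: u(3))
    qed
    have "integral {0..?u k} F = (\<Sum>j<k. integral {?u j..?u (Suc j)} F)" if "k \<le> n" for k
      using that
    proof (induction k)
      case (Suc k)
      have "integral {0..?u k} F + integral {?u k..?u (Suc k)} F = integral {0..?u (Suc k)} F"
        by (rule Henstock_Kurzweil_Integration.integral_combine[OF u(1,2)])
          (intro integrable_continuous_interval cont order_refl u1 Suc.prems)
      then show ?case using Suc by simp
    qed simp
    from this[of n] have "(\<Sum>j<n. (1 / real n) *\<^sub>R F (?u (Suc j))) - integral {0..1} F =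
        (\<Sum>j<n. (1 / real n) *\<^sub>R F (?u (Suc j)) - integral {?u j..?u (Suc j)} F)"
      using n by (simp add: sum_subtractf)
    moreover have "norm \<dots> \<le> (\<Sum>j<n. e / 2 * (1 / real n))"
      by (rule sum_norm_le) (use piece in simp)
    moreover have "(\<Sum>j<n. e / 2 * (1 / real n)) < e" using n e by simp
    ultimately show ?thesis by simp
  qed
  moreover have "eventually (\<lambda>n. 0 < n \<and> 1 / real n < d) sequentially"
    using order_tendstoD(2)[OF lim_1_over_n d(1)] eventually_gt_at_top[of 0] by eventually_elim simp
  ultimately show "\<exists>N. \<forall>n\<ge>N. norm ((\<Sum>j<n. (1 / real n) *\<^sub>R F (real (Suc j) / real n)) - (LINT u:{0..1}|lborel. F u)) < e"
    unfolding I eventually_sequentially by blast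
qed

definition mixed_exponent :: "(real \<Rightarrow> real) \<Rightarrow> ('a::euclidean_space \<Rightarrow> complex) \<Rightarrow> 'a \<Rightarrow> complex" where
  "mixed_exponent h \<psi> y = (LINT u:{0..1}|lborel. \<psi> (h u *\<^sub>R y))"

context levy_process
begin

lemma measurable_path_integral:
  assumes h: "mono_on {0..1} h" "continuous_on {0..1} h" and r: "time_scale r"
  shows "(\<lambda>\<omega>. path_integral h r (\<lambda>t. Y t \<omega>)) \<in> borel_measurable M"
proof (rule borel_measurable_LIMSEQ_metric)
  interpret r: time_scale r by fact
  show "(\<lambda>\<omega>. riemann_sum h r (\<lambda>t. Y t \<omega>) n) \<in> borel_measurable M" for n
    unfolding riemann_sum_def
  proof (intro borel_measurable_sum borel_measurable_scaleR borel_measurable_diff measurable_Y)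
    fix j assume "j \<in> {..<n}"
    then have "0 \<le> real j / real n" "real j / real n \<le> 1" "0 \<le> real (Suc j) / real n" "real (Suc j) / real n \<le> 1"
      by (auto simp: divide_simps)
    then show "0 \<le> r (real (Suc j) / real n)" "0 \<le> r (real j / real n)"
      using r.r_range by auto
  qed simp
  show "(\<lambda>n. riemann_sum h r (\<lambda>t. Y t \<omega>) n) \<longlonglongrightarrow> path_integral h r (\<lambda>t. Y t \<omega>)" if "\<omega> \<in> space M" for \<omega>
    using path_integral_riemann[OF h r cadlag_paths[OF that]] .
qed

text \<open>By independence the characteristic function of a Riemann sum is the exponential of a
  Riemann sum for \<open>\<psi> (h u *\<^sub>R y)\<close>, and both sides pass to the limit. The
  clock \<open>T * u\<close> is carried along because the laws for varying \<open>T\<close> will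
  form the convolution semigroup of the next process.\<close>

lemma chf_path_integral:
  assumes h: "mono_on {0..1} h" "continuous_on {0..1} h" and T: "0 < T"
    and \<psi>: "continuous_on UNIV \<psi>" "\<psi> 0 = 0" "\<And>y. ch 1 y = exp (\<psi> y)"
  shows "chf (integral_law M Y h (\<lambda>u. T * u)) y = exp (of_real T * mixed_exponent h \<psi> y)"
proof -
  have r: "time_scale (\<lambda>u. T * u)"
    using T by unfold_locales (auto intro!: continuous_intros strict_mono_onI)
  note [measurable] = measurable_path_integral[OF h r]
  have rs: "(CLINT \<omega>|M. iexp (riemann_sum h (\<lambda>u. T * u) (\<lambda>t. Y t \<omega>) n \<bullet> y)) =
      exp (of_real T * (\<Sum>j<n. (1 / real n) *\<^sub>R \<psi> (h (real (Suc j) / real n) *\<^sub>R y)))" if n: "0 < n" for n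
  proof -
    have "riemann_sum h (\<lambda>u. T * u) (\<lambda>t. Y t \<omega>) n \<bullet> y =
        (\<Sum>j<n. (Y (T * (real (Suc j) / real n)) \<omega> - Y (T * (real j / real n)) \<omega>) \<bullet> (h (real (Suc j) / real n) *\<^sub>R y))" for \<omega>
      by (simp add: riemann_sum_def inner_sum_left)
    then have "(CLINT \<omega>|M. iexp (riemann_sum h (\<lambda>u. T * u) (\<lambda>t. Y t \<omega>) n \<bullet> y)) =
        (\<Prod>j<n. ch (T * (real (Suc j) / real n) - T * (real j / real n)) (h (real (Suc j) / real n) *\<^sub>R y))"
      using ch_increments[of "\<lambda>j. T * (real j / real n)" n "\<lambda>j. h (real (Suc j) / real n) *\<^sub>R y"] T n
      by (simp only: divide_strict_right_mono) (simp add: divide_strict_right_mono)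
    also have "\<dots> = (\<Prod>j<n. exp (of_real (T / real n) * \<psi> (h (real (Suc j) / real n) *\<^sub>R y)))"
    proof (intro prod.cong refl)
      fix j
      have "T * (real (Suc j) / real n) - T * (real j / real n) = T / real n"
        by (simp add: add_divide_distrib distrib_left)
      then show "ch (T * (real (Suc j) / real n) - T * (real j / real n)) (h (real (Suc j) / real n) *\<^sub>R y) =
          exp (of_real (T / real n) * \<psi> (h (real (Suc j) / real n) *\<^sub>R y))"
        using ch_exponent[OF \<psi>, of "T / real n"] T by simp
    qed
    also have "\<dots> = exp (of_real T * (\<Sum>j<n. (1 / real n) *\<^sub>R \<psi> (h (real (Suc j) / real n) *\<^sub>R y)))"
      by (simp add: exp_sum[symmetric] sum_distrib_left scaleR_conv_of_real mult.assoc[symmetric])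
    finally show ?thesis .
  qed
  have "continuous_on {0..1} (\<lambda>u. \<psi> (h u *\<^sub>R y))"
    by (rule continuous_on_compose2[OF \<psi>(1)]) (auto intro!: continuous_intros h)
  from riemann_right_tendsto[OF this]
  have "(\<lambda>n. exp (of_real T * (\<Sum>j<n. (1 / real n) *\<^sub>R \<psi> (h (real (Suc j) / real n) *\<^sub>R y)))) \<longlonglongrightarrow>
      exp (of_real T * mixed_exponent h \<psi> y)"
    unfolding mixed_exponent_def by (intro tendsto_intros)
  then have "(\<lambda>n. CLINT \<omega>|M. iexp (riemann_sum h (\<lambda>u. T * u) (\<lambda>t. Y t \<omega>) n \<bullet> y)) \<longlonglongrightarrow>
      exp (of_real T * mixed_exponent h \<psi> y)"
    by (rule Lim_transform_eventually)
      (intro eventually_mono[OF eventually_gt_at_top[of 0]], rule sym, rule rs)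
  moreover have "(\<lambda>n. CLINT \<omega>|M. iexp (riemann_sum h (\<lambda>u. T * u) (\<lambda>t. Y t \<omega>) n \<bullet> y)) \<longlonglongrightarrow>
      (CLINT \<omega>|M. iexp (path_integral h (\<lambda>u. T * u) (\<lambda>t. Y t \<omega>) \<bullet> y))"
  proof (rule tendsto_expectation_iexp)
    have "(\<lambda>\<omega>. riemann_sum h (\<lambda>u. T * u) (\<lambda>t. Y t \<omega>) n) \<in> borel_measurable M" for n
      unfolding riemann_sum_def using T
      by (intro borel_measurable_sum borel_measurable_scaleR borel_measurable_diff measurable_Y) auto
    then show "(\<lambda>\<omega>. riemann_sum h (\<lambda>u. T * u) (\<lambda>t. Y t \<omega>) n \<bullet> y) \<in> borel_measurable M" for n
      by measurable
    show "AE \<omega> in M. (\<lambda>n. riemann_sum h (\<lambda>u. T * u) (\<lambda>t. Y t \<omega>) n \<bullet> y) \<longlonglongrightarrow>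
        path_integral h (\<lambda>u. T * u) (\<lambda>t. Y t \<omega>) \<bullet> y"
      by (intro AE_I2 tendsto_intros path_integral_riemann[OF h r] cadlag_paths)
  qed measurable
  ultimately show ?thesis
    unfolding integral_law_def by (subst chf_distr) (auto dest: LIMSEQ_unique)
qed

lemma borel_prob_integral_law:
  assumes "mono_on {0..1} h" "continuous_on {0..1} h" "time_scale r"
  shows "borel_prob (integral_law M Y h r)"
  unfolding integral_law_def
  by (rule borel_prob_distr[OF prob_space_axioms measurable_path_integral[OF assms]])

end

text \<open>Equal laws at time 1 mean that one exponent serves both processes, and it determines the
  law of the integral. The sample types may differ; this is what makes the description in
  \<open>J_map\<close> unambiguous.\<close>

lemma integral_law_cong_law:
  assumes Y: "levy_process M Y" and Z: "levy_process N Z"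
    and eq: "distr M borel (Y 1) = distr N borel (Z 1)"
    and h: "mono_on {0..1} h" "continuous_on {0..1} h"
  shows "integral_law M Y h (\<lambda>u. u) = integral_law N Z h (\<lambda>u. u)"
proof -
  interpret Y: levy_process M Y by fact
  interpret Z: levy_process N Z by fact
  obtain \<psi> where \<psi>: "continuous_on UNIV \<psi>" "\<psi> 0 = 0" "\<And>y. Y.ch 1 y = exp (\<psi> y)"
    by (rule Y.exponent_exists) auto
  have \<psi>': "Z.ch 1 y = exp (\<psi> y)" for y
    using \<psi>(3)[of y] eq Y.chf_eq_ch[of 1 y] Z.chf_eq_ch[of 1 y] by simp
  have r: "time_scale (\<lambda>u. u)" by unfold_locales (auto intro!: strict_mono_onI)
  show ?thesis
  proof (rule chf_unique)
    show "borel_prob (integral_law M Y h (\<lambda>u. u))" "borel_prob (integral_law N Z h (\<lambda>u. u))"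
      by (rule Y.borel_prob_integral_law Z.borel_prob_integral_law h r)+
    show "chf (integral_law M Y h (\<lambda>u. u)) = chf (integral_law N Z h (\<lambda>u. u))"
      using Y.chf_path_integral[OF h, of 1 \<psi>, OF _ \<psi>] Z.chf_path_integral[OF h, of 1 \<psi>, OF _ \<psi>(1,2) \<psi>']
      by (simp add: fun_eq_iff)
  qed
qed

section \<open>Random walks on the dyadic grids\<close>

text \<open>Indicators of open sets are monotone limits of the continuous functions
  \<open>min 1 (k * infdist x (- U))\<close>; on them the product formula survives the limit.\<close>

lemma (in prob_space) indep_vars_tendsto:
  fixes X :: "nat \<Rightarrow> 'i \<Rightarrow> 'a \<Rightarrow> 'b::euclidean_space"
  assumes I: "finite I" and ind: "\<And>n. indep_vars (\<lambda>_. borel) (X n) I"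
    and Y: "\<And>i. i \<in> I \<Longrightarrow> Y i \<in> borel_measurable M"
    and lim: "\<And>i. i \<in> I \<Longrightarrow> AE \<omega> in M. (\<lambda>n. X n i \<omega>) \<longlonglongrightarrow> Y i \<omega>"
  shows "indep_vars (\<lambda>_. borel) Y I"
proof (cases "I = {}")
  case True
  then show ?thesis by (simp add: indep_vars_def indep_sets_def)
next
  case False
  have Xm: "X n i \<in> borel_measurable M" if "i \<in> I" for n i
    using ind[of n] that by (simp add: indep_vars_def)
  \<comment> \<open>The distance \<open>infdist\<close> to the empty set is \<open>0\<close> by
    convention, hence the separate value for \<open>U = UNIV\<close>.\<close>
  define \<phi> where "\<phi> k U x = (if U = UNIV then 1 else min 1 (real k * infdist x (- U)))" for k U and x :: 'b
  have \<phi>_cont: "continuous_on UNIV (\<phi> k U)" for k U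
    unfolding \<phi>_def by (cases "U = UNIV") (auto intro!: continuous_intros)
  have [measurable]: "\<phi> k U \<in> borel_measurable borel" for k U
    by (rule borel_measurable_continuous_onI[OF \<phi>_cont])
  have \<phi>_bound: "0 \<le> \<phi> k U x" "\<phi> k U x \<le> 1" for k U x
    by (auto simp: \<phi>_def infdist_nonneg)
  have \<phi>_lim: "(\<lambda>k. \<phi> k U x) \<longlonglongrightarrow> indicator U x" if "open U" for U x
  proof (cases "x \<in> U \<and> U \<noteq> UNIV")
    case True
    then have pos: "0 < infdist x (- U)"
      using that by (intro infdist_pos_not_in_closed) auto
    have "eventually (\<lambda>k. real k \<ge> 1 / infdist x (- U)) sequentially"
      using filterlim_real_sequentially by (auto simp: filterlim_at_top)
    then have "eventually (\<lambda>k. \<phi> k U x = indicator U x) sequentially"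
      by eventually_elim (use True pos in \<open>auto simp: \<phi>_def field_simps\<close>)
    then show ?thesis by (rule tendsto_eventually)
  next
    case False
    then have "\<phi> k U x = indicator U x" for k by (auto simp: \<phi>_def)
    then show ?thesis by simp
  qed
  have prod_lim: "(\<lambda>n. expectation (\<lambda>\<omega>. \<Prod>i\<in>J. f n i \<omega>)) \<longlonglongrightarrow> expectation (\<lambda>\<omega>. \<Prod>i\<in>J. F i \<omega>)"
    if J: "finite J" and f: "\<And>n i. i \<in> J \<Longrightarrow> f n i \<in> borel_measurable M" "\<And>i. i \<in> J \<Longrightarrow> F i \<in> borel_measurable M"
      "\<And>n i \<omega>. 0 \<le> f n i \<omega> \<and> f n i \<omega> \<le> 1" and l: "\<And>i. i \<in> J \<Longrightarrow> AE \<omega> in M. (\<lambda>n. f n i \<omega>) \<longlonglongrightarrow> F i \<omega>"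
    for J :: "'i set" and f :: "nat \<Rightarrow> 'i \<Rightarrow> 'a \<Rightarrow> real" and F
  proof (rule integral_dominated_convergence[where w="\<lambda>_. 1"])
    have "AE \<omega> in M. \<forall>i\<in>J. (\<lambda>n. f n i \<omega>) \<longlonglongrightarrow> F i \<omega>" using J l by (intro AE_finite_allI)
    then show "AE \<omega> in M. (\<lambda>n. \<Prod>i\<in>J. f n i \<omega>) \<longlonglongrightarrow> (\<Prod>i\<in>J. F i \<omega>)"
      by eventually_elim (intro tendsto_prod, blast)
    show "AE \<omega> in M. norm (\<Prod>i\<in>J. f n i \<omega>) \<le> 1" for n
    proof (rule AE_I2)
      show "norm (\<Prod>i\<in>J. f n i \<omega>) \<le> 1" for \<omega>
        using prod_le_1[of J "\<lambda>i. f n i \<omega>"] prod_nonneg[of J "\<lambda>i. f n i \<omega>"] f(3) by simp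
    qed
  qed (use f in \<open>auto intro!: borel_measurable_prod\<close>)
  have \<phi>X: "(\<lambda>\<omega>. \<phi> k U (X n i \<omega>)) \<in> borel_measurable M" "(\<lambda>\<omega>. \<phi> k U (Y i \<omega>)) \<in> borel_measurable M"
    if "i \<in> I" for k U n i
    using Xm[OF that] Y[OF that] by measurable
  have step: "expectation (\<lambda>\<omega>. \<Prod>i\<in>I. \<phi> k (A i) (Y i \<omega>)) = (\<Prod>i\<in>I. expectation (\<lambda>\<omega>. \<phi> k (A i) (Y i \<omega>)))" for k A
  proof -
    have l: "AE \<omega> in M. (\<lambda>n. \<phi> k (A i) (X n i \<omega>)) \<longlonglongrightarrow> \<phi> k (A i) (Y i \<omega>)" if "i \<in> I" for i
      using lim[OF that] by eventually_elim (rule continuous_on_tendsto_compose[OF \<phi>_cont], auto)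
    have "(\<lambda>n. expectation (\<lambda>\<omega>. \<Prod>i\<in>I. \<phi> k (A i) (X n i \<omega>))) \<longlonglongrightarrow> expectation (\<lambda>\<omega>. \<Prod>i\<in>I. \<phi> k (A i) (Y i \<omega>))"
      by (rule prod_lim[OF I \<phi>X _ l]) (simp_all add: \<phi>_bound)
    moreover have "(\<lambda>n. \<Prod>i\<in>I. expectation (\<lambda>\<omega>. \<phi> k (A i) (X n i \<omega>))) \<longlonglongrightarrow> (\<Prod>i\<in>I. expectation (\<lambda>\<omega>. \<phi> k (A i) (Y i \<omega>)))"
    proof (rule tendsto_prod)
      show "(\<lambda>n. expectation (\<lambda>\<omega>. \<phi> k (A i) (X n i \<omega>))) \<longlonglongrightarrow> expectation (\<lambda>\<omega>. \<phi> k (A i) (Y i \<omega>))" if "i \<in> I" for i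
        using prod_lim[of "{i}", OF _ \<phi>X _ l] that by (simp add: \<phi>_bound)
    qed
    moreover have "expectation (\<lambda>\<omega>. \<Prod>i\<in>I. \<phi> k (A i) (X n i \<omega>)) = (\<Prod>i\<in>I. expectation (\<lambda>\<omega>. \<phi> k (A i) (X n i \<omega>)))" for n
    proof (rule indep_vars_lebesgue_integral[OF I])
      show "indep_vars (\<lambda>_. borel) (\<lambda>i \<omega>. \<phi> k (A i) (X n i \<omega>)) I"
        by (rule indep_vars_compose2[OF ind]) measurable
      show "integrable M (\<lambda>\<omega>. \<phi> k (A i) (X n i \<omega>))" if "i \<in> I" for i
        using Xm[OF that] by (intro integrable_const_bound[of _ 1]) (auto simp: \<phi>_bound)
    qed
    ultimately show ?thesis by (simp add: LIMSEQ_unique)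
  qed
  have "prob (\<Inter>i\<in>I. Y i -` A i \<inter> space M) = (\<Prod>i\<in>I. prob (Y i -` A i \<inter> space M))"
    if A: "A \<in> (\<Pi> i\<in>I. {S. open S})" for A
  proof -
    have op: "open (A i)" if "i \<in> I" for i using A that by auto
    have Am [measurable]: "A i \<in> sets borel" if "i \<in> I" for i using op[OF that] by simp
    have ind: "(\<lambda>\<omega>. indicat_real (A i) (Y i \<omega>)) \<in> borel_measurable M"
      "AE \<omega> in M. (\<lambda>k. \<phi> k (A i) (Y i \<omega>)) \<longlonglongrightarrow> indicat_real (A i) (Y i \<omega>)" if "i \<in> I" for i
      using measurable_compose[OF Y[OF that] borel_measurable_indicator[OF Am[OF that]]] \<phi>_lim[OF op[OF that]] by auto
    have "(\<lambda>k. expectation (\<lambda>\<omega>. \<Prod>i\<in>I. \<phi> k (A i) (Y i \<omega>))) \<longlonglongrightarrow> expectation (\<lambda>\<omega>. \<Prod>i\<in>I. indicat_real (A i) (Y i \<omega>))"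
      by (rule prod_lim[OF I \<phi>X(2) ind(1) _ ind(2)]) (simp_all add: \<phi>_bound)
    moreover have "(\<lambda>k. \<Prod>i\<in>I. expectation (\<lambda>\<omega>. \<phi> k (A i) (Y i \<omega>))) \<longlonglongrightarrow> (\<Prod>i\<in>I. expectation (\<lambda>\<omega>. indicat_real (A i) (Y i \<omega>)))"
    proof (rule tendsto_prod)
      show "(\<lambda>k. expectation (\<lambda>\<omega>. \<phi> k (A i) (Y i \<omega>))) \<longlonglongrightarrow> expectation (\<lambda>\<omega>. indicat_real (A i) (Y i \<omega>))" if "i \<in> I" for i
        using prod_lim[of "{i}", OF _ \<phi>X(2) ind(1) _ ind(2)] that by (simp add: \<phi>_bound)
    qed
    ultimately have "expectation (\<lambda>\<omega>. \<Prod>i\<in>I. indicat_real (A i) (Y i \<omega>)) = (\<Prod>i\<in>I. expectation (\<lambda>\<omega>. indicat_real (A i) (Y i \<omega>)))"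
      by (simp add: step LIMSEQ_unique)
    moreover have "expectation (\<lambda>\<omega>. \<Prod>i\<in>I. indicat_real (A i) (Y i \<omega>)) = prob (\<Inter>i\<in>I. Y i -` A i \<inter> space M)"
    proof -
      have "(\<Prod>i\<in>I. indicat_real (A i) (Y i \<omega>)) = (indicator (\<Inter>i\<in>I. Y i -` A i \<inter> space M) \<omega> :: real)"
        if "\<omega> \<in> space M" for \<omega>
        using I False that by (auto simp: indicator_def)
      then have "expectation (\<lambda>\<omega>. \<Prod>i\<in>I. indicat_real (A i) (Y i \<omega>)) = expectation (indicator (\<Inter>i\<in>I. Y i -` A i \<inter> space M))"
        by (intro Bochner_Integration.integral_cong) auto
      also have "\<dots> = prob (\<Inter>i\<in>I. Y i -` A i \<inter> space M)"
      proof -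
        have "(\<Inter>i\<in>I. Y i -` A i \<inter> space M) \<subseteq> space M" using False by blast
        then show ?thesis by (simp add: Int_absorb2)
      qed
      finally show ?thesis .
    qed
    moreover have "expectation (\<lambda>\<omega>. indicat_real (A i) (Y i \<omega>)) = prob (Y i -` A i \<inter> space M)" if "i \<in> I" for i
    proof -
      have "expectation (\<lambda>\<omega>. indicat_real (A i) (Y i \<omega>)) = expectation (indicator (Y i -` A i \<inter> space M))"
        by (intro Bochner_Integration.integral_cong) (auto simp: indicator_def)
      then show ?thesis by simp
    qed
    ultimately show ?thesis by simp
  qed
  then show ?thesis
    by (subst indep_vars_finite[OF False I, where E="\<lambda>_. {S. open S}"])
      (auto simp: borel_def Int_stable_def sets_measure_of Y[unfolded borel_def])
qed

lemma (in prob_space) indep_vars_block_sums: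
  fixes X :: "'i \<Rightarrow> 'a \<Rightarrow> 'b::euclidean_space"
  assumes "indep_vars (\<lambda>_. borel) X I" "\<And>j. j \<in> L \<Longrightarrow> K j \<subseteq> I" "disjoint_family_on K L"
  shows "indep_vars (\<lambda>_. borel) (\<lambda>j \<omega>. \<Sum>i\<in>K j. X i \<omega>) L"
proof -
  have "indep_vars (\<lambda>_. borel) (\<lambda>j \<omega>. (\<lambda>f. \<Sum>i\<in>K j. f i) (restrict (\<lambda>i. X i \<omega>) (K j))) L"
    by (rule indep_vars_compose2[OF indep_vars_restrict[OF assms]]) auto
  then show ?thesis by simp
qed

lemma (in prob_space) chf_indep_sum:
  fixes X :: "'i \<Rightarrow> 'a \<Rightarrow> 'b::euclidean_space"
  assumes "finite I" "indep_vars (\<lambda>_. borel) X I"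
  shows "chf (distr M borel (\<lambda>\<omega>. \<Sum>i\<in>I. X i \<omega>)) y = (\<Prod>i\<in>I. chf (distr M borel (X i)) y)"
proof -
  have Xm: "X i \<in> borel_measurable M" if "i \<in> I" for i
    using assms(2) that by (simp add: indep_vars_def)
  have "chf (distr M borel (\<lambda>\<omega>. \<Sum>i\<in>I. X i \<omega>)) y = (CLINT \<omega>|M. \<Prod>i\<in>I. iexp (X i \<omega> \<bullet> y))"
    using Xm assms(1) by (subst chf_distr) (auto simp: inner_sum_left sum_distrib_left exp_sum)
  also have "\<dots> = (\<Prod>i\<in>I. CLINT \<omega>|M. iexp (X i \<omega> \<bullet> y))"
  proof (rule indep_vars_lebesgue_integral[OF assms(1)])
    show "indep_vars (\<lambda>_. borel) (\<lambda>i \<omega>. iexp (X i \<omega> \<bullet> y)) I"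
      by (rule indep_vars_compose2[OF assms(2), where N="\<lambda>_. borel" and Y="\<lambda>_ x. iexp (x \<bullet> y)"]) auto
    show "integrable M (\<lambda>\<omega>. iexp (X i \<omega> \<bullet> y))" if "i \<in> I" for i
      using Xm[OF that] by (intro integrable_iexp) auto
  qed
  also have "\<dots> = (\<Prod>i\<in>I. chf (distr M borel (X i)) y)"
    using Xm by (intro prod.cong) (auto simp: chf_distr)
  finally show ?thesis .
qed

section \<open>Dyadic times and the Kolmogorov extension\<close>

definition grid :: "nat \<Rightarrow> real set" where
  "grid N = range (\<lambda>k::nat. real k / 2 ^ N)"

definition dyadic_times :: "real set" where
  "dyadic_times = (\<Union>N. grid N)"

abbreviation increment :: "(real \<Rightarrow> 'w \<Rightarrow> 'a::real_vector) \<Rightarrow> nat \<Rightarrow> nat \<Rightarrow> 'w \<Rightarrow> 'a" where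
  "increment X N i \<omega> \<equiv> X (real (Suc i) / 2 ^ N) \<omega> - X (real i / 2 ^ N) \<omega>"

lemma grid_mono: "N \<le> N' \<Longrightarrow> grid N \<subseteq> grid N'"
proof (clarsimp simp: grid_def)
  fix k :: nat assume "N \<le> N'"
  then obtain d where "N' = N + d" using le_Suc_ex by blast
  then have "real k / 2 ^ N = real (k * 2 ^ d) / 2 ^ N'"
    by (simp add: power_add)
  then show "real k / 2 ^ N \<in> range (\<lambda>k. real k / 2 ^ N')" by blast
qed

lemma grid_dyadics: "grid N \<subseteq> dyadic_times"
  by (auto simp: dyadic_times_def)

lemma grid_point: "real k / 2 ^ N \<in> dyadic_times"
  by (auto simp: dyadic_times_def grid_def)

lemma countable_dyadics: "countable dyadic_times"
  by (simp add: dyadic_times_def grid_def)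

lemma finite_dyadics:
  assumes "finite J" "J \<subseteq> dyadic_times"
  shows "\<exists>N. J \<subseteq> grid N"
  using assms
proof (induction J)
  case (insert t J)
  then obtain N N' where "J \<subseteq> grid N" "t \<in> grid N'" by (auto simp: dyadic_times_def)
  then have "insert t J \<subseteq> grid (max N N')"
    using grid_mono[of N "max N N'"] grid_mono[of N' "max N N'"] by auto
  then show ?case ..
qed simp

text \<open>The semigroup property is encoded by exponents linear in \<open>t\<close>, through
  \<open>chf_unique\<close>. Time 0 is left out, since a clock running at speed 0 is not a
  \<open>time_scale\<close>.\<close>

locale convolution_semigroup =
  fixes \<mu> :: "real \<Rightarrow> 'a::euclidean_space measure" and \<Psi> :: "'a \<Rightarrow> complex"
  assumes borel_prob_mu: "0 < t \<Longrightarrow> borel_prob (\<mu> t)"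
    and chf_mu: "0 < t \<Longrightarrow> chf (\<mu> t) y = exp (of_real t * \<Psi> y)"
begin

definition noise :: "nat \<Rightarrow> (nat \<Rightarrow> 'a) measure" where
  "noise N = PiM UNIV (\<lambda>_. \<mu> (1 / 2 ^ N))"

text \<open>Only the values at times of \<open>grid N\<close> matter, where the floor is the exact
  index of the grid point.\<close>

definition walk :: "nat \<Rightarrow> real \<Rightarrow> (nat \<Rightarrow> 'a) \<Rightarrow> 'a" where
  "walk N t x = (\<Sum>i<nat \<lfloor>t * 2 ^ N\<rfloor>. x i)"

lemma prob_space_mu: "0 < t \<Longrightarrow> prob_space (\<mu> t)" and sets_mu: "0 < t \<Longrightarrow> sets (\<mu> t) = sets borel"
  using borel_prob_mu by (auto simp: borel_prob_def)

lemma sets_noise [measurable_cong]: "sets (noise N) = sets (PiM UNIV (\<lambda>_. borel))"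
  unfolding noise_def by (rule sets_PiM_cong) (auto simp: sets_mu)

lemma space_noise [simp]: "space (noise N) = UNIV"
  using sets_eq_imp_space_eq[OF sets_noise, of N] by (simp add: space_PiM)

lemma prob_space_noise: "prob_space (noise N)"
  unfolding noise_def by (rule prob_space_PiM) (simp add: prob_space_mu)

lemma distr_noise_component: "distr (noise N) borel (\<lambda>x. x i) = \<mu> (1 / 2 ^ N)"
proof -
  have "distr (noise N) borel (\<lambda>x. x i) = distr (noise N) (\<mu> (1 / 2 ^ N)) (\<lambda>x. x i)"
    by (rule distr_cong) (simp_all add: sets_mu)
  also have "\<dots> = \<mu> (1 / 2 ^ N)"
    unfolding noise_def by (rule distr_PiM_component) (simp_all add: prob_space_mu)
  finally show ?thesis .
qed

lemma indep_noise: "prob_space.indep_vars (noise N) (\<lambda>_. borel) (\<lambda>i x. x i) UNIV"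
proof -
  interpret prob_space "noise N" by (rule prob_space_noise)
  have "distr (noise N) (PiM UNIV (\<lambda>_. borel)) (\<lambda>x. \<lambda>i\<in>UNIV. x i) = distr (noise N) (noise N) (\<lambda>x. x)"
    by (rule distr_cong) (simp_all add: sets_noise restrict_def)
  also have "\<dots> = PiM UNIV (\<lambda>i. distr (noise N) borel (\<lambda>x. x i))"
    by (simp add: distr_noise_component) (simp add: noise_def)
  finally show ?thesis by (subst indep_vars_iff_distr_eq_PiM') simp_all
qed

text \<open>Blocks of \<open>2 ^ d\<close> fine steps are disjoint, hence independent, and adding
  \<open>2 ^ d\<close> exponents of a fine step gives that of a coarse step. This is the consistency
  between grids on which the extension rests.\<close>

lemma distr_noise_merge:
  "distr (noise (N + d)) (PiM UNIV (\<lambda>_. borel)) (\<lambda>x j. \<Sum>i\<in>{j * 2 ^ d..<j * 2 ^ d + 2 ^ d}. x i) = noise N"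
proof -
  let ?B = "\<lambda>j::nat. {j * 2 ^ d..<j * 2 ^ d + 2 ^ d}"
  interpret prob_space "noise (N + d)" by (rule prob_space_noise)
  have "disjoint_family ?B"
    unfolding disjoint_family_on_def
  proof (intro ballI impI)
    fix i j :: nat assume "i \<noteq> j"
    moreover have "m div 2 ^ d = l" if "m \<in> ?B l" for m l
      using that by (intro div_nat_eqI) (auto simp: mult.commute)
    ultimately show "?B i \<inter> ?B j = {}" by (metis disjoint_iff)
  qed
  then have ind: "indep_vars (\<lambda>_. borel) (\<lambda>j x. \<Sum>i\<in>?B j. x i) UNIV"
    by (intro indep_vars_block_sums[OF indep_noise]) auto
  have law: "distr (noise (N + d)) borel (\<lambda>x. \<Sum>i\<in>?B j. x i) = \<mu> (1 / 2 ^ N)" for j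
  proof (rule chf_unique)
    show "borel_prob (distr (noise (N + d)) borel (\<lambda>x. \<Sum>i\<in>?B j. x i))"
      by (rule borel_prob_distr[OF prob_space_noise]) simp
    show "borel_prob (\<mu> (1 / 2 ^ N))" by (simp add: borel_prob_mu)
    show "chf (distr (noise (N + d)) borel (\<lambda>x. \<Sum>i\<in>?B j. x i)) = chf (\<mu> (1 / 2 ^ N))"
    proof
      fix y
      have "chf (distr (noise (N + d)) borel (\<lambda>x. \<Sum>i\<in>?B j. x i)) y = (\<Prod>i\<in>?B j. chf (\<mu> (1 / 2 ^ (N + d))) y)"
        by (subst chf_indep_sum) (auto intro: indep_vars_subset[OF indep_noise] simp: distr_noise_component)
      also have "\<dots> = exp (of_real (1 / 2 ^ (N + d)) * \<Psi> y) ^ 2 ^ d"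
        by (simp add: chf_mu)
      also have "\<dots> = chf (\<mu> (1 / 2 ^ N)) y"
        by (simp add: exp_of_nat_mult[symmetric] chf_mu power_add)
      finally show "chf (distr (noise (N + d)) borel (\<lambda>x. \<Sum>i\<in>?B j. x i)) y = chf (\<mu> (1 / 2 ^ N)) y" .
    qed
  qed
  have "distr (noise (N + d)) (PiM UNIV (\<lambda>_. borel)) (\<lambda>x. \<lambda>j\<in>UNIV. \<Sum>i\<in>?B j. x i) =
      PiM UNIV (\<lambda>j. distr (noise (N + d)) borel (\<lambda>x. \<Sum>i\<in>?B j. x i))"
    using ind by (subst (asm) indep_vars_iff_distr_eq_PiM') simp_all
  then show ?thesis by (simp add: law restrict_def) (simp only: noise_def)
qed

lemma walk_measurable [measurable]: "walk N t \<in> borel_measurable (PiM UNIV (\<lambda>_. borel))"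
  unfolding walk_def by measurable

lemma walk_merge:
  assumes "t \<in> grid N"
  shows "walk (N + d) t x = walk N t (\<lambda>j. \<Sum>i\<in>{j * 2 ^ d..<j * 2 ^ d + 2 ^ d}. x i)"
proof -
  obtain k :: nat where t: "t = real k / 2 ^ N" using assms by (auto simp: grid_def)
  have "t * 2 ^ N = real k" "t * 2 ^ (N + d) = real (k * 2 ^ d)"
    by (simp_all add: t power_add)
  then have "nat \<lfloor>t * 2 ^ N\<rfloor> = k" "nat \<lfloor>t * 2 ^ (N + d)\<rfloor> = k * 2 ^ d"
    by (simp_all only: floor_of_nat nat_int)
  then show ?thesis unfolding walk_def by (simp only: sum.nat_group)
qed

definition marginal :: "nat \<Rightarrow> real set \<Rightarrow> (real \<Rightarrow> 'a) measure" where
  "marginal N J = distr (noise N) (PiM J (\<lambda>_. borel)) (\<lambda>x. \<lambda>t\<in>J. walk N t x)"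

lemma marginal_level:
  assumes "J \<subseteq> grid N" "N \<le> N'"
  shows "marginal N J = marginal N' J"
proof -
  define d where "d = N' - N"
  let ?m = "\<lambda>(x :: nat \<Rightarrow> 'a) j. \<Sum>i\<in>{j * 2 ^ d..<j * 2 ^ d + 2 ^ d}. x i"
  have N': "N' = N + d" using assms(2) by (simp add: d_def)
  have m: "?m \<in> measurable (noise (N + d)) (PiM UNIV (\<lambda>_. borel))"
    by (intro measurable_PiM_single') (auto simp: space_PiM)
  have "marginal N J = distr (distr (noise (N + d)) (PiM UNIV (\<lambda>_. borel)) ?m) (PiM J (\<lambda>_. borel)) (\<lambda>x. \<lambda>t\<in>J. walk N t x)"
    unfolding marginal_def distr_noise_merge ..
  also have "\<dots> = distr (noise (N + d)) (PiM J (\<lambda>_. borel)) ((\<lambda>x. \<lambda>t\<in>J. walk N t x) \<circ> ?m)"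
    by (rule distr_distr[OF _ m]) measurable
  also have "\<dots> = marginal N' J"
    unfolding marginal_def N'
  proof (rule distr_cong)
    fix x
    show "((\<lambda>x. \<lambda>t\<in>J. walk N t x) \<circ> ?m) x = (\<lambda>t\<in>J. walk (N + d) t x)"
      unfolding comp_def by (rule restrict_ext, rule walk_merge[symmetric]) (use assms(1) in blast)
  qed simp_all
  finally show ?thesis .
qed

text \<open>A projective family has one measure for each \<open>J\<close>. By
  \<open>marginal_level\<close> any grid containing \<open>J\<close> gives the same one, so the
  least is merely a choice.\<close>

definition level :: "real set \<Rightarrow> nat" where
  "level J = (LEAST N. J \<subseteq> grid N)"

lemma marginal_level_eq:
  assumes "J \<subseteq> grid N"
  shows "marginal (level J) J = marginal N J"
  unfolding level_def
  by (rule marginal_level[OF LeastI[of "\<lambda>N. J \<subseteq> grid N", OF assms] Least_le[of "\<lambda>N. J \<subseteq> grid N", OF assms]])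

lemma prob_space_marginal: "prob_space (marginal N J)"
  unfolding marginal_def by (rule prob_space.prob_space_distr[OF prob_space_noise]) measurable

lemma polish_projective_marginal: "polish_projective dyadic_times (\<lambda>J. marginal (level J) J)"
proof (intro polish_projective.intro projective_family.intro)
  fix J H :: "real set"
  assume JH: "J \<subseteq> H" "finite H" "H \<subseteq> dyadic_times"
  then obtain N where N: "H \<subseteq> grid N" using finite_dyadics by blast
  then have "marginal (level J) J = marginal N J" "marginal (level H) H = marginal N H"
    using JH(1) by (auto intro: marginal_level_eq)
  moreover have "distr (marginal N H) (PiM J (\<lambda>_. borel)) (\<lambda>f. restrict f J) = marginal N J"
  proof -
    have "distr (marginal N H) (PiM J (\<lambda>_. borel)) (\<lambda>f. restrict f J) =
        distr (noise N) (PiM J (\<lambda>_. borel)) ((\<lambda>f. restrict f J) \<circ> (\<lambda>x. \<lambda>t\<in>H. walk N t x))"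
      unfolding marginal_def
    proof (rule distr_distr)
      show "(\<lambda>f. restrict f J) \<in> measurable (PiM H (\<lambda>_. borel)) (PiM J (\<lambda>_. borel))"
        by (rule measurable_restrict_subset[OF JH(1)])
    qed measurable
    also have "\<dots> = marginal N J"
      unfolding marginal_def comp_def using JH(1) by (intro distr_cong) (auto simp: Int_absorb1 restrict_restrict)
    finally show ?thesis .
  qed
  ultimately show "marginal (level J) J = distr (marginal (level H) H) (PiM J (\<lambda>_. borel)) (\<lambda>f. restrict f J)"
    by simp
qed (rule prob_space_marginal)

text \<open>\<open>X\<close> is the coordinate process on the projective limit, whose sample points
  have the type prescribed by \<open>J_map\<close>. On a grid, finitely many of its increments have
  the joint law of the corresponding noise coordinates, from which independence and the laws are
  read off.\<close>

lemma dyadic_walk_exists: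
  "\<exists>(M :: (real \<Rightarrow> 'a) measure) X. prob_space M \<and> (\<forall>t\<in>dyadic_times. X t \<in> borel_measurable M) \<and>
     (\<forall>N K. prob_space.indep_vars M (\<lambda>_. borel) (increment X N) {..<K}) \<and>
     (\<forall>N i. distr M borel (increment X N i) = \<mu> (1 / 2 ^ N))"
proof -
  interpret pp: polish_projective dyadic_times "\<lambda>J. marginal (level J) J"
    by (rule polish_projective_marginal)
  define L where "L = pp.lim"
  have setsL [measurable_cong]: "sets L = sets (PiM dyadic_times (\<lambda>_. borel))" by (simp add: L_def)
  interpret L: prob_space L unfolding L_def by (rule pp.P.prob_space_axioms)
  define X where "X t \<omega> = \<omega> t" for t :: real and \<omega> :: "real \<Rightarrow> 'a"
  have Xm [measurable]: "X t \<in> borel_measurable L" if "t \<in> dyadic_times" for t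
    using that unfolding X_def by measurable
  have marg: "distr L (PiM J (\<lambda>_. borel)) (\<lambda>\<omega>. restrict \<omega> J) = marginal N J"
    if J: "finite J" "J \<subseteq> grid N" for J N
  proof -
    have JD: "J \<subseteq> dyadic_times" using J(2) grid_dyadics by blast
    have r: "(\<lambda>\<omega>. restrict \<omega> J) \<in> measurable L (PiM J (\<lambda>_. borel))"
      using measurable_restrict_subset[OF JD, of "\<lambda>_. borel"] setsL by (simp cong: measurable_cong_sets)
    show ?thesis
    proof (rule measure_eqI)
      show "sets (distr L (PiM J (\<lambda>_. borel)) (\<lambda>\<omega>. restrict \<omega> J)) = sets (marginal N J)"
        by (simp add: marginal_def)
      fix A assume "A \<in> sets (distr L (PiM J (\<lambda>_. borel)) (\<lambda>\<omega>. restrict \<omega> J))"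
      then have A: "A \<in> sets (PiM J (\<lambda>_. borel :: 'a measure))" by simp
      have "emeasure (distr L (PiM J (\<lambda>_. borel)) (\<lambda>\<omega>. restrict \<omega> J)) A = emeasure L (pp.emb dyadic_times J A)"
        by (subst emeasure_distr[OF r A]) (simp add: prod_emb_def sets_eq_imp_space_eq[OF setsL] space_PiM)
      also have "\<dots> = emeasure (marginal (level J) J) A"
        unfolding L_def by (rule pp.emeasure_lim_emb[OF JD J(1) A])
      also have "marginal (level J) J = marginal N J" by (rule marginal_level_eq[OF J(2)])
      finally show "emeasure (distr L (PiM J (\<lambda>_. borel)) (\<lambda>\<omega>. restrict \<omega> J)) A = emeasure (marginal N J) A" .
    qed
  qed
  have incr: "distr L (PiM {..<K} (\<lambda>_. borel)) (\<lambda>\<omega>. \<lambda>i\<in>{..<K}. increment X N i \<omega>) =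
      distr (noise N) (PiM {..<K} (\<lambda>_. borel)) (\<lambda>x. \<lambda>i\<in>{..<K}. x i)" for N K
  proof -
    define J where "J = (\<lambda>k::nat. real k / 2 ^ N) ` {..K}"
    let ?\<Phi> = "\<lambda>(f :: real \<Rightarrow> 'a). \<lambda>i\<in>{..<K}. f (real (Suc i) / 2 ^ N) - f (real i / 2 ^ N)"
    have J: "finite J" "J \<subseteq> grid N" by (auto simp: J_def grid_def)
    have inJ: "real i / 2 ^ N \<in> J" "real (Suc i) / 2 ^ N \<in> J" if "i < K" for i
      unfolding J_def using that by (auto intro!: imageI simp del: of_nat_Suc)
    have \<Phi>: "?\<Phi> \<in> measurable (PiM J (\<lambda>_. borel)) (PiM {..<K} (\<lambda>_. borel))"
      using inJ by (intro measurable_restrict borel_measurable_diff measurable_component_singleton) auto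
    have JD: "J \<subseteq> dyadic_times" using J(2) grid_dyadics by blast
    have r: "(\<lambda>\<omega>. restrict \<omega> J) \<in> measurable L (PiM J (\<lambda>_. borel))"
      using measurable_restrict_subset[OF JD, of "\<lambda>_. borel"] setsL by (simp cong: measurable_cong_sets)
    have "distr L (PiM {..<K} (\<lambda>_. borel)) (\<lambda>\<omega>. \<lambda>i\<in>{..<K}. increment X N i \<omega>) =
        distr L (PiM {..<K} (\<lambda>_. borel)) (?\<Phi> \<circ> (\<lambda>\<omega>. restrict \<omega> J))"
      using inJ by (intro distr_cong) (auto simp: X_def restrict_def fun_eq_iff simp del: of_nat_Suc)
    also have "\<dots> = distr (marginal N J) (PiM {..<K} (\<lambda>_. borel)) ?\<Phi>"
      unfolding marg[OF J, symmetric] by (rule distr_distr[OF \<Phi> r, symmetric])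
    also have "\<dots> = distr (noise N) (PiM {..<K} (\<lambda>_. borel)) (?\<Phi> \<circ> (\<lambda>x. \<lambda>t\<in>J. walk N t x))"
      unfolding marginal_def by (rule distr_distr[OF \<Phi>]) measurable
    also have "\<dots> = distr (noise N) (PiM {..<K} (\<lambda>_. borel)) (\<lambda>x. \<lambda>i\<in>{..<K}. x i)"
    proof (rule distr_cong)
      fix x :: "nat \<Rightarrow> 'a"
      have walk: "walk N (real k / 2 ^ N) x = (\<Sum>i<k. x i)" for k
        by (simp add: walk_def)
      show "(?\<Phi> \<circ> (\<lambda>x. \<lambda>t\<in>J. walk N t x)) x = (\<lambda>i\<in>{..<K}. x i)"
        using inJ by (auto simp: walk restrict_def fun_eq_iff simp del: of_nat_Suc)
    qed simp_all
    finally show ?thesis .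
  qed
  have im: "(increment X N i) \<in> borel_measurable L" for i N
    by (intro borel_measurable_diff Xm grid_point)
  have law: "distr L borel (increment X N i) = \<mu> (1 / 2 ^ N)" for N i
  proof -
    let ?P = "PiM {..<Suc i} (\<lambda>_. borel :: 'a measure)"
    have c: "(\<lambda>f. f i) \<in> borel_measurable ?P" by measurable
    have "distr L borel (increment X N i) =
        distr (distr L ?P (\<lambda>\<omega>. \<lambda>i\<in>{..<Suc i}. increment X N i \<omega>)) borel (\<lambda>f. f i)"
      by (subst distr_distr[OF c]) (auto intro!: measurable_restrict im simp: comp_def simp del: of_nat_Suc)
    also have "\<dots> = distr (noise N) borel (\<lambda>x. x i)"
      unfolding incr by (subst distr_distr[OF c]) (auto intro!: measurable_restrict simp: comp_def)
    finally show ?thesis by (simp add: distr_noise_component)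
  qed
  have "L.indep_vars (\<lambda>_. borel) (increment X N) {..<K}" for N K
  proof (cases "K = 0")
    case True
    then show ?thesis by (simp add: L.indep_vars_def L.indep_sets_def)
  next
    case False
    interpret n: prob_space "noise N" by (rule prob_space_noise)
    have ne: "{..<K} \<noteq> {}" using False by (simp add: lessThan_empty_iff)
    have ind: "n.indep_vars (\<lambda>_. borel) (\<lambda>i x. x i) {..<K}"
      by (rule n.indep_vars_subset[OF indep_noise]) simp
    have "distr (noise N) (PiM {..<K} (\<lambda>_. borel)) (\<lambda>x. \<lambda>i\<in>{..<K}. x i) =
        PiM {..<K} (\<lambda>i. distr (noise N) borel (\<lambda>x. x i))"
      by (rule n.indep_vars_iff_distr_eq_PiM'[THEN iffD1, OF ne _ ind]) simp
    then show ?thesis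
      by (intro L.indep_vars_iff_distr_eq_PiM'[THEN iffD2, OF ne im])
        (simp only: incr law distr_noise_component)
  qed
  then show ?thesis using L.prob_space_axioms Xm law by blast
qed

end

section \<open>Oscillations\<close>

text \<open>This plays the part of upcrossing counts for vector-valued walks: the number of
  successive disjoint oscillations is bounded, not a supremum, because finiteness of that number for
  every size \<open>c\<close> is what yields one-sided limits.\<close>

primrec osc :: "nat \<Rightarrow> real \<Rightarrow> nat \<Rightarrow> nat \<Rightarrow> (nat \<Rightarrow> 'a::euclidean_space) \<Rightarrow> bool" where
  "osc K c 0 a f \<longleftrightarrow> True"
| "osc K c (Suc p) a f \<longleftrightarrow> (\<exists>u\<in>{a..K}. \<exists>v\<in>{u<..K}. c < norm (sum f {u..<v}) \<and> osc K c p v f)"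

lemma osc_antimono:
  assumes "osc K c p b f" "a \<le> b"
  shows "osc K c p a f"
proof (cases p)
  case (Suc q)
  with assms(1) obtain u v where "u \<in> {b..K}" "v \<in> {u<..K}" "c < norm (sum f {u..<v})" "osc K c q v f"
    by auto
  then show ?thesis unfolding Suc osc.simps using assms(2)
    by - (rule bexI[of _ u], rule bexI[of _ v], auto)
qed simp

lemma sum_restrict: "S \<subseteq> A \<Longrightarrow> sum (restrict f A) S = sum f S"
  by (rule sum.cong) auto

lemma measurable_sum_components:
  "S \<subseteq> A \<Longrightarrow> (\<lambda>f. sum f S) \<in> borel_measurable (PiM A (\<lambda>_. borel :: 'a::euclidean_space measure))"
  by (rule borel_measurable_sum[where f="\<lambda>i f. f i"]) (auto intro!: measurable_component_singleton)

text \<open>Oscillations from \<open>a\<close> on depend only on the steps from \<open>a\<close> on;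
  this makes them independent of what happened before.\<close>

lemma osc_restrict: "{a..<K} \<subseteq> A \<Longrightarrow> osc K c p a (restrict f A) = osc K c p a f"
proof (induction p arbitrary: a)
  case (Suc p)
  have "sum (restrict f A) {u..<v} = sum f {u..<v}" if "a \<le> u" "v \<le> K" for u v
    by (rule sum_restrict, rule order_trans[OF _ Suc.prems]) (use that in auto)
  moreover have "osc K c p v (restrict f A) = osc K c p v f" if "a \<le> v" for v
    by (rule Suc.IH, rule order_trans[OF _ Suc.prems]) (use that in auto)
  ultimately show ?case unfolding osc.simps by (intro bex_cong refl) auto
qed simp

lemma measurable_osc:
  "{a..<K} \<subseteq> A \<Longrightarrow> Measurable.pred (PiM A (\<lambda>_. borel :: 'a::euclidean_space measure)) (osc K c p a)"
proof (induction p arbitrary: a)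
  case (Suc p)
  have "Measurable.pred (PiM A (\<lambda>_. borel :: 'a measure)) (\<lambda>f. c < norm (sum f {u..<v}))" if "u \<in> {a..K}" "v \<in> {u<..K}" for u v
  proof -
    have "{u..<v} \<subseteq> A" by (rule order_trans[OF _ Suc.prems]) (use that in auto)
    have [measurable]: "(\<lambda>f. sum f {u..<v}) \<in> borel_measurable (PiM A (\<lambda>_. borel :: 'a measure))"
      by (rule measurable_sum_components) fact
    show ?thesis by measurable
  qed
  moreover have "Measurable.pred (PiM A (\<lambda>_. borel :: 'a measure)) (osc K c p v)" if "u \<in> {a..K}" "v \<in> {u<..K}" for u v
    by (rule Suc.IH, rule order_trans[OF _ Suc.prems]) (use that in auto)
  ultimately show ?case
    unfolding osc.simps by (intro pred_intros_finite pred_intros_logic) auto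
next
  case 0
  have "osc K c 0 a = (\<lambda>f :: nat \<Rightarrow> 'a. True)" by (simp add: fun_eq_iff)
  then show ?case by simp
qed

text \<open>\<open>L\<close> is the index at which the observed window starts.\<close>

locale small_steps = prob_space M
  for M :: "'w measure" and \<xi> :: "nat \<Rightarrow> 'w \<Rightarrow> 'a::euclidean_space" and L K :: nat and \<epsilon> :: real +
  assumes indep_steps: "indep_vars (\<lambda>_. borel) \<xi> {..<K}"
    and small: "\<And>a b. L \<le> a \<Longrightarrow> a \<le> b \<Longrightarrow> b \<le> K \<Longrightarrow>
      prob {\<omega> \<in> space M. \<epsilon> < norm (\<Sum>i\<in>{a..<b}. \<xi> i \<omega>)} \<le> 1 / 3"
begin

text \<open>First passage: \<open>k\<close> is the first index at which the walk started at
  \<open>a\<close> is outside the ball of radius \<open>2 * \<epsilon>\<close>.\<close>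

definition passage :: "nat \<Rightarrow> nat \<Rightarrow> (nat \<Rightarrow> 'a) \<Rightarrow> bool" where
  "passage a k f \<longleftrightarrow> 2 * \<epsilon> < norm (sum f {a..<k}) \<and> (\<forall>j\<in>{a..<k}. norm (sum f {a..<j}) \<le> 2 * \<epsilon>)"

definition steps :: "'w \<Rightarrow> nat \<Rightarrow> 'a" where
  "steps \<omega> = (\<lambda>i. \<xi> i \<omega>)"

abbreviation passage_event :: "nat \<Rightarrow> nat \<Rightarrow> 'w set" where
  "passage_event a k \<equiv> {\<omega> \<in> space M. passage a k (steps \<omega>)}"

lemma step_measurable: "i < K \<Longrightarrow> \<xi> i \<in> borel_measurable M"
  using indep_steps by (simp add: indep_vars_def)

lemma steps_measurable: "A \<subseteq> {..<K} \<Longrightarrow> (\<lambda>\<omega>. restrict (steps \<omega>) A) \<in> measurable M (PiM A (\<lambda>_. borel))"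
  unfolding steps_def by (intro measurable_restrict step_measurable) auto

lemma measurable_passage:
  assumes "{a..<k} \<subseteq> A"
  shows "Measurable.pred (PiM A (\<lambda>_. borel)) (passage a k)"
proof -
  have m: "(\<lambda>f. sum f {a..<j}) \<in> borel_measurable (PiM A (\<lambda>_. borel :: 'a measure))" if "j \<le> k" for j
    by (rule measurable_sum_components, rule order_trans[OF _ assms]) (use that in auto)
  have "Measurable.pred (PiM A (\<lambda>_. borel :: 'a measure)) (\<lambda>f. 2 * \<epsilon> < norm (sum f {a..<k}))"
    using m[OF order_refl] by measurable
  moreover have "Measurable.pred (PiM A (\<lambda>_. borel :: 'a measure)) (\<lambda>f. norm (sum f {a..<j}) \<le> 2 * \<epsilon>)"
    if "j \<in> {a..<k}" for j
  proof -
    have "j \<le> k" using that by simp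
    from m[OF this] show ?thesis by measurable
  qed
  ultimately show ?thesis
    unfolding passage_def by (intro pred_intros_logic pred_intros_finite) auto
qed

lemma passage_restrict:
  assumes "{a..<k} \<subseteq> A"
  shows "passage a k (restrict f A) = passage a k f"
proof -
  have "sum (restrict f A) {a..<j} = sum f {a..<j}" if "j \<le> k" for j
    by (rule sum_restrict, rule order_trans[OF _ assms]) (use that in auto)
  then show ?thesis unfolding passage_def by simp
qed

lemma sets_pred_steps:
  assumes "A \<subseteq> {..<K}" "Measurable.pred (PiM A (\<lambda>_. borel)) Q" "\<And>f. Q (restrict f A) = Q f"
  shows "{\<omega> \<in> space M. Q (steps \<omega>)} \<in> events"
proof -
  have "Measurable.pred M (\<lambda>\<omega>. Q (restrict (steps \<omega>) A))"
    by (rule measurable_compose[OF steps_measurable[OF assms(1)] assms(2)])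
  then show ?thesis by (simp add: assms(3) pred_def)
qed

lemma sets_passage: "k \<le> K \<Longrightarrow> passage_event a k \<in> events"
  by (rule sets_pred_steps[of "{..<K}", OF _ measurable_passage passage_restrict]) auto

lemma sets_osc: "{\<omega> \<in> space M. osc K c p a (steps \<omega>)} \<in> events"
  by (rule sets_pred_steps[of "{..<K}", OF _ measurable_osc osc_restrict]) auto

text \<open>The Markov property at the index \<open>k\<close>: a passage at \<open>k\<close>
  involves steps before \<open>k\<close> only, and \<open>Q\<close> involves later ones
  only.\<close>

lemma prob_passage_indep:
  assumes k: "k \<le> K" and Q: "Measurable.pred (PiM {k..<K} (\<lambda>_. borel)) Q" "\<And>f. Q (restrict f {k..<K}) = Q f"
  shows "prob {\<omega> \<in> space M. passage a k (steps \<omega>) \<and> Q (steps \<omega>)} =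
    prob (passage_event a k) * prob {\<omega> \<in> space M. Q (steps \<omega>)}"
proof -
  let ?A = "{a..<k}" and ?B = "{k..<K}"
  let ?SA = "{f \<in> space (PiM ?A (\<lambda>_. borel)). passage a k f}" and ?SB = "{f \<in> space (PiM ?B (\<lambda>_. borel)). Q f}"
  have "indep_var (PiM ?A (\<lambda>_. borel)) (\<lambda>\<omega>. restrict (\<lambda>i. \<xi> i \<omega>) ?A) (PiM ?B (\<lambda>_. borel)) (\<lambda>\<omega>. restrict (\<lambda>i. \<xi> i \<omega>) ?B)"
    by (rule indep_var_restrict[OF indep_steps]) (use k in auto)
  then have "prob ((\<lambda>\<omega>. (restrict (steps \<omega>) ?A, restrict (steps \<omega>) ?B)) -` (?SA \<times> ?SB) \<inter> space M) =
      prob ((\<lambda>\<omega>. restrict (steps \<omega>) ?A) -` ?SA \<inter> space M) * prob ((\<lambda>\<omega>. restrict (steps \<omega>) ?B) -` ?SB \<inter> space M)"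
    unfolding steps_def
    by (rule indep_varD) (use measurable_passage[of a k ?A] Q(1) in \<open>auto simp: pred_def\<close>)
  moreover have "(\<lambda>\<omega>. restrict (steps \<omega>) ?A) -` ?SA \<inter> space M = passage_event a k"
    using passage_restrict[of a k ?A] by (auto simp: space_PiM)
  moreover have "(\<lambda>\<omega>. restrict (steps \<omega>) ?B) -` ?SB \<inter> space M = {\<omega> \<in> space M. Q (steps \<omega>)}"
    using Q(2) by (auto simp: space_PiM)
  moreover have "(\<lambda>\<omega>. (restrict (steps \<omega>) ?A, restrict (steps \<omega>) ?B)) -` (?SA \<times> ?SB) \<inter> space M =
      {\<omega> \<in> space M. passage a k (steps \<omega>) \<and> Q (steps \<omega>)}"
    using passage_restrict[of a k ?A] Q(2) by (auto simp: space_PiM)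
  ultimately show ?thesis by simp
qed

lemma passage_unique: "passage a k f \<Longrightarrow> passage a l f \<Longrightarrow> a \<le> k \<Longrightarrow> a \<le> l \<Longrightarrow> k = l"
  unfolding passage_def by (metis atLeastLessThan_iff linorder_neqE_nat not_less)

lemma passage_exists:
  assumes "2 * \<epsilon> < norm (sum f {a..<w})" "a \<le> w"
  shows "\<exists>k\<in>{a..w}. passage a k f"
proof -
  define k where "k = (LEAST k. a \<le> k \<and> 2 * \<epsilon> < norm (sum f {a..<k}))"
  have "a \<le> k \<and> 2 * \<epsilon> < norm (sum f {a..<k})"
    unfolding k_def by (rule LeastI[of _ w]) (use assms in auto)
  moreover have "k \<le> w" unfolding k_def by (rule Least_le) (use assms in auto)
  moreover have "norm (sum f {a..<j}) \<le> 2 * \<epsilon>" if "j \<in> {a..<k}" for j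
    using that not_less_Least[of j "\<lambda>k. a \<le> k \<and> 2 * \<epsilon> < norm (sum f {a..<k})"] by (auto simp: k_def)
  ultimately show ?thesis unfolding passage_def by auto
qed

text \<open>An Ottaviani-type inequality. After a first passage at \<open>k\<close> the remaining
  sum has norm at most \<epsilon> with probability at least 2/3, independently of the past, and then
  the whole sum up to \<open>K\<close> has norm beyond \<epsilon>. As passages at different
  \<open>k\<close> exclude each other, 2/3 of the left-hand side is at most 1/3.\<close>

lemma sum_passage_le_half:
  assumes "L \<le> a" "a \<le> K"
  shows "(\<Sum>k\<in>{a..K}. prob (passage_event a k)) \<le> 1 / 2"
proof -
  let ?Q = "\<lambda>k (f :: nat \<Rightarrow> 'a). norm (sum f {k..<K}) \<le> \<epsilon>"
  let ?E = "\<lambda>k. {\<omega> \<in> space M. passage a k (steps \<omega>) \<and> ?Q k (steps \<omega>)}"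
  have Qm: "Measurable.pred (PiM {k..<K} (\<lambda>_. borel)) (?Q k)" for k
  proof -
    have [measurable]: "(\<lambda>f. sum f {k..<K}) \<in> borel_measurable (PiM {k..<K} (\<lambda>_. borel :: 'a measure))"
      by (rule measurable_sum_components) simp
    show ?thesis by measurable
  qed
  have Qr: "?Q k (restrict f {k..<K}) = ?Q k f" for k f
    by (simp add: sum_restrict)
  have Qs: "{\<omega> \<in> space M. ?Q k (steps \<omega>)} \<in> events" if "k \<in> {a..K}" for k
    by (rule sets_pred_steps[OF _ Qm Qr]) (use that in auto)
  have Es: "?E k \<in> events" if "k \<in> {a..K}" for k
  proof -
    have "passage_event a k \<inter> {\<omega> \<in> space M. ?Q k (steps \<omega>)} \<in> events"
      using sets_passage[of k a] Qs[OF that] that by (intro sets.Int) auto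
    moreover have "passage_event a k \<inter> {\<omega> \<in> space M. ?Q k (steps \<omega>)} = ?E k" by auto
    ultimately show ?thesis by simp
  qed
  have "2 / 3 * prob (passage_event a k) \<le> prob (?E k)" if k: "k \<in> {a..K}" for k
  proof -
    have "{\<omega> \<in> space M. \<not> ?Q k (steps \<omega>)} = {\<omega> \<in> space M. \<epsilon> < norm (\<Sum>i\<in>{k..<K}. \<xi> i \<omega>)}"
      by (auto simp: steps_def not_le)
    then have "prob {\<omega> \<in> space M. \<not> ?Q k (steps \<omega>)} \<le> 1 / 3"
      using small[of k K] k assms by simp
    moreover have "prob {\<omega> \<in> space M. \<not> ?Q k (steps \<omega>)} = 1 - prob {\<omega> \<in> space M. ?Q k (steps \<omega>)}"
      by (rule prob_neg[OF Qs[OF k]])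
    ultimately have "2 / 3 \<le> prob {\<omega> \<in> space M. ?Q k (steps \<omega>)}" by simp
    then have "2 / 3 * prob (passage_event a k) \<le>
        prob {\<omega> \<in> space M. ?Q k (steps \<omega>)} * prob (passage_event a k)"
      by (rule mult_right_mono) simp
    also have "\<dots> = prob (?E k)"
      using k by (subst prob_passage_indep[OF _ Qm Qr]) auto
    finally show ?thesis .
  qed
  then have "(\<Sum>k\<in>{a..K}. 2 / 3 * prob (passage_event a k)) \<le> (\<Sum>k\<in>{a..K}. prob (?E k))"
    by (rule sum_mono)
  also have "\<dots> = prob (\<Union>k\<in>{a..K}. ?E k)"
  proof (rule finite_measure_finite_Union[symmetric])
    show "disjoint_family_on ?E {a..K}"
      unfolding disjoint_family_on_def using passage_unique by fastforce
  qed (use Es in auto)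
  also have "\<dots> \<le> prob {\<omega> \<in> space M. \<epsilon> < norm (\<Sum>i\<in>{a..<K}. \<xi> i \<omega>)}"
  proof (rule finite_measure_mono)
    show "(\<Union>k\<in>{a..K}. ?E k) \<subseteq> {\<omega> \<in> space M. \<epsilon> < norm (\<Sum>i\<in>{a..<K}. \<xi> i \<omega>)}"
    proof safe
      fix k \<omega> assume k: "k \<in> {a..K}" and p: "passage a k (steps \<omega>)" "?Q k (steps \<omega>)"
      have "sum (steps \<omega>) {a..<K} = sum (steps \<omega>) {a..<k} + sum (steps \<omega>) {k..<K}"
        using k by (simp add: sum.atLeastLessThan_concat)
      then have "norm (sum (steps \<omega>) {a..<k}) \<le> norm (sum (steps \<omega>) {a..<K}) + norm (sum (steps \<omega>) {k..<K})"
        by (metis add_diff_cancel_right' norm_triangle_ineq4)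
      then show "\<epsilon> < norm (\<Sum>i\<in>{a..<K}. \<xi> i \<omega>)"
        using p by (simp add: passage_def steps_def)
    qed
    have "(\<lambda>\<omega>. \<Sum>i\<in>{a..<K}. \<xi> i \<omega>) \<in> borel_measurable M"
      using step_measurable by (intro borel_measurable_sum) auto
    then show "{\<omega> \<in> space M. \<epsilon> < norm (\<Sum>i\<in>{a..<K}. \<xi> i \<omega>)} \<in> events" by measurable
  qed
  also have "\<dots> \<le> 1 / 3" using small assms by simp
  finally show ?thesis unfolding sum_distrib_left[symmetric] by linarith
qed

text \<open>After its first exit from the ball of radius \<open>2 * \<epsilon>\<close>, no later than the end of the first
  oscillation, the walk starts afresh and still has to perform the remaining oscillations.\<close>

lemma prob_osc_le: "L \<le> a \<Longrightarrow> a \<le> K \<Longrightarrow> prob {\<omega> \<in> space M. osc K (4 * \<epsilon>) p a (steps \<omega>)} \<le> (1 / 2) ^ p"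
proof (induction p arbitrary: a)
  case (Suc p)
  let ?E = "\<lambda>k. {\<omega> \<in> space M. passage a k (steps \<omega>) \<and> osc K (4 * \<epsilon>) p k (steps \<omega>)}"
  have Es: "?E k \<in> events" if "k \<in> {a..K}" for k
  proof -
    have "passage_event a k \<inter> {\<omega> \<in> space M. osc K (4 * \<epsilon>) p k (steps \<omega>)} \<in> events"
      using sets_passage[of k a] sets_osc that by (intro sets.Int) auto
    moreover have "passage_event a k \<inter> {\<omega> \<in> space M. osc K (4 * \<epsilon>) p k (steps \<omega>)} = ?E k" by auto
    ultimately show ?thesis by simp
  qed
  have "{\<omega> \<in> space M. osc K (4 * \<epsilon>) (Suc p) a (steps \<omega>)} \<subseteq> (\<Union>k\<in>{a..K}. ?E k)"
  proof safe
    fix \<omega> assume "\<omega> \<in> space M" and "osc K (4 * \<epsilon>) (Suc p) a (steps \<omega>)"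
    then obtain u v where uv: "a \<le> u" "u < v" "v \<le> K" "4 * \<epsilon> < norm (sum (steps \<omega>) {u..<v})" "osc K (4 * \<epsilon>) p v (steps \<omega>)"
      by auto
    have "sum (steps \<omega>) {a..<v} = sum (steps \<omega>) {a..<u} + sum (steps \<omega>) {u..<v}"
      using uv by (simp add: sum.atLeastLessThan_concat)
    then have "norm (sum (steps \<omega>) {u..<v}) \<le> norm (sum (steps \<omega>) {a..<v}) + norm (sum (steps \<omega>) {a..<u})"
      by (metis add_diff_cancel_left' norm_triangle_ineq4)
    \<comment> \<open>This is where \<open>4 * \<epsilon>\<close> comes from: if both ends of the
      oscillation were within \<open>2 * \<epsilon>\<close> of the start, they could not be further
      apart.\<close>
    then have "2 * \<epsilon> < norm (sum (steps \<omega>) {a..<v}) \<or> 2 * \<epsilon> < norm (sum (steps \<omega>) {a..<u})"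
      using uv(4) by linarith
    then obtain w where "a \<le> w" "w \<le> v" "2 * \<epsilon> < norm (sum (steps \<omega>) {a..<w})"
      using uv by (meson less_imp_le order_refl order_trans)
    then obtain k where "k \<in> {a..w}" and p: "passage a k (steps \<omega>)"
      using passage_exists[of "steps \<omega>" a w] by blast
    then have k: "k \<in> {a..v}" using \<open>w \<le> v\<close> by simp
    then show "\<omega> \<in> (\<Union>k\<in>{a..K}. ?E k)"
      using osc_antimono[OF uv(5), of k] p uv(3) \<open>\<omega> \<in> space M\<close> by auto
  qed
  then have "prob {\<omega> \<in> space M. osc K (4 * \<epsilon>) (Suc p) a (steps \<omega>)} \<le> prob (\<Union>k\<in>{a..K}. ?E k)"
    using Es by (intro finite_measure_mono) auto
  also have "\<dots> \<le> (\<Sum>k\<in>{a..K}. prob (?E k))"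
    using Es by (intro finite_measure_subadditive_finite) auto
  also have "\<dots> \<le> (\<Sum>k\<in>{a..K}. prob (passage_event a k) * (1 / 2) ^ p)"
  proof (rule sum_mono)
    fix k assume k: "k \<in> {a..K}"
    have "prob (?E k) = prob (passage_event a k) * prob {\<omega> \<in> space M. osc K (4 * \<epsilon>) p k (steps \<omega>)}"
      using k by (intro prob_passage_indep measurable_osc osc_restrict) auto
    also have "\<dots> \<le> prob (passage_event a k) * (1 / 2) ^ p"
      using k Suc.prems by (intro mult_left_mono Suc.IH) auto
    finally show "prob (?E k) \<le> prob (passage_event a k) * (1 / 2) ^ p" .
  qed
  also have "\<dots> \<le> 1 / 2 * (1 / 2) ^ p"
    unfolding sum_distrib_right[symmetric]
    by (intro mult_right_mono sum_passage_le_half Suc.prems) auto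
  finally show ?case by simp
qed simp

end

section \<open>Oscillations of functions along the dyadic times\<close>

primrec oscillates :: "real set \<Rightarrow> (real \<Rightarrow> 'a::real_normed_vector) \<Rightarrow> real \<Rightarrow> nat \<Rightarrow> real \<Rightarrow> bool" where
  "oscillates F x c 0 a \<longleftrightarrow> True"
| "oscillates F x c (Suc p) a \<longleftrightarrow>
     (\<exists>u\<in>F. \<exists>v\<in>F. a \<le> u \<and> u < v \<and> c < norm (x v - x u) \<and> oscillates F x c p v)"

lemma oscillates_antimono: "oscillates F x c p b \<Longrightarrow> a \<le> b \<Longrightarrow> oscillates F x c p a"
  by (cases p) (auto intro: order_trans)

lemma oscillates_mono: "oscillates F x c p a \<Longrightarrow> F \<subseteq> G \<Longrightarrow> oscillates G x c p a"
proof (induction p arbitrary: a)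
  case (Suc p)
  then show ?case unfolding oscillates.simps by blast
qed simp

text \<open>A chain of oscillations involves finitely many dyadic times, and these lie on a common
  grid, which may be taken as fine as desired.\<close>

lemma oscillates_grid:
  assumes "oscillates (dyadic_times \<inter> W) x c p a"
  shows "\<exists>N\<ge>m. oscillates (grid N \<inter> W) x c p a"
  using assms
proof (induction p arbitrary: a)
  case (Suc p)
  then obtain u v where uv: "u \<in> dyadic_times \<inter> W" "v \<in> dyadic_times \<inter> W" "a \<le> u" "u < v" "c < norm (x v - x u)"
    "oscillates (dyadic_times \<inter> W) x c p v" by auto
  obtain N1 where N1: "N1 \<ge> m" "oscillates (grid N1 \<inter> W) x c p v" using Suc.IH[OF uv(6)] by blast
  obtain N2 N3 where N23: "u \<in> grid N2" "v \<in> grid N3" using uv by (auto simp: dyadic_times_def)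
  define N where "N = max N1 (max N2 N3)"
  have sub: "grid N1 \<subseteq> grid N" "grid N2 \<subseteq> grid N" "grid N3 \<subseteq> grid N"
    by (rule grid_mono, simp add: N_def)+
  have "oscillates (grid N \<inter> W) x c p v"
    by (rule oscillates_mono[OF N1(2)]) (use sub in auto)
  then have "oscillates (grid N \<inter> W) x c (Suc p) a"
    unfolding oscillates.simps using uv(1-5) N23 sub
    by - (rule bexI[of _ u], rule bexI[of _ v], auto)
  then show ?case using N1(1) by (intro exI[of _ N]) (simp add: N_def)
qed auto

text \<open>Sums over blocks of increments telescope to differences of \<open>x\<close>. The lower
  end \<open>lo\<close> is arbitrary, since the start \<open>a\<close> already bounds the times from
  below.\<close>

lemma oscillates_osc:
  assumes "oscillates (grid N \<inter> {lo..real K / 2 ^ N}) x c p (real a / 2 ^ N)"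
  shows "osc K c p a (\<lambda>i. x (real (Suc i) / 2 ^ N) - x (real i / 2 ^ N))"
  using assms
proof (induction p arbitrary: a)
  case (Suc p)
  then obtain k l :: nat where kl: "real a / 2 ^ N \<le> real k / 2 ^ N" "real k / 2 ^ N < real l / 2 ^ N"
    "real l / 2 ^ N \<le> real K / 2 ^ N" "c < norm (x (real l / 2 ^ N) - x (real k / 2 ^ N))"
    "oscillates (grid N \<inter> {lo..real K / 2 ^ N}) x c p (real l / 2 ^ N)"
    by (auto simp: grid_def)
  have le: "a \<le> k" "k < l" "l \<le> K" using kl(1-3) by (simp_all add: divide_le_cancel divide_less_cancel)
  have "(\<Sum>i\<in>{k..<l}. x (real (Suc i) / 2 ^ N) - x (real i / 2 ^ N)) = x (real l / 2 ^ N) - x (real k / 2 ^ N)"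
    by (rule sum_Suc_diff') (use le in simp)
  then show ?case
    unfolding osc.simps using kl(4) Suc.IH[OF kl(5)] le
    by - (rule bexI[of _ k], rule bexI[of _ l], simp_all del: of_nat_Suc)
qed simp

section \<open>One-sided limits along the dyadic times\<close>

definition dyadic_right :: "real \<Rightarrow> real filter" where
  "dyadic_right t = at t within (dyadic_times \<inter> {t<..})"

definition dyadic_left :: "real \<Rightarrow> real filter" where
  "dyadic_left t = at t within (dyadic_times \<inter> {..<t})"

lemma eventually_dyadic_right:
  "eventually P (dyadic_right t) \<longleftrightarrow> (\<exists>d>0. \<forall>u\<in>dyadic_times. t < u \<and> u < t + d \<longrightarrow> P u)"
proof -
  have eq: "(u \<in> dyadic_times \<inter> {t<..} \<longrightarrow> u \<noteq> t \<and> \<bar>u - t\<bar> < d \<longrightarrow> P u) \<longleftrightarrow> (u \<in> dyadic_times \<longrightarrow> t < u \<and> u < t + d \<longrightarrow> P u)" for u d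
    by (auto simp: abs_if)
  then show ?thesis
    unfolding dyadic_right_def eventually_at dist_real_def Ball_def by (simp only: eq)
qed

lemma eventually_dyadic_left:
  "eventually P (dyadic_left t) \<longleftrightarrow> (\<exists>d>0. \<forall>u\<in>dyadic_times. t - d < u \<and> u < t \<longrightarrow> P u)"
proof -
  have eq: "(u \<in> dyadic_times \<inter> {..<t} \<longrightarrow> u \<noteq> t \<and> \<bar>u - t\<bar> < d \<longrightarrow> P u) \<longleftrightarrow> (u \<in> dyadic_times \<longrightarrow> t - d < u \<and> u < t \<longrightarrow> P u)" for u d
    by (auto simp: abs_if)
  then show ?thesis
    unfolding dyadic_left_def eventually_at dist_real_def Ball_def by (simp only: eq)
qed

text \<open>For \<open>t \<ge> 0\<close> this is the index of the least grid point strictly above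
  \<open>t\<close>. The \<open>Suc\<close> matters when \<open>t\<close> is itself a grid point,
  because the limits are taken from strictly above.\<close>

definition dyadic_above :: "nat \<Rightarrow> real \<Rightarrow> nat" where
  "dyadic_above N t = Suc (nat \<lfloor>t * 2 ^ N\<rfloor>)"

lemma dyadic_above_bounds:
  assumes "0 \<le> t"
  shows "t < real (dyadic_above N t) / 2 ^ N" "real (dyadic_above N t) / 2 ^ N \<le> t + 1 / 2 ^ N"
proof -
  define k where "k = \<lfloor>t * 2 ^ N\<rfloor>"
  have "real (nat k) = of_int k" using assms by (simp add: k_def)
  moreover have "of_int k \<le> t * 2 ^ N" "t * 2 ^ N < of_int k + 1"
    unfolding k_def by linarith+
  ultimately show "t < real (dyadic_above N t) / 2 ^ N" "real (dyadic_above N t) / 2 ^ N \<le> t + 1 / 2 ^ N"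
    unfolding dyadic_above_def k_def[symmetric] by (simp_all add: field_simps)
qed

lemma dyadic_above_mono: "s \<le> t \<Longrightarrow> dyadic_above N s \<le> dyadic_above N t"
  unfolding dyadic_above_def by (intro Suc_leI le_imp_less_Suc nat_mono floor_mono mult_right_mono) auto

lemma power_half_tendsto: "(\<lambda>N. 1 / 2 ^ N :: real) \<longlonglongrightarrow> 0"
  using LIMSEQ_realpow_zero[of "1 / 2 :: real"] by (simp add: power_one_over)

lemma dyadic_above_tendsto:
  assumes "0 \<le> t"
  shows "(\<lambda>N. real (dyadic_above N t) / 2 ^ N) \<longlonglongrightarrow> t"
proof (rule tendsto_sandwich[OF always_eventually always_eventually])
  show "\<forall>N. t \<le> real (dyadic_above N t) / 2 ^ N" "\<forall>N. real (dyadic_above N t) / 2 ^ N \<le> t + 1 / 2 ^ N"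
    using dyadic_above_bounds[OF assms] less_imp_le by blast+
  show "(\<lambda>N. t + 1 / 2 ^ N) \<longlonglongrightarrow> t" using tendsto_add[OF tendsto_const power_half_tendsto, of t] by simp
qed simp

lemma filterlim_dyadic_above:
  assumes "0 \<le> t"
  shows "filterlim (\<lambda>N. real (dyadic_above N t) / 2 ^ N) (dyadic_right t) sequentially"
  unfolding dyadic_right_def filterlim_at
proof (intro conjI always_eventually allI)
  show "real (dyadic_above N t) / 2 ^ N \<in> dyadic_times \<inter> {t<..}" "real (dyadic_above N t) / 2 ^ N \<noteq> t" for N
    using dyadic_above_bounds(1)[OF assms, of N] grid_point[of "dyadic_above N t" N] by auto
qed (rule dyadic_above_tendsto[OF assms])

lemma dyadic_right_nonbot: "0 \<le> t \<Longrightarrow> dyadic_right t \<noteq> bot"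
  using filterlim_dyadic_above[of t] by (metis bot.extremum_uniqueI filterlim_def filtermap_bot_iff sequentially_bot)

lemma dyadic_dense:
  assumes "0 \<le> s" "s < t"
  shows "\<exists>u\<in>dyadic_times. s < u \<and> u < t"
proof -
  have "eventually (\<lambda>u. u \<in> dyadic_times \<and> s < u \<and> u < t) (dyadic_right s)"
    unfolding eventually_dyadic_right using assms by (intro exI[of _ "t - s"]) auto
  then show ?thesis using eventually_happens'[OF dyadic_right_nonbot[OF assms(1)]] by blast
qed

lemma dyadic_left_nonbot:
  assumes "0 < t"
  shows "dyadic_left t \<noteq> bot"
proof
  assume "dyadic_left t = bot"
  then have "eventually (\<lambda>_. False) (dyadic_left t)" by simp
  then obtain d where d: "d > 0" "\<And>u. u \<in> dyadic_times \<Longrightarrow> \<not> (t - d < u \<and> u < t)"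
    unfolding eventually_dyadic_left by blast
  obtain u where "u \<in> dyadic_times" "max 0 (t - d) < u" "u < t"
    using dyadic_dense[of "max 0 (t - d)" t] assms d(1) by auto
  then show False using d(2) by auto
qed

lemma cauchy_limit:
  fixes x :: "real \<Rightarrow> 'a::banach"
  assumes "F \<noteq> bot" "\<And>e. 0 < e \<Longrightarrow> \<exists>P. eventually P F \<and> (\<forall>u v. P u \<and> P v \<and> u < v \<longrightarrow> norm (x v - x u) \<le> e)"
  shows "\<exists>l. (x \<longlongrightarrow> l) F"
proof -
  have "cauchy_filter (filtermap x F)"
    unfolding cauchy_filter_metric_filtermap
  proof (intro allI impI)
    fix e :: real assume e: "0 < e"
    then obtain P where P: "eventually P F" "\<And>u v. P u \<Longrightarrow> P v \<Longrightarrow> u < v \<Longrightarrow> norm (x v - x u) \<le> e / 2"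
      using assms(2)[of "e / 2"] by auto
    have "dist (x u) (x v) < e" if "P u" "P v" for u v
      using P(2)[of u v] P(2)[of v u] that e
      by (cases u v rule: linorder_cases) (auto simp: dist_norm norm_minus_commute)
    then show "\<exists>P. eventually P F \<and> (\<forall>u v. P u \<and> P v \<longrightarrow> dist (x u) (x v) < e)" using P(1) by blast
  qed
  then obtain l where "filtermap x F \<le> nhds l"
    using cauchy_filter_complete_converges[of "filtermap x F" UNIV] assms(1) complete_UNIV
    by (auto simp: filtermap_bot_iff)
  then show ?thesis by (auto simp: filterlim_def)
qed

text \<open>If \<open>x\<close> were not Cauchy, every interval to the right of \<open>t\<close>
  would contain two dyadic times with values more than \<open>e\<close> apart. Choosing each new
  pair to the left of the previous ones prepends an oscillation, so chains of every length would fit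
  into the window.\<close>

lemma dyadic_right_limit:
  fixes x :: "real \<Rightarrow> 'a::banach"
  assumes t: "0 \<le> t" and fin: "\<And>e. 0 < e \<Longrightarrow> \<exists>a b p. a \<le> t \<and> t < b \<and> \<not> oscillates (dyadic_times \<inter> {a..b}) x e p a"
  shows "\<exists>l. (x \<longlongrightarrow> l) (dyadic_right t)"
proof (rule cauchy_limit[OF dyadic_right_nonbot[OF t]], rule ccontr)
  fix e :: real assume e: "0 < e"
    and no: "\<nexists>P. eventually P (dyadic_right t) \<and> (\<forall>u v. P u \<and> P v \<and> u < v \<longrightarrow> norm (x v - x u) \<le> e)"
  obtain a b p where abp: "a \<le> t" "t < b" "\<not> oscillates (dyadic_times \<inter> {a..b}) x e p a" using fin[OF e] by blast
  have jump: "\<exists>u\<in>dyadic_times. \<exists>v\<in>dyadic_times. t < u \<and> u < v \<and> v < c \<and> e < norm (x v - x u)" if c: "t < c" for c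
  proof (rule ccontr)
    assume *: "\<not> ?thesis"
    have "eventually (\<lambda>u. u \<in> dyadic_times \<and> t < u \<and> u < c) (dyadic_right t)"
      unfolding eventually_dyadic_right using c by (intro exI[of _ "c - t"]) auto
    moreover have "norm (x v - x u) \<le> e"
      if "u \<in> dyadic_times \<and> t < u \<and> u < c" "v \<in> dyadic_times \<and> t < v \<and> v < c" "u < v" for u v
      using * that not_le by blast
    ultimately show False using no by blast
  qed
  have "\<exists>c>t. c \<le> b \<and> oscillates (dyadic_times \<inter> {a..b}) x e q c" for q
  proof (induction q)
    case 0
    then show ?case using abp(2) by (intro exI[of _ b]) simp
  next
    case (Suc q)
    then obtain c where c: "t < c" "c \<le> b" "oscillates (dyadic_times \<inter> {a..b}) x e q c" by blast
    obtain u v where uv: "u \<in> dyadic_times" "v \<in> dyadic_times" "t < u" "u < v" "v < c" "e < norm (x v - x u)"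
      using jump[OF c(1)] by blast
    have "oscillates (dyadic_times \<inter> {a..b}) x e q v" by (rule oscillates_antimono[OF c(3)]) (use uv in simp)
    then have "oscillates (dyadic_times \<inter> {a..b}) x e (Suc q) u"
      unfolding oscillates.simps using uv c abp by - (rule bexI[of _ u], rule bexI[of _ v], auto)
    moreover have "t < u" "u \<le> b" using uv c by auto
    ultimately show ?case by blast
  qed
  then obtain c where "t < c" and c: "oscillates (dyadic_times \<inter> {a..b}) x e p c" by blast
  from c have "oscillates (dyadic_times \<inter> {a..b}) x e p a" by (rule oscillates_antimono) (use abp \<open>t < c\<close> in simp)
  then show False using abp(3) by simp
qed

text \<open>As on the right, except that chains grow forwards, each pair lying between the end of
  the previous one and \<open>t\<close>. Hence the induction claims a chain from every start
  \<open>c\<close> in the window before \<open>t\<close>.\<close>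

lemma dyadic_left_limit:
  fixes x :: "real \<Rightarrow> 'a::banach"
  assumes t: "0 < t" and fin: "\<And>e. 0 < e \<Longrightarrow> \<exists>a b p. a < t \<and> t \<le> b \<and> \<not> oscillates (dyadic_times \<inter> {a..b}) x e p a"
  shows "\<exists>l. (x \<longlongrightarrow> l) (dyadic_left t)"
proof (rule cauchy_limit[OF dyadic_left_nonbot[OF t]], rule ccontr)
  fix e :: real assume e: "0 < e"
    and no: "\<nexists>P. eventually P (dyadic_left t) \<and> (\<forall>u v. P u \<and> P v \<and> u < v \<longrightarrow> norm (x v - x u) \<le> e)"
  obtain a b p where abp: "a < t" "t \<le> b" "\<not> oscillates (dyadic_times \<inter> {a..b}) x e p a" using fin[OF e] by blast
  have jump: "\<exists>u\<in>dyadic_times. \<exists>v\<in>dyadic_times. c < u \<and> u < v \<and> v < t \<and> e < norm (x v - x u)" if c: "c < t" for c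
  proof (rule ccontr)
    assume *: "\<not> ?thesis"
    have "eventually (\<lambda>u. u \<in> dyadic_times \<and> c < u \<and> u < t) (dyadic_left t)"
      unfolding eventually_dyadic_left using c by (intro exI[of _ "t - c"]) auto
    moreover have "norm (x v - x u) \<le> e"
      if "u \<in> dyadic_times \<and> c < u \<and> u < t" "v \<in> dyadic_times \<and> c < v \<and> v < t" "u < v" for u v
      using * that not_le by blast
    ultimately show False using no by blast
  qed
  have "oscillates (dyadic_times \<inter> {a..b}) x e q c" if "a \<le> c" "c < t" for q c
    using that
  proof (induction q arbitrary: c)
    case (Suc q)
    obtain u v where uv: "u \<in> dyadic_times" "v \<in> dyadic_times" "c < u" "u < v" "v < t" "e < norm (x v - x u)"
      using jump[OF Suc.prems(2)] by blast
    have "oscillates (dyadic_times \<inter> {a..b}) x e q v" by (rule Suc.IH) (use uv Suc.prems in auto)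
    then show ?case
      unfolding oscillates.simps using uv Suc.prems abp by - (rule bexI[of _ u], rule bexI[of _ v], auto)
  qed simp
  then show False using abp by auto
qed

text \<open>As \<open>L s\<close> is a limit of values of \<open>x\<close> just after
  \<open>s\<close>, a bound for \<open>x\<close> on the dyadic times following \<open>s\<close>
  carries over to \<open>L s\<close>; this is \<open>near\<close>. It is applied around
  \<open>L t\<close> to the right of \<open>t\<close> and around the dyadic left limit to its
  left.\<close>

lemma cadlag_dyadic_limit:
  fixes x :: "real \<Rightarrow> 'a::euclidean_space"
  assumes right: "\<And>t. 0 \<le> t \<Longrightarrow> (x \<longlongrightarrow> L t) (dyadic_right t)"
    and left: "\<And>t. 0 < t \<Longrightarrow> \<exists>l. (x \<longlongrightarrow> l) (dyadic_left t)"
  shows "cadlag L"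
proof -
  have near: "dist (L s) c \<le> e"
    if "0 \<le> s" "s < b" "\<And>u. u \<in> dyadic_times \<Longrightarrow> s < u \<Longrightarrow> u < b \<Longrightarrow> dist (x u) c < e" for s b c e
  proof (rule tendsto_upperbound[OF _ _ dyadic_right_nonbot[OF that(1)]])
    show "((\<lambda>u. dist (x u) c) \<longlongrightarrow> dist (L s) c) (dyadic_right s)"
      by (intro tendsto_intros right that(1))
    show "eventually (\<lambda>u. dist (x u) c \<le> e) (dyadic_right s)"
      unfolding eventually_dyadic_right using that(2,3) by (intro exI[of _ "b - s"]) (auto intro: less_imp_le)
  qed
  show ?thesis
    unfolding cadlag_def
  proof (intro conjI allI impI)
    fix t :: real assume t: "0 \<le> t"
    show "(L \<longlongrightarrow> L t) (at_right t)"
    proof (rule tendstoI)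
      fix e :: real assume e: "0 < e"
      then have "eventually (\<lambda>u. dist (x u) (L t) < e / 2) (dyadic_right t)"
        using tendstoD[OF right[OF t], of "e / 2"] by simp
      then obtain d where d: "d > 0" "\<And>u. u \<in> dyadic_times \<Longrightarrow> t < u \<Longrightarrow> u < t + d \<Longrightarrow> dist (x u) (L t) < e / 2"
        unfolding eventually_dyadic_right by blast
      have "dist (L s) (L t) \<le> e / 2" if "t < s" "s < t + d" for s
        by (rule near[of s "t + d"]) (use that t d(2) in auto)
      then have "dist (L s) (L t) < e" if "t < s" "s < t + d" for s using that e by fastforce
      then show "eventually (\<lambda>s. dist (L s) (L t) < e) (at_right t)"
        unfolding eventually_at_right_field using d(1) by (intro exI[of _ "t + d"]) auto
    qed
  next
    fix t :: real assume t: "0 < t"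
    obtain l where l: "(x \<longlongrightarrow> l) (dyadic_left t)" using left[OF t] ..
    have "(L \<longlongrightarrow> l) (at_left t)"
    proof (rule tendstoI)
      fix e :: real assume e: "0 < e"
      then have "eventually (\<lambda>u. dist (x u) l < e / 2) (dyadic_left t)"
        using tendstoD[OF l, of "e / 2"] by simp
      then obtain d where d: "d > 0" "\<And>u. u \<in> dyadic_times \<Longrightarrow> t - d < u \<Longrightarrow> u < t \<Longrightarrow> dist (x u) l < e / 2"
        unfolding eventually_dyadic_left by blast
      have "dist (L s) l \<le> e / 2" if "max 0 (t - d) < s" "s < t" for s
        by (rule near[of s t]) (use that t d(2) in auto)
      then have "dist (L s) l < e" if "max 0 (t - d) < s" "s < t" for s using that e by fastforce
      then show "eventually (\<lambda>s. dist (L s) l < e) (at_left t)"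
        unfolding eventually_at_left_field using d(1) t by (intro exI[of _ "max 0 (t - d)"]) auto
    qed
    then show "\<exists>l. (L \<longlongrightarrow> l) (at_left t)" ..
  qed
qed

section \<open>Levy processes with prescribed marginals\<close>

lemma oscillates_threshold: "oscillates F x c p a \<Longrightarrow> d \<le> c \<Longrightarrow> oscillates F x d p a"
proof (induction p arbitrary: a)
  case (Suc p)
  then obtain u v where uv: "u \<in> F" "v \<in> F" "a \<le> u" "u < v" "c < norm (x v - x u)" "oscillates F x d p v" by auto
  then show ?case
    unfolding oscillates.simps using Suc.prems(2) by - (rule bexI[of _ u], rule bexI[of _ v], auto)
qed simp

lemma cadlag_diff_const:
  fixes f :: "real \<Rightarrow> 'a::real_normed_vector"
  assumes "cadlag f"
  shows "cadlag (\<lambda>t. f t - c)"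
  unfolding cadlag_def
proof (intro conjI allI impI)
  fix t :: real assume "0 \<le> t"
  then have "(f \<longlongrightarrow> f t) (at_right t)" using assms by (simp add: cadlag_def)
  then show "((\<lambda>t. f t - c) \<longlongrightarrow> f t - c) (at_right t)" by (intro tendsto_diff tendsto_const)
next
  fix t :: real assume "0 < t"
  then obtain l where "(f \<longlongrightarrow> l) (at_left t)" using assms unfolding cadlag_def by blast
  then have "((\<lambda>t. f t - c) \<longlongrightarrow> l - c) (at_left t)" by (intro tendsto_diff tendsto_const)
  then show "\<exists>l. ((\<lambda>t. f t - c) \<longlongrightarrow> l) (at_left t)" ..
qed

text \<open>The assumption \<open>small_mu\<close> is stochastic continuity at time 0 in the form,
  with 1/3, that \<open>small_steps\<close> consumes. Only increments of \<open>X\<close> are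
  prescribed; the start at zero is arranged in \<open>Z\<close>.\<close>

locale dyadic_process = prob_space M + convolution_semigroup \<mu> \<Psi>
  for M :: "'w measure" and \<mu> :: "real \<Rightarrow> 'a::euclidean_space measure" and \<Psi> +
  fixes X :: "real \<Rightarrow> 'w \<Rightarrow> 'a"
  assumes X_measurable [measurable]: "t \<in> dyadic_times \<Longrightarrow> X t \<in> borel_measurable M"
    and X_indep: "indep_vars (\<lambda>_. borel) (increment X N) {..<K}"
    and X_law: "distr M borel (increment X N i) = \<mu> (1 / 2 ^ N)"
    and small_mu: "0 < \<epsilon> \<Longrightarrow> \<exists>d>0. \<forall>t. 0 < t \<and> t \<le> d \<longrightarrow> measure (\<mu> t) {x. \<epsilon> < norm x} \<le> 1 / 3"
begin

lemma increment_indep: "indep_vars (\<lambda>_. borel) (increment X N) {..<K}"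
  using X_indep[of N K] by simp

abbreviation gain :: "nat \<Rightarrow> nat \<Rightarrow> nat \<Rightarrow> 'w \<Rightarrow> 'a" where
  "gain N i j \<omega> \<equiv> X (real j / 2 ^ N) \<omega> - X (real i / 2 ^ N) \<omega>"

lemma sum_increment: "i \<le> j \<Longrightarrow> (\<Sum>k\<in>{i..<j}. increment X N k \<omega>) = gain N i j \<omega>"
  by (rule sum_Suc_diff')

lemma X_grid_measurable: "X (real j / 2 ^ N) \<in> borel_measurable M"
  by (rule X_measurable[OF grid_point])

lemma expectation_diff:
  assumes "i \<le> j"
  shows "(CLINT \<omega>|M. iexp ((gain N i j \<omega>) \<bullet> y)) =
    exp (of_real ((real j - real i) / 2 ^ N) * \<Psi> y)"
proof -
  have ind: "indep_vars (\<lambda>_. borel) (increment X N) {i..<j}"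
    by (rule indep_vars_subset[OF increment_indep[of N j]]) auto
  have law: "distr M borel (increment X N k) = \<mu> (1 / 2 ^ N)" for k
    using X_law[of k N] by simp
  have "(CLINT \<omega>|M. iexp ((gain N i j \<omega>) \<bullet> y)) =
      chf (distr M borel (\<lambda>\<omega>. \<Sum>k\<in>{i..<j}. increment X N k \<omega>)) y"
    unfolding sum_increment[OF assms]
    by (rule chf_distr[symmetric]) (intro borel_measurable_diff X_grid_measurable)
  also have "\<dots> = exp (of_real (1 / 2 ^ N) * \<Psi> y) ^ (j - i)"
    unfolding chf_indep_sum[OF finite_atLeastLessThan ind] law by (simp add: chf_mu)
  also have "\<dots> = exp (of_real ((real j - real i) / 2 ^ N) * \<Psi> y)"
    using assms by (simp add: exp_of_nat_mult[symmetric] of_nat_diff)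
  finally show ?thesis .
qed

lemma diff_law:
  assumes "i < j"
  shows "distr M borel (gain N i j) = \<mu> ((real j - real i) / 2 ^ N)"
proof (rule chf_unique)
  have m: "(gain N i j) \<in> borel_measurable M"
    by (intro borel_measurable_diff X_grid_measurable)
  show "borel_prob (distr M borel (gain N i j))"
    by (rule borel_prob_distr[OF prob_space_axioms m])
  show "borel_prob (\<mu> ((real j - real i) / 2 ^ N))"
    using assms by (intro borel_prob_mu) simp
  show "chf (distr M borel (gain N i j)) = chf (\<mu> ((real j - real i) / 2 ^ N))"
    using assms expectation_diff[of i j N] by (auto simp: fun_eq_iff chf_distr[OF m] chf_mu)
qed

lemma sets_oscillates:
  assumes "F \<subseteq> dyadic_times"
  shows "{\<omega> \<in> space M. oscillates F (\<lambda>t. X t \<omega>) c p a} \<in> events"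
proof (induction p arbitrary: a)
  case (Suc p)
  have cF: "countable F" using assms countable_dyadics by (rule countable_subset)
  have "{\<omega> \<in> space M. a \<le> u \<and> u < v \<and> c < norm (X v \<omega> - X u \<omega>) \<and> oscillates F (\<lambda>t. X t \<omega>) c p v} \<in> events"
    if "u \<in> F" "v \<in> F" for u v
  proof -
    have [measurable]: "X u \<in> borel_measurable M" "X v \<in> borel_measurable M"
      using that assms by auto
    have "{\<omega> \<in> space M. c < norm (X v \<omega> - X u \<omega>)} \<in> events" by measurable
    from sets.Int[OF this Suc.IH[of v]]
    have "{\<omega> \<in> space M. c < norm (X v \<omega> - X u \<omega>)} \<inter> {\<omega> \<in> space M. oscillates F (\<lambda>t. X t \<omega>) c p v} \<in> events" .
    moreover have "{\<omega> \<in> space M. a \<le> u \<and> u < v \<and> c < norm (X v \<omega> - X u \<omega>) \<and> oscillates F (\<lambda>t. X t \<omega>) c p v} =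
        (if a \<le> u \<and> u < v then {\<omega> \<in> space M. c < norm (X v \<omega> - X u \<omega>)} \<inter> {\<omega> \<in> space M. oscillates F (\<lambda>t. X t \<omega>) c p v} else {})"
      by auto
    ultimately show ?thesis by simp
  qed
  then show ?case
    unfolding oscillates.simps
    by (intro sets.sets_Collect_countable_Ex' cF)
qed simp

lemma window_exists:
  assumes "0 < \<epsilon>"
  shows "\<exists>m. \<forall>t. 0 < t \<and> t \<le> 1 / 2 ^ m \<longrightarrow> measure (\<mu> t) {x. \<epsilon> < norm x} \<le> 1 / 3"
proof -
  obtain d where d: "d > 0" "\<And>t. 0 < t \<and> t \<le> d \<Longrightarrow> measure (\<mu> t) {x. \<epsilon> < norm x} \<le> 1 / 3"
    using small_mu[OF assms] by blast
  obtain m where "1 / 2 ^ m < d"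
    using order_tendstoD(2)[OF power_half_tendsto d(1)] by (auto simp: eventually_sequentially)
  then show ?thesis using d(2) by (intro exI[of _ m]) auto
qed

text \<open>On each grid at least as fine as the window, whose ends are then grid points,
  \<open>prob_osc_le\<close> gives the same bound. The events \<open>Ev N\<close> increase with the
  grid and exhaust the dyadic event, so the bound survives in the limit.\<close>

lemma prob_oscillates_le:
  assumes \<epsilon>: "0 < \<epsilon>" and m: "\<And>t. 0 < t \<Longrightarrow> t \<le> 1 / 2 ^ m \<Longrightarrow> measure (\<mu> t) {x. \<epsilon> < norm x} \<le> 1 / 3"
  shows "prob {\<omega> \<in> space M. oscillates (dyadic_times \<inter> {real j / 2 ^ m..real (Suc j) / 2 ^ m}) (\<lambda>t. X t \<omega>) (4 * \<epsilon>) p (real j / 2 ^ m)}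
    \<le> (1 / 2) ^ p"
proof -
  let ?W = "{real j / 2 ^ m..real (Suc j) / 2 ^ m}"
  define Ev where "Ev N = {\<omega> \<in> space M. oscillates (grid (N + m) \<inter> ?W) (\<lambda>t. X t \<omega>) (4 * \<epsilon>) p (real j / 2 ^ m)}" for N
  have "prob (Ev d) \<le> (1 / 2) ^ p" for d
  proof -
    define N where "N = d + m"
    let ?L = "j * 2 ^ d" and ?K = "Suc j * 2 ^ d"
    have L: "real ?L / 2 ^ N = real j / 2 ^ m" and K: "real ?K / 2 ^ N = real (Suc j) / 2 ^ m"
      unfolding N_def power_add of_nat_mult by (simp_all del: of_nat_Suc)
    interpret small_steps M "increment X N" ?L ?K \<epsilon>
    proof
      show "indep_vars (\<lambda>_. borel) (increment X N) {..<?K}" by (rule increment_indep)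
      fix a b assume ab: "?L \<le> a" "a \<le> b" "b \<le> ?K"
      show "prob {\<omega> \<in> space M. \<epsilon> < norm (\<Sum>i\<in>{a..<b}. increment X N i \<omega>)} \<le> 1 / 3"
      proof (cases "a = b")
        case True
        then show ?thesis using \<epsilon> by simp
      next
        case False
        have "real b - real a \<le> 2 ^ d"
        proof -
          have "b \<le> a + 2 ^ d" using ab by simp
          then have "real b \<le> real (a + 2 ^ d)" by (rule of_nat_mono)
          then show ?thesis by simp
        qed
        from divide_right_mono[OF this, of "2 ^ N"] have le: "(real b - real a) / 2 ^ N \<le> 1 / 2 ^ m"
          by (simp add: N_def power_add)
        have meas: "(gain N a b) \<in> borel_measurable M"
          by (intro borel_measurable_diff X_grid_measurable)
        have "prob {\<omega> \<in> space M. \<epsilon> < norm (\<Sum>i\<in>{a..<b}. increment X N i \<omega>)} =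
            measure (distr M borel (gain N a b)) {x. \<epsilon> < norm x}"
          unfolding sum_increment[OF ab(2)]
          by (subst measure_distr[OF meas]) (auto intro!: arg_cong[where f=prob])
        also have "\<dots> \<le> 1 / 3"
        proof -
          have ab': "a < b" using False ab(2) by simp
          show ?thesis unfolding diff_law[OF ab'] by (rule m[OF _ le]) (use ab' in simp)
        qed
        finally show ?thesis .
      qed
    qed
    have "Ev d \<subseteq> {\<omega> \<in> space M. osc ?K (4 * \<epsilon>) p ?L (steps \<omega>)}"
    proof
      fix \<omega> assume \<omega>: "\<omega> \<in> Ev d"
      then have "oscillates (grid N \<inter> {real j / 2 ^ m..real ?K / 2 ^ N}) (\<lambda>t. X t \<omega>) (4 * \<epsilon>) p (real ?L / 2 ^ N)"
        unfolding L K by (simp add: Ev_def N_def)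
      from oscillates_osc[OF this] \<omega> show "\<omega> \<in> {\<omega> \<in> space M. osc ?K (4 * \<epsilon>) p ?L (steps \<omega>)}"
        by (simp add: steps_def Ev_def del: of_nat_Suc)
    qed
    then have "prob (Ev d) \<le> prob {\<omega> \<in> space M. osc ?K (4 * \<epsilon>) p ?L (steps \<omega>)}"
      by (intro finite_measure_mono sets_osc)
    also have "\<dots> \<le> (1 / 2) ^ p" by (rule prob_osc_le) auto
    finally show ?thesis .
  qed
  moreover have "(\<lambda>N. prob (Ev N)) \<longlonglongrightarrow> prob (\<Union>N. Ev N)"
  proof (rule finite_Lim_measure_incseq)
    have "grid (N + m) \<inter> ?W \<subseteq> dyadic_times" for N using grid_dyadics by blast
    then show "range Ev \<subseteq> events" unfolding Ev_def using sets_oscillates by blast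
    show "incseq Ev"
    proof (rule incseq_SucI)
      fix N
      have sub: "grid (N + m) \<inter> ?W \<subseteq> grid (Suc N + m) \<inter> ?W"
        using grid_mono[of "N + m" "Suc N + m"] by auto
      show "Ev N \<subseteq> Ev (Suc N)"
        unfolding Ev_def using oscillates_mono[OF _ sub] by blast
    qed
  qed
  ultimately have "prob (\<Union>N. Ev N) \<le> (1 / 2) ^ p" by (intro LIMSEQ_le_const2) auto
  moreover have "{\<omega> \<in> space M. oscillates (dyadic_times \<inter> ?W) (\<lambda>t. X t \<omega>) (4 * \<epsilon>) p (real j / 2 ^ m)} = (\<Union>N. Ev N)"
  proof
    show "(\<Union>N. Ev N) \<subseteq> {\<omega> \<in> space M. oscillates (dyadic_times \<inter> ?W) (\<lambda>t. X t \<omega>) (4 * \<epsilon>) p (real j / 2 ^ m)}"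
    proof safe
      fix N \<omega> assume "\<omega> \<in> Ev N"
      then show "\<omega> \<in> space M" "oscillates (dyadic_times \<inter> ?W) (\<lambda>t. X t \<omega>) (4 * \<epsilon>) p (real j / 2 ^ m)"
        unfolding Ev_def using grid_dyadics[of "N + m"]
        by (blast intro: oscillates_mono[of "grid (N + m) \<inter> ?W"])+
    qed
    show "{\<omega> \<in> space M. oscillates (dyadic_times \<inter> ?W) (\<lambda>t. X t \<omega>) (4 * \<epsilon>) p (real j / 2 ^ m)} \<subseteq> (\<Union>N. Ev N)"
    proof safe
      fix \<omega> assume \<omega>: "\<omega> \<in> space M" "oscillates (dyadic_times \<inter> ?W) (\<lambda>t. X t \<omega>) (4 * \<epsilon>) p (real j / 2 ^ m)"
      then obtain N where "N \<ge> m" "oscillates (grid N \<inter> ?W) (\<lambda>t. X t \<omega>) (4 * \<epsilon>) p (real j / 2 ^ m)"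
        using oscillates_grid[OF \<omega>(2), of m] by blast
      then have "\<omega> \<in> Ev (N - m)" using \<omega> by (simp add: Ev_def)
      then show "\<omega> \<in> (\<Union>N. Ev N)" by blast
    qed
  qed
  ultimately show ?thesis by simp
qed

text \<open>The factor 4 matches the size \<open>4 * \<epsilon>\<close> in
  \<open>prob_oscillates_le\<close>: windows of length \<open>1 / 2 ^ mesh n\<close> control
  oscillations beyond \<open>1 / real (Suc n)\<close>.\<close>

definition mesh :: "nat \<Rightarrow> nat" where
  "mesh n = (SOME m. \<forall>t. 0 < t \<and> t \<le> 1 / 2 ^ m \<longrightarrow> measure (\<mu> t) {x. 1 / (4 * real (Suc n)) < norm x} \<le> 1 / 3)"

lemma mesh: "0 < t \<Longrightarrow> t \<le> 1 / 2 ^ mesh n \<Longrightarrow> measure (\<mu> t) {x. 1 / (4 * real (Suc n)) < norm x} \<le> 1 / 3"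
  using someI_ex[OF window_exists[of "1 / (4 * real (Suc n))"]] by (simp add: mesh_def)

definition calm :: "nat \<Rightarrow> nat \<Rightarrow> nat \<Rightarrow> 'w \<Rightarrow> bool" where
  "calm n j p \<omega> \<longleftrightarrow> \<not> oscillates (dyadic_times \<inter> {real j / 2 ^ mesh n..real (Suc j) / 2 ^ mesh n})
     (\<lambda>t. X t \<omega>) (1 / real (Suc n)) p (real j / 2 ^ mesh n)"

text \<open>Finitely many oscillations in every window and for every size, written with countably
  many conditions so that it is measurable and may be checked one condition at a time.\<close>

definition regular :: "'w \<Rightarrow> bool" where
  "regular \<omega> \<longleftrightarrow> (\<forall>n j. \<exists>p. calm n j p \<omega>)"

lemma calm_measurable [measurable]: "Measurable.pred M (calm n j p)"
proof -
  have "{\<omega> \<in> space M. oscillates (dyadic_times \<inter> {real j / 2 ^ mesh n..real (Suc j) / 2 ^ mesh n})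
     (\<lambda>t. X t \<omega>) (1 / real (Suc n)) p (real j / 2 ^ mesh n)} \<in> events"
    by (rule sets_oscillates) auto
  then have "Measurable.pred M (\<lambda>\<omega>. \<not> oscillates (dyadic_times \<inter> {real j / 2 ^ mesh n..real (Suc j) / 2 ^ mesh n})
     (\<lambda>t. X t \<omega>) (1 / real (Suc n)) p (real j / 2 ^ mesh n))"
    by (intro pred_intros_logic) (simp add: pred_def)
  then show ?thesis by (simp add: calm_def[abs_def])
qed

lemma regular_measurable [measurable]: "Measurable.pred M regular"
  unfolding regular_def[abs_def] by measurable

text \<open>Unboundedly many oscillations in a window have probability at most
  \<open>(1 / 2) ^ p\<close> for every \<open>p\<close>, hence probability zero.\<close>

lemma AE_regular: "AE \<omega> in M. regular \<omega>"
  unfolding regular_def AE_all_countable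
proof (intro allI)
  fix n j
  have le: "prob {\<omega> \<in> space M. \<not> calm n j p \<omega>} \<le> (1 / 2) ^ p" for p
  proof -
    have 4: "4 * (1 / (4 * real (Suc n))) = 1 / real (Suc n)" by (simp del: of_nat_Suc)
    have "0 < 1 / (4 * real (Suc n))" by simp
    then show ?thesis
      unfolding calm_def not_not 4[symmetric] by (rule prob_oscillates_le[OF _ mesh])
  qed
  have ev: "{\<omega> \<in> space M. \<not> calm n j p \<omega>} \<in> events" for p by measurable
  have ev': "{\<omega> \<in> space M. \<not> (\<exists>p. calm n j p \<omega>)} \<in> events" by measurable
  have "prob {\<omega> \<in> space M. \<not> (\<exists>p. calm n j p \<omega>)} \<le> (1 / 2) ^ p" for p
    by (rule order_trans[OF finite_measure_mono le[of p]]) (use ev in auto)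
  then have "prob {\<omega> \<in> space M. \<not> (\<exists>p. calm n j p \<omega>)} \<le> 0"
    by (intro LIMSEQ_le_const[OF LIMSEQ_realpow_zero[of "1 / 2 :: real"]]) auto
  then have "prob {\<omega> \<in> space M. \<not> (\<exists>p. calm n j p \<omega>)} = 0"
    using measure_nonneg[of M] by (simp add: order_antisym)
  then have "emeasure M {\<omega> \<in> space M. \<not> (\<exists>p. calm n j p \<omega>)} = 0"
    by (simp add: emeasure_eq_measure)
  then show "AE \<omega> in M. \<exists>p. calm n j p \<omega>"
    by (rule AE_I[OF order_refl _ ev'])
qed

section \<open>The regularized process\<close>

definition right_lim :: "real \<Rightarrow> 'w \<Rightarrow> 'a" where
  "right_lim t \<omega> = Lim (dyadic_right t) (\<lambda>s. X s \<omega>)"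

text \<open>The zero path outside the regular points and the subtraction of
  \<open>right_lim 0\<close> are there because \<open>levy_process\<close> asks for cadlag paths
  starting at zero at every sample point, not just almost everywhere.\<close>

definition Z :: "real \<Rightarrow> 'w \<Rightarrow> 'a" where
  "Z t \<omega> = (if regular \<omega> then right_lim t \<omega> - right_lim 0 \<omega> else 0)"

lemma regular_threshold:
  assumes "regular \<omega>" "0 < e"
  shows "\<exists>m. \<forall>j. \<exists>p. \<not> oscillates (dyadic_times \<inter> {real j / 2 ^ m..real (Suc j) / 2 ^ m}) (\<lambda>t. X t \<omega>) e p (real j / 2 ^ m)"
proof -
  obtain n where n: "inverse (real (Suc n)) < e" using reals_Archimedean[OF assms(2)] by blast
  show ?thesis
  proof (rule exI[of _ "mesh n"], rule allI)
    fix j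
    obtain p where "calm n j p \<omega>" using assms(1) by (auto simp: regular_def)
    moreover have "1 / real (Suc n) \<le> e" using n by (simp add: inverse_eq_divide)
    ultimately have "\<not> oscillates (dyadic_times \<inter> {real j / 2 ^ mesh n..real (Suc j) / 2 ^ mesh n}) (\<lambda>t. X t \<omega>) e p (real j / 2 ^ mesh n)"
      unfolding calm_def using oscillates_threshold by blast
    then show "\<exists>p. \<not> oscillates (dyadic_times \<inter> {real j / 2 ^ mesh n..real (Suc j) / 2 ^ mesh n}) (\<lambda>t. X t \<omega>) e p (real j / 2 ^ mesh n)" ..
  qed
qed

lemma right_lim_tendsto:
  assumes "regular \<omega>" "0 \<le> t"
  shows "((\<lambda>s. X s \<omega>) \<longlongrightarrow> right_lim t \<omega>) (dyadic_right t)"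
proof -
  have "\<exists>l. ((\<lambda>s. X s \<omega>) \<longlongrightarrow> l) (dyadic_right t)"
  proof (rule dyadic_right_limit[OF assms(2)])
    fix e :: real assume "0 < e"
    then obtain m where m: "\<And>j. \<exists>p. \<not> oscillates (dyadic_times \<inter> {real j / 2 ^ m..real (Suc j) / 2 ^ m}) (\<lambda>t. X t \<omega>) e p (real j / 2 ^ m)"
      using regular_threshold[OF assms(1)] by blast
    define j where "j = nat \<lfloor>t * 2 ^ m\<rfloor>"
    have "real j = of_int \<lfloor>t * 2 ^ m\<rfloor>"
      using assms(2) unfolding j_def by (subst of_nat_nat) auto
    then have "real j \<le> t * 2 ^ m" "t * 2 ^ m < real (Suc j)" by linarith+
    then have "real j / 2 ^ m \<le> t" "t < real (Suc j) / 2 ^ m" by (simp_all add: field_simps)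
    then show "\<exists>a b p. a \<le> t \<and> t < b \<and> \<not> oscillates (dyadic_times \<inter> {a..b}) (\<lambda>t. X t \<omega>) e p a"
      using m[of j] by blast
  qed
  then show ?thesis
    unfolding right_lim_def using tendsto_Lim[OF dyadic_right_nonbot[OF assms(2)]] by metis
qed

lemma left_lim_exists:
  assumes "regular \<omega>" "0 < t"
  shows "\<exists>l. ((\<lambda>s. X s \<omega>) \<longlongrightarrow> l) (dyadic_left t)"
proof (rule dyadic_left_limit[OF assms(2)])
  fix e :: real assume "0 < e"
  then obtain m where m: "\<And>j. \<exists>p. \<not> oscillates (dyadic_times \<inter> {real j / 2 ^ m..real (Suc j) / 2 ^ m}) (\<lambda>t. X t \<omega>) e p (real j / 2 ^ m)"
    using regular_threshold[OF assms(1)] by blast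
  \<comment> \<open>The ceiling minus one replaces the floor used for right limits: the window has
    to begin strictly before \<open>t\<close> even if \<open>t\<close> is a grid point.\<close>
  define j where "j = nat (\<lceil>t * 2 ^ m\<rceil> - 1)"
  have "real j = of_int \<lceil>t * 2 ^ m\<rceil> - 1"
    using assms(2) unfolding j_def by (subst of_nat_nat) auto
  then have "real j < t * 2 ^ m" "t * 2 ^ m \<le> real (Suc j)" by linarith+
  then have "real j / 2 ^ m < t" "t \<le> real (Suc j) / 2 ^ m" by (simp_all add: field_simps)
  then show "\<exists>a b p. a < t \<and> t \<le> b \<and> \<not> oscillates (dyadic_times \<inter> {a..b}) (\<lambda>t. X t \<omega>) e p a"
    using m[of j] by blast
qed

lemma cadlag_Z: "cadlag (\<lambda>t. Z t \<omega>)"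
proof (cases "regular \<omega>")
  case True
  have "cadlag (\<lambda>t. right_lim t \<omega>)"
    by (rule cadlag_dyadic_limit[OF right_lim_tendsto[OF True] left_lim_exists[OF True]])
  then have "cadlag (\<lambda>t. right_lim t \<omega> - right_lim 0 \<omega>)"
    by (rule cadlag_diff_const)
  then show ?thesis using True by (simp add: Z_def)
qed (auto simp: Z_def cadlag_def)

lemma Z_diff_tendsto:
  assumes "regular \<omega>" "0 \<le> s" "0 \<le> t"
  shows "(\<lambda>N. gain N (dyadic_above N s) (dyadic_above N t) \<omega>) \<longlonglongrightarrow> Z t \<omega> - Z s \<omega>"
proof -
  have "(\<lambda>N. X (real (dyadic_above N u) / 2 ^ N) \<omega>) \<longlonglongrightarrow> right_lim u \<omega>" if "0 \<le> u" for u
    by (rule filterlim_compose[OF right_lim_tendsto[OF assms(1) that] filterlim_dyadic_above[OF that]])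
  then have "(\<lambda>N. gain N (dyadic_above N s) (dyadic_above N t) \<omega>) \<longlonglongrightarrow> right_lim t \<omega> - right_lim s \<omega>"
    using assms by (intro tendsto_diff)
  then show ?thesis using assms(1) by (simp add: Z_def)
qed

lemma Z_measurable [measurable]:
  assumes "0 \<le> t"
  shows "Z t \<in> borel_measurable M"
proof (rule borel_measurable_LIMSEQ_metric)
  show "(\<lambda>\<omega>. if regular \<omega> then gain N (dyadic_above N 0) (dyadic_above N t) \<omega> else 0) \<in> borel_measurable M" for N
    using X_grid_measurable by measurable
  show "(\<lambda>N. if regular \<omega> then gain N (dyadic_above N 0) (dyadic_above N t) \<omega> else 0) \<longlonglongrightarrow> Z t \<omega>" for \<omega>
    using Z_diff_tendsto[of \<omega> 0 t] assms by (cases "regular \<omega>") (auto simp: Z_def)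
qed

lemma expectation_Z_diff:
  assumes "0 \<le> s" "s \<le> t"
  shows "(CLINT \<omega>|M. iexp ((Z t \<omega> - Z s \<omega>) \<bullet> y)) = exp (of_real (t - s) * \<Psi> y)"
proof -
  have t: "0 \<le> t" using assms by simp
  have "(\<lambda>N. CLINT \<omega>|M. iexp ((gain N (dyadic_above N s) (dyadic_above N t) \<omega>) \<bullet> y))
      \<longlonglongrightarrow> (CLINT \<omega>|M. iexp ((Z t \<omega> - Z s \<omega>) \<bullet> y))"
  proof (rule tendsto_expectation_iexp)
    show "(\<lambda>\<omega>. (gain N (dyadic_above N s) (dyadic_above N t) \<omega>) \<bullet> y) \<in> borel_measurable M" for N
      by (intro borel_measurable_inner borel_measurable_diff X_grid_measurable borel_measurable_const)
    show "(\<lambda>\<omega>. (Z t \<omega> - Z s \<omega>) \<bullet> y) \<in> borel_measurable M"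
      by (intro borel_measurable_inner borel_measurable_diff Z_measurable borel_measurable_const assms t)
    show "AE \<omega> in M. (\<lambda>N. (gain N (dyadic_above N s) (dyadic_above N t) \<omega>) \<bullet> y) \<longlonglongrightarrow> (Z t \<omega> - Z s \<omega>) \<bullet> y"
      using AE_regular by eventually_elim (intro tendsto_inner Z_diff_tendsto tendsto_const assms t)
  qed
  moreover have "(CLINT \<omega>|M. iexp ((gain N (dyadic_above N s) (dyadic_above N t) \<omega>) \<bullet> y)) =
      exp (of_real (real (dyadic_above N t) / 2 ^ N - real (dyadic_above N s) / 2 ^ N) * \<Psi> y)" for N
    by (subst expectation_diff[OF dyadic_above_mono[OF assms(2)]]) (simp add: diff_divide_distrib)
  moreover have "(\<lambda>N. exp (of_real (real (dyadic_above N t) / 2 ^ N - real (dyadic_above N s) / 2 ^ N) * \<Psi> y)) \<longlonglongrightarrow>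
      exp (of_real (t - s) * \<Psi> y)"
    by (intro tendsto_intros dyadic_above_tendsto assms t)
  ultimately show ?thesis by (simp add: LIMSEQ_unique)
qed

text \<open>The increments of \<open>Z\<close> are almost sure limits of sums of grid increments
  over disjoint blocks. On a coarse grid some blocks may be empty, which is harmless.\<close>

lemma Z_indep:
  fixes n :: nat and t :: "nat \<Rightarrow> real"
  assumes t: "0 \<le> t 0" "\<And>i. i < n \<Longrightarrow> t i < t (Suc i)"
  shows "indep_vars (\<lambda>_. borel) (\<lambda>i \<omega>. Z (t (Suc i)) \<omega> - Z (t i) \<omega>) {..<n}"
proof (rule indep_vars_tendsto)
  have nonneg: "0 \<le> t i" if "i \<le> n" for i by (rule increasing_nonneg[OF t that])
  have mono: "t i \<le> t j" if "i \<le> j" "j \<le> n" for i j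
    using that
  proof (induction j rule: dec_induct)
    case (step k)
    then show ?case using t(2)[of k] by simp
  qed simp
  define A where "A N i = dyadic_above N (t i)" for N i
  have A_mono: "A N i \<le> A N j" if "i \<le> j" "j \<le> n" for N i j
    unfolding A_def by (rule dyadic_above_mono[OF mono[OF that]])
  show "indep_vars (\<lambda>_. borel) (\<lambda>i \<omega>. \<Sum>k\<in>{A N i..<A N (Suc i)}. increment X N k \<omega>) {..<n}" for N
  proof (rule indep_vars_block_sums[OF increment_indep[of N "A N n"]])
    show "{A N j..<A N (Suc j)} \<subseteq> {..<A N n}" if "j \<in> {..<n}" for j
      using A_mono[of "Suc j" n N] that by auto
    show "disjoint_family_on (\<lambda>i. {A N i..<A N (Suc i)}) {..<n}"
      unfolding disjoint_family_on_def
    proof (intro ballI impI)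
      have *: "{A N i..<A N (Suc i)} \<inter> {A N j..<A N (Suc j)} = {}" if "i < j" "j < n" for i j
        using A_mono[of "Suc i" j N] that by auto
      fix i j assume "i \<in> {..<n}" "j \<in> {..<n}" "i \<noteq> j"
      then show "{A N i..<A N (Suc i)} \<inter> {A N j..<A N (Suc j)} = {}"
        using *[of i j] *[of j i] by (cases i j rule: linorder_cases) (auto simp: Int_commute)
    qed
  qed
  show "(\<lambda>\<omega>. Z (t (Suc i)) \<omega> - Z (t i) \<omega>) \<in> borel_measurable M" if "i \<in> {..<n}" for i
    using that nonneg by (intro borel_measurable_diff Z_measurable) auto
  show "AE \<omega> in M. (\<lambda>N. \<Sum>k\<in>{A N i..<A N (Suc i)}. increment X N k \<omega>) \<longlonglongrightarrow> Z (t (Suc i)) \<omega> - Z (t i) \<omega>" if i: "i \<in> {..<n}" for i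
    using AE_regular
  proof eventually_elim
    case (elim \<omega>)
    have "(\<Sum>k\<in>{A N i..<A N (Suc i)}. increment X N k \<omega>) = X (real (A N (Suc i)) / 2 ^ N) \<omega> - X (real (A N i) / 2 ^ N) \<omega>" for N
      using i by (intro sum_increment A_mono) auto
    then show ?case
      using Z_diff_tendsto[OF elim, of "t i" "t (Suc i)"] nonneg[of i] nonneg[of "Suc i"] i by (simp add: A_def)
  qed
qed simp

lemma distr_Z_diff:
  assumes "0 \<le> s" "0 < t"
  shows "distr M borel (\<lambda>\<omega>. Z (s + t) \<omega> - Z s \<omega>) = \<mu> t"
proof (rule chf_unique)
  have m: "(\<lambda>\<omega>. Z (s + t) \<omega> - Z s \<omega>) \<in> borel_measurable M"
    using assms by (intro borel_measurable_diff Z_measurable) auto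
  show "borel_prob (distr M borel (\<lambda>\<omega>. Z (s + t) \<omega> - Z s \<omega>))"
    by (rule borel_prob_distr[OF prob_space_axioms m])
  show "borel_prob (\<mu> t)" by (rule borel_prob_mu[OF assms(2)])
  show "chf (distr M borel (\<lambda>\<omega>. Z (s + t) \<omega> - Z s \<omega>)) = chf (\<mu> t)"
    using assms by (auto simp: fun_eq_iff chf_distr[OF m] chf_mu expectation_Z_diff)
qed

lemma levy_process_Z: "levy_process M Z"
proof
  show "Z t \<in> borel_measurable M" if "0 \<le> t" for t by (rule Z_measurable[OF that])
  show "Z 0 \<omega> = 0" for \<omega> by (simp add: Z_def)
  show "distr M borel (\<lambda>\<omega>. Z (s + t) \<omega> - Z s \<omega>) = distr M borel (\<lambda>\<omega>. Z t \<omega> - Z 0 \<omega>)"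
    if "0 \<le> s" "0 \<le> t" for s t
    using distr_Z_diff[of s t] distr_Z_diff[of 0 t] that by (cases "t = 0") auto
qed (simp_all add: Z_indep cadlag_Z)

lemma distr_Z_1: "distr M borel (Z 1) = \<mu> 1"
proof -
  have "Z 0 \<omega> = 0" for \<omega> by (simp add: Z_def)
  then show ?thesis using distr_Z_diff[of 0 1] by simp
qed

end

lemma (in convolution_semigroup) levy_process_exists:
  assumes "\<And>\<epsilon>. 0 < \<epsilon> \<Longrightarrow> \<exists>d>0. \<forall>t. 0 < t \<and> t \<le> d \<longrightarrow> measure (\<mu> t) {x. \<epsilon> < norm x} \<le> 1 / 3"
  shows "\<exists>(M :: (real \<Rightarrow> 'a) measure) Z. levy_process M Z \<and> distr M borel (Z 1) = \<mu> 1"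
proof -
  obtain M :: "(real \<Rightarrow> 'a) measure" and X where
    X: "prob_space M" "\<And>t. t \<in> dyadic_times \<Longrightarrow> X t \<in> borel_measurable M"
    "\<And>N K. prob_space.indep_vars M (\<lambda>_. borel) (increment X N) {..<K}"
    "\<And>N i. distr M borel (increment X N i) = \<mu> (1 / 2 ^ N)"
    using dyadic_walk_exists by blast
  interpret dyadic_process M \<mu> \<Psi> X
    by (intro dyadic_process.intro dyadic_process_axioms.intro X assms convolution_semigroup_axioms)
  show ?thesis using levy_process_Z distr_Z_1 by blast
qed

text \<open>The laws at the times \<open>t\<close> are those of the same integral against the process run at speed \<open>t\<close>.\<close>

lemma (in levy_process) levy_process_integral_law_exists:
  assumes h: "mono_on {0..1} h" "continuous_on {0..1} h"
  shows "\<exists>(N :: (real \<Rightarrow> 'a) measure) Z. levy_process N Z \<and> distr N borel (Z 1) = integral_law M Y h (\<lambda>u. u)"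
proof -
  obtain \<psi> where \<psi>: "continuous_on UNIV \<psi>" "\<psi> 0 = 0" "\<And>y. ch 1 y = exp (\<psi> y)"
    by (rule exponent_exists) auto
  define \<mu> where "\<mu> t = integral_law M Y h (\<lambda>u. t * u)" for t
  have r: "time_scale (\<lambda>u. t * u)" if "0 < t" for t
    using that by unfold_locales (auto intro!: continuous_intros strict_mono_onI)
  interpret convolution_semigroup \<mu> "mixed_exponent h \<psi>"
  proof
    show "borel_prob (\<mu> t)" if "0 < t" for t
      unfolding \<mu>_def by (rule borel_prob_integral_law[OF h r[OF that]])
    show "chf (\<mu> t) y = exp (of_real t * mixed_exponent h \<psi> y)" if "0 < t" for t y
      unfolding \<mu>_def by (rule chf_path_integral[OF h that \<psi>])
  qed
  \<comment> \<open>Otherwise there are times \<open>t n\<close> tending to 0 whose laws keep mass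
    above 1/3 outside the ball. But \<open>Y\<close> tends to 0 at time 0, so by
    \<open>norm_path_integral_le\<close> the integrals are eventually within \<epsilon> along each
    path, and dominated convergence sends these masses to 0.\<close>
  have "\<exists>d>0. \<forall>t. 0 < t \<and> t \<le> d \<longrightarrow> measure (\<mu> t) {x. \<epsilon> < norm x} \<le> 1 / 3" if \<epsilon>: "0 < \<epsilon>" for \<epsilon>
  proof (rule ccontr)
    assume "\<not> ?thesis"
    then have "\<exists>t. 0 < t \<and> t \<le> 1 / real (Suc n) \<and> 1 / 3 < measure (\<mu> t) {x. \<epsilon> < norm x}" for n
      by (metis not_le of_nat_0_less_iff zero_less_Suc zero_less_divide_1_iff)
    then obtain t where t: "\<And>n. 0 < t n" "\<And>n. t n \<le> 1 / real (Suc n)"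
      "\<And>n. 1 / 3 < measure (\<mu> (t n)) {x. \<epsilon> < norm x}" by metis
    define I where "I n \<omega> = path_integral h (\<lambda>u. t n * u) (\<lambda>s. Y s \<omega>)" for n \<omega>
    have [measurable]: "I n \<in> borel_measurable M" for n
      unfolding I_def by (rule measurable_path_integral[OF h r[OF t(1)]])
    have "(\<lambda>n. \<integral>\<omega>. indicator {\<omega>. \<epsilon> < norm (I n \<omega>)} \<omega> \<partial>M) \<longlonglongrightarrow> (\<integral>\<omega>. (0::real) \<partial>M)"
    proof (rule integral_dominated_convergence[where w="\<lambda>_. 1"])
      show "AE \<omega> in M. (\<lambda>n. indicator {\<omega>. \<epsilon> < norm (I n \<omega>)} \<omega>) \<longlonglongrightarrow> (0::real)"
      proof (rule AE_I2)
        fix \<omega> assume \<omega>: "\<omega> \<in> space M"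
        define C where "C = max \<bar>h 0\<bar> \<bar>h 1\<bar> + 1"
        have C: "0 < C" "\<bar>h 0\<bar> \<le> C" "\<bar>h 1\<bar> \<le> C" by (auto simp: C_def)
        have "((\<lambda>s. Y s \<omega>) \<longlongrightarrow> 0) (at_right 0)"
          using cadlag_paths[OF \<omega>] start_zero[OF \<omega>] by (auto simp: cadlag_def dest: spec[of _ 0])
        then have "eventually (\<lambda>s. norm (Y s \<omega>) < \<epsilon> / (4 * C)) (at_right 0)"
          using tendstoD[of "\<lambda>s. Y s \<omega>" 0 "at_right 0" "\<epsilon> / (4 * C)"] \<epsilon> C by simp
        then obtain d where d: "0 < d" "\<And>s. 0 < s \<Longrightarrow> s < d \<Longrightarrow> norm (Y s \<omega>) < \<epsilon> / (4 * C)"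
          unfolding eventually_at_right_field by auto
        have "(\<lambda>n. 1 / real (Suc n)) \<longlonglongrightarrow> 0"
          using LIMSEQ_inverse_real_of_nat by (simp add: inverse_eq_divide)
        then have "eventually (\<lambda>n. 1 / real (Suc n) < d) sequentially"
          using d(1) by (rule order_tendstoD(2))
        then have "eventually (\<lambda>n. indicator {\<omega>. \<epsilon> < norm (I n \<omega>)} \<omega> = (0::real)) sequentially"
        proof eventually_elim
          case (elim n)
          have K: "norm (Y s \<omega>) \<le> \<epsilon> / (4 * C)" if "s \<in> {t n * 0..t n * 1}" for s
          proof (cases "s = 0")
            case True
            then show ?thesis using \<epsilon> C start_zero[OF \<omega>] by simp
          next
            case False
            then show ?thesis using that d(2)[of s] t(2)[of n] elim by simp
          qed
          have "norm (I n \<omega>) \<le> 4 * C * (\<epsilon> / (4 * C))"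
            unfolding I_def
            by (rule norm_path_integral_le[OF h r[OF t(1)] cadlag_paths[OF \<omega>] C(2,3) K])
          then show ?case using C by simp
        qed
        then show "(\<lambda>n. indicator {\<omega>. \<epsilon> < norm (I n \<omega>)} \<omega>) \<longlonglongrightarrow> (0::real)"
          by (rule tendsto_eventually)
      qed
    qed (auto simp: indicator_def)
    moreover have "(\<integral>\<omega>. indicator {\<omega>. \<epsilon> < norm (I n \<omega>)} \<omega> \<partial>M) = measure (\<mu> (t n)) {x. \<epsilon> < norm x}" for n
    proof -
      have "measure (\<mu> (t n)) {x. \<epsilon> < norm x} = prob {\<omega> \<in> space M. \<epsilon> < norm (I n \<omega>)}"
        unfolding \<mu>_def integral_law_def I_def[symmetric]
        by (subst measure_distr) (auto intro!: arg_cong[where f=prob])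
      also have "\<dots> = (\<integral>\<omega>. indicator {\<omega>. \<epsilon> < norm (I n \<omega>)} \<omega> \<partial>M)"
        by (simp add: Collect_conj_eq Int_commute)
      finally show ?thesis by simp
    qed
    ultimately have "(\<lambda>n. measure (\<mu> (t n)) {x. \<epsilon> < norm x}) \<longlonglongrightarrow> 0" by simp
    then have "eventually (\<lambda>n. measure (\<mu> (t n)) {x. \<epsilon> < norm x} < 1 / 3) sequentially"
      by (rule order_tendstoD(2)) simp
    then obtain n where "measure (\<mu> (t n)) {x. \<epsilon> < norm x} < 1 / 3"
      by (auto simp: eventually_sequentially)
    then show False using t(3)[of n] by simp
  qed
  from levy_process_exists[OF this] show ?thesis by (simp add: \<mu>_def)
qed

text \<open>With integrand \<open>1\<close> the existence theorem yields a version of \<open>Y\<close> itself on path space.\<close>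

lemma integral_law_const:
  assumes "levy_process M Y"
  shows "integral_law M Y (\<lambda>_. 1) (\<lambda>u. u) = distr M borel (Y 1)"
proof -
  have "clamped (\<lambda>_. 1) = (\<lambda>_. 0)" by (simp add: clamped_def fun_eq_iff)
  then have "stieltjes_integral (\<lambda>_. 1) f = 0" for f :: "real \<Rightarrow> 'b"
    by (subst stieltjes_integral_mono) (simp_all add: mono_on_def LINT_null_interval)
  then show ?thesis
    unfolding integral_law_def path_integral_def
    by (intro distr_cong) (simp_all add: levy_process.start_zero[OF assms])
qed

text \<open>\<open>Y\<close> may live on any sample type, whereas the description in
  \<open>J_map\<close> ranges over one type only. A version of \<open>Y\<close> there, got from the
  integrand 1, shows that it is inhabited; \<open>integral_law_cong_law\<close> gives both the value
  and the uniqueness.\<close>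

lemma J_map_eq:
  assumes "levy_process M Y" "distr M borel (Y 1) = \<nu>" "0 < \<beta>"
  shows "J_map \<beta> \<nu> = integral_law M Y (\<lambda>t. t powr (1 / \<beta>)) (\<lambda>t. t)"
proof -
  have h: "mono_on {0..1} (\<lambda>t. t powr (1 / \<beta>))" "continuous_on {0..1} (\<lambda>t. t powr (1 / \<beta>))"
    using assms(3) by (auto intro!: mono_onI powr_mono2 continuous_on_powr' continuous_on_id continuous_on_const)
  obtain N :: "(real \<Rightarrow> 'b) measure" and Z where N: "levy_process N Z" "distr N borel (Z 1) = \<nu>"
    using levy_process.levy_process_integral_law_exists[OF assms(1), of "\<lambda>_. 1"] assms(2)
    by (auto simp: mono_on_def integral_law_const[OF assms(1)])
  show ?thesis
    unfolding J_map_def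
  proof (rule the_equality)
    show "\<exists>(N :: (real \<Rightarrow> 'b) measure) Z. levy_process N Z \<and> distr N borel (Z 1) = \<nu> \<and>
        integral_law M Y (\<lambda>t. t powr (1 / \<beta>)) (\<lambda>t. t) = integral_law N Z (\<lambda>t. t powr (1 / \<beta>)) (\<lambda>t. t)"
      using N integral_law_cong_law[OF assms(1) N(1) _ h] assms(2) by auto
  next
    fix \<mu> assume "\<exists>(N :: (real \<Rightarrow> 'b) measure) Z. levy_process N Z \<and> distr N borel (Z 1) = \<nu> \<and>
        \<mu> = integral_law N Z (\<lambda>t. t powr (1 / \<beta>)) (\<lambda>t. t)"
    then show "\<mu> = integral_law M Y (\<lambda>t. t powr (1 / \<beta>)) (\<lambda>t. t)"
      using integral_law_cong_law[OF _ assms(1) _ h] assms(2) by auto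
  qed
qed

section \<open>The time change\<close>

lemma time_change_sym: "\<alpha> \<noteq> \<beta> \<Longrightarrow> time_change \<alpha> \<beta> u = time_change \<beta> \<alpha> u"
  unfolding time_change_def by (simp add: divide_simps) (simp add: algebra_simps)

section \<open>Powers and the uniform distribution on the unit interval\<close>

lemma continuous_on_powr_unit: "0 < a \<Longrightarrow> continuous_on {0..1} (\<lambda>u::real. u powr a)"
  by (intro continuous_on_powr' continuous_on_id continuous_on_const) auto

lemma mono_on_powr_unit: "0 < a \<Longrightarrow> mono_on {0..1} (\<lambda>u::real. u powr a)"
  by (auto intro!: mono_onI powr_mono2)

text \<open>The uniform distribution. Writing \<open>mixed_exponent\<close> as an expectation under
  it gives access to Fubini and to image measures.\<close>

definition unit :: "real measure" where
  "unit = restrict_space lborel {0..1}"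

lemma space_unit [simp]: "space unit = {0..1}"
  by (simp add: unit_def space_restrict_space)

lemma sets_unit [measurable_cong]: "sets unit = sets (restrict_space borel {0..1})"
  unfolding unit_def by (rule sets_restrict_space_cong) simp

lemma prob_space_unit: "prob_space unit"
  by (rule prob_spaceI) (simp add: unit_def space_restrict_space emeasure_restrict_space)

lemma continuous_measurable_unit:
  "continuous_on {0..1} f \<Longrightarrow> f \<in> borel_measurable unit"
  using borel_measurable_continuous_on_restrict[of "{0..1}" f] by (simp cong: measurable_cong_sets add: sets_unit)

lemma measure_unit_atMost: "0 \<le> w \<Longrightarrow> w \<le> 1 \<Longrightarrow> measure unit {t \<in> {0..1}. t \<le> w} = w"
proof -
  assume w: "0 \<le> w" "w \<le> 1"
  then have "{t \<in> {0..1}. t \<le> w} = {0..w}" by auto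
  then show ?thesis using w by (simp add: unit_def measure_restrict_space)
qed

lemma measure_unit_powr:
  assumes "0 \<le> c" "0 < b"
  shows "measure unit {t \<in> {0..1}. t powr (1 / b) \<le> c} = min 1 (c powr b)"
proof -
  have "t powr (1 / b) \<le> c \<longleftrightarrow> t \<le> c powr b" if "0 \<le> t" for t
  proof
    assume "t powr (1 / b) \<le> c"
    then have "(t powr (1 / b)) powr b \<le> c powr b" using assms by (intro powr_mono2) auto
    then show "t \<le> c powr b" using assms that by (simp add: powr_powr)
  next
    assume "t \<le> c powr b"
    then have "t powr (1 / b) \<le> (c powr b) powr (1 / b)" using assms that by (intro powr_mono2) auto
    then show "t powr (1 / b) \<le> c" using assms by (simp add: powr_powr)
  qed
  then have eq: "{t \<in> {0..1}. t powr (1 / b) \<le> c} = {t \<in> {0..1}. t \<le> min 1 (c powr b)}" by auto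
  show ?thesis unfolding eq by (rule measure_unit_atMost) auto
qed

lemma mixed_exponent_unit: "mixed_exponent h \<psi> y = (LINT u|unit. \<psi> (h u *\<^sub>R y))"
  unfolding mixed_exponent_def unit_def set_lebesgue_integral_def
  by (subst integral_restrict_space) auto

lemma AE_unit_nonzero: "AE u in unit. u \<noteq> 0"
  unfolding unit_def using AE_lborel_singleton[of "0::real"] by (subst AE_restrict_space_iff) auto

text \<open>The mapping is iterated, so the exponent of the second process must again be continuous,
  as \<open>ch_exponent\<close> requires. Dominated convergence applies because \<open>h\<close> is
  bounded and \<open>\<psi>\<close> is bounded on balls.\<close>

lemma continuous_mixed_exponent:
  fixes \<psi> :: "'a::euclidean_space \<Rightarrow> complex"
  assumes \<psi>: "continuous_on UNIV \<psi>" and h: "continuous_on {0..1} h"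
  shows "continuous_on UNIV (mixed_exponent h \<psi>)"
proof -
  interpret prob_space unit by (rule prob_space_unit)
  obtain C where C: "\<And>u. u \<in> {0..1} \<Longrightarrow> norm (h u) \<le> C"
    using compact_imp_bounded[OF compact_continuous_image[OF h compact_Icc]] unfolding bounded_iff by blast
  have C0: "0 \<le> C" using order_trans[OF norm_ge_zero C[of 0]] by simp
  have meas: "(\<lambda>u. \<psi> (h u *\<^sub>R y)) \<in> borel_measurable unit" for y
    by (intro continuous_measurable_unit continuous_on_compose2[OF \<psi>] continuous_intros h) auto
  have "isCont (mixed_exponent h \<psi>) y" for y
    unfolding continuous_at_sequentially comp_def
  proof (intro allI impI)
    fix z :: "nat \<Rightarrow> 'a" assume z: "z \<longlonglongrightarrow> y"
    then have "Bseq z" by (intro convergent_imp_Bseq convergentI)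
    then obtain R where R: "\<And>n. norm (z n) \<le> R" by (auto simp: Bseq_def)
    have "compact (\<psi> ` cball 0 (C * R))"
      by (intro compact_continuous_image continuous_on_subset[OF \<psi>]) auto
    then obtain K where K: "\<And>x. x \<in> cball 0 (C * R) \<Longrightarrow> norm (\<psi> x) \<le> K"
      using compact_imp_bounded[of "\<psi> ` cball 0 (C * R)"] unfolding bounded_iff by blast
    show "(\<lambda>n. mixed_exponent h \<psi> (z n)) \<longlonglongrightarrow> mixed_exponent h \<psi> y"
      unfolding mixed_exponent_unit
    proof (rule integral_dominated_convergence[where w="\<lambda>_. K"])
      show "AE u in unit. (\<lambda>n. \<psi> (h u *\<^sub>R z n)) \<longlonglongrightarrow> \<psi> (h u *\<^sub>R y)"
        by (intro AE_I2 continuous_on_tendsto_compose[OF \<psi>] tendsto_scaleR tendsto_const z) auto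
      show "AE u in unit. norm (\<psi> (h u *\<^sub>R z n)) \<le> K" for n
      proof (intro AE_I2 K)
        fix u assume "u \<in> space unit"
        then show "h u *\<^sub>R z n \<in> cball 0 (C * R)"
          using mult_mono[OF C R C0] by simp
      qed
    qed (simp_all add: meas)
  qed
  then show ?thesis by (simp add: continuous_at_imp_continuous_on)
qed

locale two_exponents =
  fixes \<alpha> \<beta> :: real
  assumes pos: "0 < \<alpha>" "0 < \<beta>" and neq: "\<alpha> \<noteq> \<beta>"
begin

abbreviation r :: "real \<Rightarrow> real" where
  "r \<equiv> time_change \<alpha> \<beta>"

lemma r_0: "r 0 = 0"
  by (simp add: time_change_def)

lemma r_1: "r 1 = 1"
  using neq by (simp add: time_change_def diff_divide_distrib[symmetric])

lemma continuous_r: "continuous_on {0..1} r"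
  unfolding time_change_def using pos by (intro continuous_intros continuous_on_powr_unit)

text \<open>For exponents \<open>a < b\<close> the derivative is a positive multiple of
  \<open>x powr (a - 1) - x powr (b - 1)\<close>, which is positive inside the unit interval. It may
  fail to exist at 0, hence the criterion with continuity at the ends; symmetry covers the other
  order.\<close>

lemma strict_mono_r: "strict_mono_on {0..1} r"
proof -
  have main: "time_change a b u < time_change a b v"
    if ab: "0 < a" "a < b" and uv: "0 \<le> u" "u < v" "v \<le> 1" for a b u v :: real
  proof (rule DERIV_pos_imp_increasing_open[OF uv(2)])
    show "continuous_on {u..v} (time_change a b)"
      unfolding time_change_def using uv ab
      by (intro continuous_intros continuous_on_subset[OF continuous_on_powr_unit]) auto
    fix x assume x: "u < x" "x < v"
    then have x01: "0 < x" "x < 1" using uv by auto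
    have "(time_change a b has_real_derivative
        b / (b - a) * (a * x powr (a - 1)) - a / (b - a) * (b * x powr (b - 1))) (at x)"
      unfolding time_change_def using x01 ab by (auto intro!: derivative_eq_intros simp: mult_ac)
    moreover have "b / (b - a) * (a * x powr (a - 1)) - a / (b - a) * (b * x powr (b - 1)) =
        a * b / (b - a) * (x powr (a - 1) - x powr (b - 1))"
      by (simp add: right_diff_distrib diff_divide_distrib mult_ac)
    moreover have "x powr (b - 1) < x powr (a - 1)"
      using powr_less_mono'[of x "a - 1" "b - 1"] x01 ab by simp
    then have "0 < a * b / (b - a) * (x powr (a - 1) - x powr (b - 1))"
      using ab by (intro mult_pos_pos divide_pos_pos) auto
    ultimately show "\<exists>y. (time_change a b has_real_derivative y) (at x) \<and> 0 < y" by metis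
  qed
  show ?thesis
  proof (rule strict_mono_onI)
    fix u v :: real assume "u \<in> {0..1}" "v \<in> {0..1}" "u < v"
    then show "r u < r v"
      using main[of \<alpha> \<beta> u v] main[of \<beta> \<alpha> u v] pos neq time_change_sym[OF neq]
      by (cases "\<alpha> < \<beta>") auto
  qed
qed

lemma bij_r: "bij_betw r {0..1} {0..1}"
proof -
  have "r u \<in> {0..1}" if "u \<in> {0..1}" for u
    using strict_mono_on_leD[OF strict_mono_r, of 0 u] strict_mono_on_leD[OF strict_mono_r, of u 1] that r_0 r_1
    by simp
  moreover have "\<exists>u\<in>{0..1}. r u = v" if "v \<in> {0..1}" for v
    using IVT'[of r 0 v 1] continuous_r that r_0 r_1 by auto
  ultimately show ?thesis
    unfolding bij_betw_def using strict_mono_on_imp_inj_on[OF strict_mono_r] by blast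
qed

definition g :: "real \<Rightarrow> real" where
  "g = the_inv_into {0..1} r"

lemma r_g: "u \<in> {0..1} \<Longrightarrow> r (g u) = u"
  unfolding g_def using bij_r by (simp add: f_the_inv_into_f_bij_betw)

lemma g_r: "u \<in> {0..1} \<Longrightarrow> g (r u) = u"
  unfolding g_def using bij_r by (simp add: the_inv_into_f_f bij_betw_def)

lemma g_range: "u \<in> {0..1} \<Longrightarrow> g u \<in> {0..1}"
  unfolding g_def using bij_betw_the_inv_into[OF bij_r] by (auto simp: bij_betw_def)

lemma g_le_iff: "u \<in> {0..1} \<Longrightarrow> v \<in> {0..1} \<Longrightarrow> g u \<le> v \<longleftrightarrow> u \<le> r v"
  using strict_mono_on_less_eq[OF strict_mono_r, of "g u" v] g_range r_g by simp

lemma continuous_g: "continuous_on {0..1} g"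
proof -
  have "continuous_on (r ` {0..1}) g"
    by (rule continuous_on_inv[OF continuous_r]) (auto simp: g_r)
  then show ?thesis using bij_r by (simp add: bij_betw_def)
qed

lemma strict_mono_g: "strict_mono_on {0..1} g"
proof (rule strict_mono_onI)
  fix u v :: real assume uv: "u \<in> {0..1}" "v \<in> {0..1}" "u < v"
  then show "g u < g v"
    using g_le_iff[OF uv(2) g_range[OF uv(1)]] r_g[OF uv(1)] by simp
qed

lemma g_0: "g 0 = 0" and g_1: "g 1 = 1"
  using g_r[of 0] g_r[of 1] by (simp_all add: r_0 r_1)

definition pair_law :: "real measure" where
  "pair_law = distr (unit \<Otimes>\<^sub>M unit) borel (\<lambda>(s, t). s powr (1 / \<alpha>) * t powr (1 / \<beta>))"

definition inverse_law :: "real measure" where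
  "inverse_law = distr unit borel g"

text \<open>For \<open>s > 0\<close> the integrand is the probability that a uniform
  \<open>t\<close> satisfies \<open>t powr (1 / \<beta>) \<le> v / s powr (1 / \<alpha>)\<close>. It
  is \<open>1\<close> up to \<open>s = v powr \<alpha>\<close> and a multiple of a power of
  \<open>s\<close> beyond, so the integral is elementary.\<close>

lemma integral_min_powr:
  assumes v: "0 \<le> v" "v \<le> 1"
  shows "(LINT s|unit. min 1 ((v / s powr (1 / \<alpha>)) powr \<beta>)) = r v"
proof (cases "v = 0")
  case True
  then show ?thesis by (simp add: r_0)
next
  case False
  then have v0: "0 < v" using v by simp
  \<comment> \<open>Here \<open>a\<close> is the point where the cap \<open>1\<close> ceases to act
    and \<open>P\<close> is an antiderivative of the remaining power;
    \<open>\<alpha> \<noteq> \<beta>\<close> gives \<open>\<gamma> + 1 \<noteq> 0\<close>, so no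
    logarithm arises.\<close>
  define a where "a = v powr \<alpha>"
  define \<gamma> where "\<gamma> = - (\<beta> / \<alpha>)"
  define P where "P s = v powr \<beta> / (\<gamma> + 1) * s powr (\<gamma> + 1)" for s
  have a: "0 < a" "a \<le> 1" using v v0 pos powr_mono2[of \<alpha> v 1] by (auto simp: a_def)
  have \<gamma>: "\<gamma> + 1 = (\<alpha> - \<beta>) / \<alpha>" "\<gamma> + 1 \<noteq> 0" using pos neq by (simp_all add: \<gamma>_def field_simps)
  have f: "min 1 ((v / s powr (1 / \<alpha>)) powr \<beta>) = (if s \<le> a then 1 else v powr \<beta> * s powr \<gamma>)" if s: "0 < s" for s
  proof -
    have eq: "(v / s powr (1 / \<alpha>)) powr \<beta> = v powr \<beta> * s powr \<gamma>"
      using s v by (simp add: powr_divide powr_powr \<gamma>_def powr_minus_divide)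
    have sa: "(s powr (1 / \<alpha>)) powr \<alpha> = s" using s pos by (simp add: powr_powr)
    show ?thesis
    proof (cases "s \<le> a")
      case True
      have "s powr (1 / \<alpha>) \<le> (v powr \<alpha>) powr (1 / \<alpha>)"
        using True s pos by (intro powr_mono2) (auto simp: a_def)
      then have "s powr (1 / \<alpha>) \<le> v" using v pos by (simp add: powr_powr)
      then have "1 \<le> v / s powr (1 / \<alpha>)" using s by simp
      then have "1 powr \<beta> \<le> (v / s powr (1 / \<alpha>)) powr \<beta>" using pos by (intro powr_mono2) auto
      then show ?thesis using True by simp
    next
      case False
      have "v \<le> s powr (1 / \<alpha>)"
      proof (rule ccontr)
        assume "\<not> ?thesis"
        then have "(s powr (1 / \<alpha>)) powr \<alpha> \<le> v powr \<alpha>" using pos by (intro powr_mono2) auto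
        then show False using False sa by (simp add: a_def)
      qed
      then have "v / s powr (1 / \<alpha>) \<le> 1" using s by simp
      then have "(v / s powr (1 / \<alpha>)) powr \<beta> \<le> 1 powr \<beta>" using pos v by (intro powr_mono2) auto
      then show ?thesis using False eq by simp
    qed
  qed
  have int1: "integrable lborel (indicator {0..a} :: real \<Rightarrow> real)"
    using a by (intro integrable_real_indicator) auto
  have deriv: "(P has_real_derivative v powr \<beta> * s powr \<gamma>) (at s)" if "a \<le> s" "s \<le> 1" for s
    unfolding P_def using that a \<gamma>(2) by (auto intro!: derivative_eq_intros)
  have cont: "isCont (\<lambda>s. v powr \<beta> * s powr \<gamma>) s" if "a \<le> s" "s \<le> 1" for s
    using that a by (intro continuous_intros) auto
  have int2: "integrable lborel (\<lambda>s. v powr \<beta> * s powr \<gamma> * indicator {a..1} s)"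
    by (rule borel_integrable_atLeastAtMost[OF cont])
  have "(LINT s|unit. min 1 ((v / s powr (1 / \<alpha>)) powr \<beta>)) =
      (LINT s|lborel. indicator {0..1} s *\<^sub>R min 1 ((v / s powr (1 / \<alpha>)) powr \<beta>))"
    unfolding unit_def by (subst integral_restrict_space) (auto simp: set_lebesgue_integral_def)
  also have "\<dots> = (LINT s|lborel. indicator {0..a} s + v powr \<beta> * s powr \<gamma> * indicator {a..1} s)"
  proof (rule integral_cong_AE)
    \<comment> \<open>Two points are excepted: at \<open>s = 0\<close> division by zero turns the
      left side into \<open>0\<close>, and at \<open>s = a\<close> both indicators on the right
      count.\<close>
    show "AE s in lborel. indicator {0..1} s *\<^sub>R min 1 ((v / s powr (1 / \<alpha>)) powr \<beta>) =
        indicator {0..a} s + v powr \<beta> * s powr \<gamma> * indicator {a..1} s"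
      using AE_lborel_singleton[of "0::real"] AE_lborel_singleton[of a]
    proof eventually_elim
      case (elim s)
      then show ?case using f[of s] a by (auto simp: indicator_def)
    qed
  qed measurable
  also have "\<dots> = (LINT s|lborel. indicator {0..a} s) + (LINT s|lborel. v powr \<beta> * s powr \<gamma> * indicator {a..1} s)"
    by (rule Bochner_Integration.integral_add[OF int1 int2])
  also have "(LINT s|lborel. indicator {0..a} s) = a"
    using a by simp
  also have "(LINT s|lborel. v powr \<beta> * s powr \<gamma> * indicator {a..1} s) = P 1 - P a"
    by (rule integral_FTC_Icc_real[OF a(2) deriv cont])
  also have "a + (P 1 - P a) = r v"
  proof -
    have "v powr \<beta> * a powr (\<gamma> + 1) = v powr \<alpha>"
      using v0 pos by (simp add: a_def powr_powr \<gamma>(1) powr_add[symmetric])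
    then have "P a = v powr \<alpha> / (\<gamma> + 1)" by (simp add: P_def)
    moreover have "P 1 = v powr \<beta> / (\<gamma> + 1)" by (simp add: P_def)
    ultimately show ?thesis
      unfolding \<gamma>(1) time_change_def a_def using pos neq by (simp add: divide_simps) (simp add: algebra_simps)
  qed
  finally show ?thesis .
qed

lemma measurable_product:
  "(\<lambda>(s, t). s powr (1 / \<alpha>) * t powr (1 / \<beta>)) \<in> borel_measurable (unit \<Otimes>\<^sub>M unit)"
proof -
  have [measurable]: "(\<lambda>s. s powr (1 / \<alpha>)) \<in> borel_measurable unit" "(\<lambda>t. t powr (1 / \<beta>)) \<in> borel_measurable unit"
    using pos by (auto intro!: continuous_measurable_unit continuous_on_powr_unit)
  show ?thesis by measurable
qed

lemma product_range:
  assumes "s \<in> {0..1}" "t \<in> {0..1}"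
  shows "s powr (1 / \<alpha>) * t powr (1 / \<beta>) \<in> {0..1}"
proof -
  have "s powr (1 / \<alpha>) \<le> 1" "t powr (1 / \<beta>) \<le> 1"
    using powr_mono2[of "1 / \<alpha>" s 1] powr_mono2[of "1 / \<beta>" t 1] assms pos by auto
  then show ?thesis by (auto intro: mult_le_one)
qed

lemma prob_space_pair_unit: "prob_space (unit \<Otimes>\<^sub>M unit)"
proof -
  interpret prob_space unit by (rule prob_space_unit)
  interpret pair_prob_space unit unit ..
  show ?thesis by (rule P.prob_space_axioms)
qed

lemma g_measurable: "g \<in> borel_measurable unit"
  by (rule continuous_measurable_unit[OF continuous_g])

lemma real_distribution_pair_law: "real_distribution pair_law"
  unfolding pair_law_def using measurable_product
  by (intro prob_space.real_distribution_distr prob_space_pair_unit) simp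

lemma real_distribution_inverse_law: "real_distribution inverse_law"
  unfolding inverse_law_def by (intro prob_space.real_distribution_distr prob_space_unit g_measurable)

lemma cdf_inverse_law:
  assumes "v \<in> {0..1}"
  shows "cdf inverse_law v = r v"
proof -
  have "cdf inverse_law v = measure unit (g -` {..v} \<inter> space unit)"
    unfolding cdf_def inverse_law_def by (rule measure_distr[OF g_measurable]) simp
  also have "g -` {..v} \<inter> space unit = {t \<in> {0..1}. t \<le> r v}"
    using assms g_le_iff by auto
  also have "measure unit \<dots> = r v"
    using assms bij_r by (intro measure_unit_atMost) (auto simp: bij_betw_def)
  finally show ?thesis .
qed

text \<open>For fixed \<open>s > 0\<close> the slice of the event is the one measured by
  \<open>measure_unit_powr\<close>, and integrating over \<open>s\<close> is
  \<open>integral_min_powr\<close>.\<close>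

lemma cdf_pair_law:
  assumes v: "v \<in> {0..1}"
  shows "cdf pair_law v = r v"
proof -
  interpret prob_space unit by (rule prob_space_unit)
  interpret P: prob_space "unit \<Otimes>\<^sub>M unit" by (rule prob_space_pair_unit)
  let ?A = "(\<lambda>(s, t). s powr (1 / \<alpha>) * t powr (1 / \<beta>)) -` {..v} \<inter> space (unit \<Otimes>\<^sub>M unit)"
  let ?f = "\<lambda>s. min 1 ((v / s powr (1 / \<alpha>)) powr \<beta>)"
  have A: "?A \<in> sets (unit \<Otimes>\<^sub>M unit)" by (rule measurable_sets[OF measurable_product]) simp
  have [measurable]: "(\<lambda>s. s powr (1 / \<alpha>)) \<in> borel_measurable unit"
    using pos by (auto intro!: continuous_measurable_unit continuous_on_powr_unit)
  have fm: "?f \<in> borel_measurable unit" by measurable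
  have "emeasure (unit \<Otimes>\<^sub>M unit) ?A = (\<integral>\<^sup>+s. emeasure unit (Pair s -` ?A) \<partial>unit)"
    by (rule emeasure_pair_measure_alt[OF A])
  also have "\<dots> = (\<integral>\<^sup>+s. ennreal (?f s) \<partial>unit)"
  proof (rule nn_integral_cong_AE)
    show "AE s in unit. emeasure unit (Pair s -` ?A) = ennreal (?f s)"
      using AE_unit_nonzero AE_space
    proof eventually_elim
      case (elim s)
      then have s: "0 < s" "s \<le> 1" by auto
      have "Pair s -` ?A = {t \<in> {0..1}. t powr (1 / \<beta>) \<le> v / s powr (1 / \<alpha>)}"
        using s by (auto simp: space_pair_measure field_simps)
      then have "measure unit (Pair s -` ?A) = ?f s"
        using measure_unit_powr[of "v / s powr (1 / \<alpha>)" \<beta>] v pos by simp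
      then show ?case by (simp add: emeasure_eq_measure)
    qed
  qed
  also have "\<dots> = ennreal (LINT s|unit. ?f s)"
    by (intro nn_integral_eq_integral integrable_const_bound[of _ 1] fm) auto
  also have "(LINT s|unit. ?f s) = r v" using v by (intro integral_min_powr) auto
  finally have "measure (unit \<Otimes>\<^sub>M unit) ?A = r v"
    using bij_betwE[OF bij_r] v by (simp add: measure_def)
  then show ?thesis
    unfolding cdf_def pair_law_def by (subst measure_distr[OF measurable_product]) auto
qed

lemma pair_law_eq_inverse_law: "pair_law = inverse_law"
proof (rule cdf_unique[OF real_distribution_pair_law real_distribution_inverse_law])
  interpret U: prob_space unit by (rule prob_space_unit)
  interpret P: prob_space "unit \<Otimes>\<^sub>M unit" by (rule prob_space_pair_unit)
  have pair: "cdf pair_law v = P.prob ((\<lambda>(s, t). s powr (1 / \<alpha>) * t powr (1 / \<beta>)) -` {..v} \<inter> space (unit \<Otimes>\<^sub>M unit))" for v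
    unfolding cdf_def pair_law_def by (rule measure_distr[OF measurable_product]) simp
  have inv: "cdf inverse_law v = U.prob (g -` {..v} \<inter> space unit)" for v
    unfolding cdf_def inverse_law_def by (rule measure_distr[OF g_measurable]) simp
  show "cdf pair_law = cdf inverse_law"
  proof
    fix v :: real
    consider "v < 0" | "v \<in> {0..1}" | "1 < v" by fastforce
    then show "cdf pair_law v = cdf inverse_law v"
    proof cases
      case 1
      have "v < s powr (1 / \<alpha>) * t powr (1 / \<beta>)" for s t
        using 1 by (rule less_le_trans) simp
      then have e: "(\<lambda>(s, t). s powr (1 / \<alpha>) * t powr (1 / \<beta>)) -` {..v} \<inter> space (unit \<Otimes>\<^sub>M unit) = {}"
        by (auto dest: leD)
      have "g -` {..v} \<inter> space unit = {}" using 1 g_range by fastforce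
      then show ?thesis unfolding pair inv e by simp
    next
      case 2
      then show ?thesis by (simp add: cdf_pair_law cdf_inverse_law)
    next
      case 3
      have "s powr (1 / \<alpha>) * t powr (1 / \<beta>) \<le> v" if "s \<in> {0..1}" "t \<in> {0..1}" for s t
        using product_range[OF that] 3 by simp
      then have e: "(\<lambda>(s, t). s powr (1 / \<alpha>) * t powr (1 / \<beta>)) -` {..v} \<inter> space (unit \<Otimes>\<^sub>M unit) = space (unit \<Otimes>\<^sub>M unit)"
        by (auto simp: space_pair_measure)
      have "g -` {..v} \<inter> space unit = space unit" using 3 g_range by fastforce
      then show ?thesis unfolding pair inv e using U.prob_space P.prob_space by simp
    qed
  qed
qed

text \<open>The two scalings of \<open>y\<close> multiply, so by Fubini the iterated exponent is the
  mean of \<open>\<psi> (v *\<^sub>R y)\<close> for \<open>v\<close> distributed by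
  \<open>pair_law\<close>, which is also the law of \<open>g\<close> at a uniform point.\<close>

lemma mixed_exponent_comp:
  fixes \<psi> :: "'a::euclidean_space \<Rightarrow> complex"
  assumes \<psi>: "continuous_on UNIV \<psi>"
  shows "mixed_exponent (\<lambda>s. s powr (1 / \<alpha>)) (mixed_exponent (\<lambda>t. t powr (1 / \<beta>)) \<psi>) y = mixed_exponent g \<psi> y"
proof -
  interpret U: prob_space unit by (rule prob_space_unit)
  interpret pair_prob_space unit unit ..
  define F where "F v = \<psi> (v *\<^sub>R y)" for v :: real
  have Fc: "continuous_on UNIV F"
    unfolding F_def by (intro continuous_on_compose2[OF \<psi>] continuous_intros) auto
  have Fm: "F \<in> borel_measurable borel" by (rule borel_measurable_continuous_onI[OF Fc])
  have "compact (F ` {0..1})" by (intro compact_continuous_image continuous_on_subset[OF Fc]) auto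
  then obtain K where K: "\<And>v. v \<in> {0..1} \<Longrightarrow> norm (F v) \<le> K"
    using compact_imp_bounded[of "F ` {0..1}"] unfolding bounded_iff by blast
  have "mixed_exponent (\<lambda>s. s powr (1 / \<alpha>)) (mixed_exponent (\<lambda>t. t powr (1 / \<beta>)) \<psi>) y =
      (LINT s|unit. LINT t|unit. F (s powr (1 / \<alpha>) * t powr (1 / \<beta>)))"
    unfolding mixed_exponent_unit F_def by (simp add: mult.commute)
  also have "\<dots> = (LINT p|(unit \<Otimes>\<^sub>M unit). F (case p of (s, t) \<Rightarrow> s powr (1 / \<alpha>) * t powr (1 / \<beta>)))"
  proof -
    have "integrable (unit \<Otimes>\<^sub>M unit) (\<lambda>p. F (case p of (s, t) \<Rightarrow> s powr (1 / \<alpha>) * t powr (1 / \<beta>)))"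
    proof (rule P.integrable_const_bound[of _ K])
      show "AE p in (unit \<Otimes>\<^sub>M unit). norm (F (case p of (s, t) \<Rightarrow> s powr (1 / \<alpha>) * t powr (1 / \<beta>))) \<le> K"
        by (rule AE_I2) (use K product_range in \<open>auto simp: space_pair_measure\<close>)
      show "(\<lambda>p. F (case p of (s, t) \<Rightarrow> s powr (1 / \<alpha>) * t powr (1 / \<beta>))) \<in> borel_measurable (unit \<Otimes>\<^sub>M unit)"
        by (rule measurable_compose[OF measurable_product Fm])
    qed
    from integral_fst'[OF this] show ?thesis by simp
  qed
  also have "\<dots> = (LINT v|pair_law. F v)"
    unfolding pair_law_def by (rule integral_distr[OF measurable_product Fm, symmetric])
  also have "\<dots> = (LINT u|unit. F (g u))"
    unfolding pair_law_eq_inverse_law inverse_law_def by (rule integral_distr[OF g_measurable Fm])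
  also have "\<dots> = mixed_exponent g \<psi> y" by (simp add: mixed_exponent_unit F_def)
  finally show ?thesis .
qed

end

theorem proposition1:
  fixes \<nu> :: "(real ^ 'd) measure"
    and M :: "'w measure" and Y :: "real \<Rightarrow> 'w \<Rightarrow> real ^ 'd"
    and \<alpha> \<beta> :: real
  assumes "\<nu> \<in> ID"
    and "levy_process M Y" and "distr M borel (Y 1) = \<nu>"
    and "\<alpha> > 0" and "\<beta> > 0" and "\<alpha> \<noteq> \<beta>"
  shows "bij_betw (time_change \<alpha> \<beta>) {0..1} {0..1}
    \<and> continuous_on {0..1} (time_change \<alpha> \<beta>)
    \<and> strict_mono_on {0..1} (time_change \<alpha> \<beta>)
    \<and> (\<forall>u\<in>{0..1}. time_change \<alpha> \<beta> u = time_change \<beta> \<alpha> u)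
    \<and> J_map \<alpha> (J_map \<beta> \<nu>) = integral_law M Y (\<lambda>u. u) (time_change \<alpha> \<beta>)
    \<and> J_map \<alpha> (J_map \<beta> \<nu>) = integral_law M Y (the_inv_into {0..1} (time_change \<alpha> \<beta>)) (\<lambda>u. u)"
proof -
  interpret two_exponents \<alpha> \<beta> using assms by unfold_locales
  interpret Y: levy_process M Y by fact
  let ?h = "\<lambda>a t. t powr (1 / a) :: real"
  have h: "mono_on {0..1} (?h a)" "continuous_on {0..1} (?h a)" if "0 < a" for a
    using that by (simp_all add: mono_on_powr_unit continuous_on_powr_unit)
  have mono_g: "mono_on {0..1} g" by (rule strict_mono_on_imp_mono_on[OF strict_mono_g])
  have id: "time_scale (\<lambda>u. u)" by unfold_locales (auto intro!: strict_mono_onI)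
  \<comment> \<open>The outer mapping can be evaluated only through a process representing the inner
    law.\<close>
  obtain N :: "(real \<Rightarrow> real ^ 'd) measure" and Z where
    Z: "levy_process N Z" "distr N borel (Z 1) = integral_law M Y (?h \<beta>) (\<lambda>u. u)"
    using Y.levy_process_integral_law_exists[OF h[OF pos(2)]] by blast
  interpret Z: levy_process N Z by fact
  obtain \<psi> where \<psi>: "continuous_on UNIV \<psi>" "\<psi> 0 = 0" "\<And>y. Y.ch 1 y = exp (\<psi> y)"
    by (rule Y.exponent_exists) auto
  define \<Psi> where "\<Psi> = mixed_exponent (?h \<beta>) \<psi>"
  have \<Psi>: "continuous_on UNIV \<Psi>" "\<Psi> 0 = 0"
    unfolding \<Psi>_def using continuous_mixed_exponent[OF \<psi>(1) h(2)[OF pos(2)]]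
    by (simp_all add: mixed_exponent_unit \<psi>(2))
  have chZ: "Z.ch 1 y = exp (\<Psi> y)" for y
    using Z.chf_eq_ch[of 1 y] Y.chf_path_integral[OF h[OF pos(2)], of 1 \<psi> y] \<psi> by (simp add: Z(2) \<Psi>_def)
  have "J_map \<alpha> (J_map \<beta> \<nu>) = integral_law N Z (?h \<alpha>) (\<lambda>u. u)"
    using J_map_eq[OF assms(2,3) pos(2)] Z by (intro J_map_eq[OF Z(1) _ pos(1)]) simp
  also have "\<dots> = integral_law M Y g (\<lambda>u. u)"
  proof (rule chf_unique)
    show "borel_prob (integral_law N Z (?h \<alpha>) (\<lambda>u. u))"
      by (rule Z.borel_prob_integral_law[OF h[OF pos(1)] id])
    show "borel_prob (integral_law M Y g (\<lambda>u. u))"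
      by (rule Y.borel_prob_integral_law[OF mono_g continuous_g id])
    show "chf (integral_law N Z (?h \<alpha>) (\<lambda>u. u)) = chf (integral_law M Y g (\<lambda>u. u))"
    proof
      fix y
      have "chf (integral_law N Z (?h \<alpha>) (\<lambda>u. u)) y = exp (mixed_exponent (?h \<alpha>) \<Psi> y)"
        using Z.chf_path_integral[OF h[OF pos(1)], of 1 \<Psi> y] \<Psi> chZ by simp
      also have "\<dots> = exp (mixed_exponent g \<psi> y)"
        unfolding \<Psi>_def mixed_exponent_comp[OF \<psi>(1)] ..
      also have "\<dots> = chf (integral_law M Y g (\<lambda>u. u)) y"
        using Y.chf_path_integral[OF mono_g continuous_g, of 1 \<psi> y] \<psi> by simp
      finally show "chf (integral_law N Z (?h \<alpha>) (\<lambda>u. u)) y = chf (integral_law M Y g (\<lambda>u. u)) y" .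
    qed
  qed
  finally have J: "J_map \<alpha> (J_map \<beta> \<nu>) = integral_law M Y g (\<lambda>u. u)" .
  \<comment> \<open>Here the two integrals agree along every path, whereas the previous equality was
    one of laws only.\<close>
  have "integral_law M Y (\<lambda>u. u) r = integral_law M Y g (\<lambda>u. u)"
    unfolding integral_law_def
    by (intro distr_cong refl path_integral_inverse_time Y.cadlag_paths continuous_r strict_mono_r
        continuous_g strict_mono_g r_0 r_1 g_0 g_1 r_g)
  with J show ?thesis
    using bij_r continuous_r strict_mono_r time_change_sym[OF neq] by (simp add: g_def)
qed

end
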